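(* Let $a,b\in\overline B$, $a\neq b$. If a function $f\in C^\infty(bB)$ extends holomorphically along each complex line in $\mathcal L(a)\cup\mathcal L(b)$ that meets $B$, then $f$ extends holomorphically through $B$.
   Context: $B$ is the open unit ball in $\mathbb C^2$, $\overline B$ its closure and $bB$ its boundary (the unit sphere). Functions are complex valued. Complex lines are affine complex lines in $\mathbb C^2$; for $a\in\mathbb C^2$, $\mathcal L(a)$ denotes the family of all complex lines passing through $a$. If $f$ is a continuous function on $bB$ and $L$ is a complex line that meets $B$, then $f$ extends holomorphically along $L$ if $f|_{L\cap bB}$ has a continuous extension to $L\cap\overline B$ which is holomorphic on $L\cap B$. A continuous function $f$ on $bB$ extends holomorphically through $B$ if it has a continuous extension to $\overline B$ which is holomorphic on $B$. *)

theory Defs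
  imports "HOL-Analysis.Analysis"
begin

text \<open>The unit ball, its closure and its boundary in \<open>\<complex>\<^sup>2\<close> are
  \<^term>\<open>ball (0 :: complex^2) 1\<close>, \<^term>\<open>cball (0 :: complex^2) 1\<close> and
  \<^term>\<open>sphere (0 :: complex^2) 1\<close>; the norm of \<^typ>\<open>complex^2\<close> is the Euclidean one.\<close>

text \<open>Functions of class \<open>C\<^sup>k\<close> (in the real sense) on an open set \<open>U\<close> of a finite-dimensional
  space: \<open>v\<close> ranges over all real directions.\<close>

primrec Ck_on :: "nat \<Rightarrow> ('a::real_normed_vector \<Rightarrow> 'b::real_normed_vector) \<Rightarrow> 'a set \<Rightarrow> bool" where
  "Ck_on 0 f U \<longleftrightarrow> continuous_on U f"
| "Ck_on (Suc k) f U \<longleftrightarrow> (\<forall>x\<in>U. f differentiable (at x)) \<and>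
     (\<forall>v. Ck_on k (\<lambda>x. frechet_derivative f (at x) v) U)"

text \<open>Smooth functions on a subset that need not be open, such as a closed submanifold:
  restrictions of functions that are smooth on a neighbourhood.\<close>

definition smooth_on :: "('a::real_normed_vector \<Rightarrow> 'b::real_normed_vector) \<Rightarrow> 'a set \<Rightarrow> bool" where
  "smooth_on f S \<longleftrightarrow>
     (\<exists>U g. open U \<and> S \<subseteq> U \<and> (\<forall>k. Ck_on k g U) \<and> (\<forall>x\<in>S. g x = f x))"

definition complex_line :: "complex^'n::finite \<Rightarrow> complex^'n \<Rightarrow> (complex^'n) set" where
  "complex_line p v = {p + \<zeta> *s v | \<zeta>. True}"

definition complex_lines_through :: "complex^'n::finite \<Rightarrow> (complex^'n) set set" where
  "complex_lines_through a = {L. a \<in> L \<and> (\<exists>p v. v \<noteq> 0 \<and> L = complex_line p v)}"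

text \<open>Complex differentiability relative to \<open>S\<close>, for functions of several complex variables.
  The derivative is taken within \<open>S\<close>, so that the definition covers both open subsets of
  \<open>\<complex>\<^sup>n\<close> and relatively open subsets of complex lines; see
  \<open>holomorphic_in_on_line_iff\<close> for the latter.\<close>

definition holomorphic_in_on :: "(complex^'n::finite \<Rightarrow> complex) \<Rightarrow> (complex^'n) set \<Rightarrow> bool" where
  "holomorphic_in_on F S \<longleftrightarrow>
     (\<forall>z\<in>S. \<exists>D. (F has_derivative D) (at z within S) \<and> (\<forall>c w. D (c *s w) = c * D w))"

definition extends_holomorphically_along :: "(complex^2 \<Rightarrow> complex) \<Rightarrow> (complex^2) set \<Rightarrow> bool" where
  "extends_holomorphically_along f L \<longleftrightarrow>
     (\<exists>F. continuous_on (L \<inter> cball 0 1) F \<and> (\<forall>z \<in> L \<inter> sphere 0 1. F z = f z) \<and>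
          holomorphic_in_on F (L \<inter> ball 0 1))"

definition extends_holomorphically_through_ball :: "(complex^2 \<Rightarrow> complex) \<Rightarrow> bool" where
  "extends_holomorphically_through_ball f \<longleftrightarrow>
     (\<exists>F. continuous_on (cball 0 1) F \<and> (\<forall>z \<in> sphere 0 1. F z = f z) \<and>
          holomorphic_in_on F (ball 0 1))"

lemma norm_vector_scalar_mult: "norm (c *s v) = cmod c * norm v"
  for v :: "complex^'n::finite"
  by (simp add: norm_vec_def norm_mult L2_set_right_distrib)

lemma bounded_linear_scalar_left: "bounded_linear (\<lambda>\<zeta>. \<zeta> *s v)"
  for v :: "complex^'n::finite"
  by (rule bounded_linear_intro[where K = "norm v"])
     (auto simp: norm_vector_scalar_mult vec_eq_iff algebra_simps)

lemma holomorphic_in_on_line_iff: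
  fixes p v :: "complex^'n::finite"
  assumes "v \<noteq> 0"
  shows "holomorphic_in_on F (complex_line p v \<inter> U) \<longleftrightarrow>
         (\<lambda>\<zeta>. F (p + \<zeta> *s v)) holomorphic_on {\<zeta>. p + \<zeta> *s v \<in> U}"
    (is "holomorphic_in_on F ?S \<longleftrightarrow> ?g holomorphic_on ?T")
proof -
  obtain i where i: "v $ i \<noteq> 0"
    using assms by (auto simp: vec_eq_iff)
  define \<phi> where "\<phi> = (\<lambda>\<zeta>. p + \<zeta> *s v)"
  define \<psi> where "\<psi> = (\<lambda>z :: complex^'n. (z $ i - p $ i) / v $ i)"
  have \<psi>\<phi>: "\<psi> (\<phi> \<zeta>) = \<zeta>" for \<zeta>
    using i by (simp add: \<phi>_def \<psi>_def)
  have S: "?S = \<phi> ` ?T"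
    by (auto simp: complex_line_def \<phi>_def)
  have T: "?T = \<psi> ` ?S"
    unfolding S by (simp add: image_image \<psi>\<phi>)
  have d\<phi>: "(\<phi> has_derivative (\<lambda>h. h *s v)) (at \<zeta> within A)" for \<zeta> A
    using has_derivative_add[OF has_derivative_const
        bounded_linear_imp_has_derivative[OF bounded_linear_scalar_left]]
    unfolding \<phi>_def by fastforce
  have d\<psi>: "(\<psi> has_derivative (\<lambda>h. h $ i / v $ i)) (at z within A)" for z A
  proof -
    have "((\<lambda>z. z $ i - p $ i) has_derivative (\<lambda>h. h $ i)) (at z within A)"
      using has_derivative_diff[OF bounded_linear_imp_has_derivative[OF bounded_linear_vec_nth]
          has_derivative_const] by fastforce
    from has_derivative_mult_left[OF this, of "inverse (v $ i)"] show ?thesis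
      by (simp add: \<psi>_def divide_inverse)
  qed
  show ?thesis
  proof
    assume hol: "holomorphic_in_on F ?S"
    show "?g holomorphic_on ?T"
      unfolding holomorphic_on_def
    proof
      fix \<zeta> assume "\<zeta> \<in> ?T"
      then have "\<phi> \<zeta> \<in> ?S"
        by (subst S) blast
      then obtain D where D: "(F has_derivative D) (at (\<phi> \<zeta>) within ?S)"
          "\<And>c w. D (c *s w) = c * D w"
        using hol unfolding holomorphic_in_on_def by meson
      have "(F \<circ> \<phi> has_derivative D \<circ> (\<lambda>h. h *s v)) (at \<zeta> within ?T)"
        using diff_chain_within[OF d\<phi>] D(1) S by metis
      then have "(?g has_derivative (\<lambda>h. D v * h)) (at \<zeta> within ?T)"
        by (simp add: o_def \<phi>_def D(2) mult.commute)
      then show "?g field_differentiable at \<zeta> within ?T"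
        by (auto simp: field_differentiable_def has_field_derivative_def)
    qed
  next
    assume hol: "?g holomorphic_on ?T"
    show "holomorphic_in_on F ?S"
      unfolding holomorphic_in_on_def
    proof
      fix z assume z: "z \<in> ?S"
      then have "\<psi> z \<in> ?T"
        by (subst T) blast
      then obtain d where d: "(?g has_derivative (*) d) (at (\<psi> z) within \<psi> ` ?S)"
        using hol T unfolding holomorphic_on_def field_differentiable_def has_field_derivative_def
        by metis
      have "(?g \<circ> \<psi> has_derivative (*) d \<circ> (\<lambda>h. h $ i / v $ i)) (at z within ?S)"
        by (rule diff_chain_within[OF d\<psi> d])
      then have "(F has_derivative (*) d \<circ> (\<lambda>h. h $ i / v $ i)) (at z within ?S)"
      proof (rule has_derivative_transform[OF z, rotated])
        fix w assume "w \<in> ?S"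
        then obtain \<zeta> where "w = \<phi> \<zeta>"
          unfolding S by blast
        then show "F w = (?g \<circ> \<psi>) w"
          by (simp only: o_apply \<psi>\<phi>) (simp only: \<phi>_def)
      qed
      then show "\<exists>D. (F has_derivative D) (at z within ?S) \<and> (\<forall>c w. D (c *s w) = c * D w)"
        by (intro exI conjI, assumption) (simp add: mult_ac)
    qed
  qed
qed

end

theory Submission
  imports Defs "HOL-Complex_Analysis.Complex_Analysis"
begin

text \<open>An automorphism of the ball moves \<open>a\<close> and \<open>b\<close> to points \<open>(\<alpha>, 0)\<close> and \<open>(\<beta>, 0)\<close> with real \<open>\<alpha> < 0 < \<beta>\<close>.
  The hypothesis is then invariant under rotations of the second coordinate \<open>w\<close>, so it passes to the
  Fourier components of \<open>f\<close> in the angle of \<open>w\<close>. By smoothness, the component of order \<open>n \<ge> 0\<close> is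
  \<open>w ^ n * G z\<close> with \<open>G\<close> continuous on the closed disc, and \<open>g z = (z - \<alpha>) ^ n * (z - \<beta>) ^ n * G z\<close> extends
  holomorphically from each circle of the two pencils into which the lines through \<open>(\<alpha>, 0)\<close> and
  \<open>(\<beta>, 0)\<close> project.

  Such a \<open>g\<close> is holomorphic. For \<open>\<alpha> < p < \<beta>\<close> consider the area mean of
  \<open>g z / ((1 - p * cnj z)\<^sup>2 * (\<mu> - z))\<close> as a function of \<open>\<mu>\<close> with \<open>\<bar>\<mu>\<bar> > 1\<close>. Integrating first over the circles of
  one pencil shows that it continues analytically to the complement of the segment from \<open>\<alpha>\<close> to \<open>p\<close>,
  and the other pencil gives the complement of the segment from \<open>p\<close> to \<open>\<beta>\<close>. Together with a growth
  estimate at \<open>p\<close>, Liouville's theorem makes it a multiple of \<open>1 / (\<mu> - p)\<close>. Comparing the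
  expansions in \<open>\<mu>\<close> and \<open>p\<close>, the moments of \<open>g\<close> are those of a holomorphic function.

  The components of negative order \<open>- m\<close> vanish: multiplied by \<open>w ^ m\<close> they become holomorphic functions of \<open>z\<close>
  that are zero on the unit circle. Hence \<open>f\<close> is a uniform limit of sums of terms \<open>w ^ n * G z\<close>,
  and the maximum principle on the discs with \<open>z\<close> fixed carries the limit into the ball.\<close>

section \<open>Approximation by trigonometric polynomials\<close>

text \<open>Smoothness is what makes \<open>G\<close> continuous up to the unit circle, and no
  finite class \<open>C\<^sup>k\<close> suffices. On the sphere, \<open>w ^ n / cnj w\<close> (0
  where \<open>w = 0\<close>) is of class \<open>C\<^sup>k\<close> for large \<open>n\<close>. It
  extends along every line through every real point \<open>(\<alpha>, 0)\<close> of the closed ball: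
  on \<open>w = c * (z - \<alpha>)\<close> with \<open>c\<close> nonzero, \<open>1 / cnj w\<close>
  is fractional linear in \<open>z\<close> with its pole outside the open unit disc, and on
  \<open>z = \<alpha>\<close> it is a multiple of \<open>w\<close>. Yet it equals
  \<open>w ^ (n + 1) / (1 - \<bar>z\<bar>\<^sup>2)\<close>, whose coefficient is not holomorphic.

  The kernel is antiholomorphic in \<open>z\<close>, but on each circle of a pencil
  \<open>cnj z\<close> is fractional linear in \<open>z\<close>. The kernel therefore continues
  meromorphically from the circle, with one double pole on the real axis. As the circle runs through
  the pencil, this pole moves from \<open>p\<close> to the centre of the pencil: this is the origin
  of the two segments, which share only \<open>p\<close> when \<open>\<alpha> < p < \<beta>\<close>.
  The normalisation \<open>\<alpha> < 0 < \<beta>\<close> lets \<open>p\<close> tend to 0, so that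
  power series in \<open>p\<close> can be compared.\<close>

definition rot :: "real \<Rightarrow> complex" where
  "rot t = cis (2 * pi * t)"

lemma norm_rot [simp]: "norm (rot t) = 1"
  by (simp add: rot_def)

lemma rot_0 [simp]: "rot 0 = 1"
  by (simp add: rot_def)

lemma rot_1 [simp]: "rot 1 = 1"
  by (simp add: rot_def cis.ctr complex_eq_iff)

lemma rot_nonzero [simp]: "rot t \<noteq> 0"
  by (simp add: rot_def)

lemma rot_add: "rot (s + t) = rot s * rot t"
  by (simp add: rot_def cis_mult algebra_simps)

lemma rot_minus: "rot (- t) = cnj (rot t)"
  by (simp add: rot_def cis_cnj)

lemma rot_cnj_mult [simp]: "rot t * cnj (rot t) = 1" "cnj (rot t) * rot t = 1"
  by (simp_all flip: rot_minus rot_add)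

lemma rot_int [simp]: "rot (of_int n) = 1"
  by (simp add: rot_def cis.ctr complex_eq_iff)

lemma rot_power: "rot t ^ n = rot (of_nat n * t)"
  by (simp add: rot_def Complex.DeMoivre mult_ac)

lemma continuous_on_rot [continuous_intros]:
  "continuous_on S f \<Longrightarrow> continuous_on S (\<lambda>x. rot (f x))"
  unfolding rot_def by (auto intro!: continuous_intros)

lemma rot_has_vector_derivative:
  "((\<lambda>t. rot (k * t)) has_vector_derivative (of_real (2 * pi * k) * \<i> * rot (k * t))) (at t within S)"
proof -
  define c where "c = of_real (2 * pi * k) * \<i>"
  have "((\<lambda>z. exp (c * z)) has_field_derivative c * exp (c * of_real t)) (at (of_real t))"
    by (auto intro!: derivative_eq_intros)
  from has_vector_derivative_real_field[OF this, of S] show ?thesis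
    by (simp add: rot_def cis_conv_exp c_def mult_ac)
qed

lemma rot_surj:
  assumes "norm z = 1"
  obtains t where "t \<in> {0..1}" "z = rot t"
proof -
  have "z \<noteq> 0" using assms by auto
  define t where "t = Arg2pi z / (2*pi)"
  have "t \<in> {0..1}" using Arg2pi[of z] by (auto simp: t_def)
  moreover have "z = rot t" using Arg2pi_eq[of z] assms by (simp add: t_def rot_def cis_conv_exp)
  ultimately show ?thesis using that by blast
qed

text \<open>Bivariate polynomials in \<open>z\<close> and \<open>cnj z\<close> are encoded as \<open>complex poly poly\<close>, which makes
  the closure under multiplication immediate.\<close>

lemma real_polynomial_function_complex:
  fixes p :: "complex \<Rightarrow> real"
  assumes "real_polynomial_function p"
  shows "\<exists>P. \<forall>z. of_real (p z) = poly (poly P [:z:]) (cnj z)"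
  using assms
proof induction
  case (linear L)
  then interpret bounded_linear L .
  have L: "L z = Re z * L 1 + Im z * L \<i>" for z
  proof -
    have "z = Re z *\<^sub>R 1 + Im z *\<^sub>R \<i>" by (simp add: complex_eq_iff)
    then have "L z = L (Re z *\<^sub>R 1 + Im z *\<^sub>R \<i>)" by simp
    then show ?thesis by (simp add: add scale)
  qed
  \<comment> \<open>\<open>a\<close> is the Wirtinger derivative of \<open>L\<close>: a real-valued
    real-linear map is \<open>a * z + cnj a * cnj z\<close>.\<close>
  define a where "a = (of_real (L 1) - \<i> * of_real (L \<i>)) / 2"
  have "of_real (L z) = poly (poly [:[:0, cnj a:], [:a:]:] [:z:]) (cnj z)" for z
    by (subst L) (simp add: a_def complex_eq_iff field_simps)
  then show ?case by blast
next
  case (const c)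
  have "of_real c = poly (poly [:[:of_real c:]:] [:z:]) (cnj z)" for z by simp
  then show ?case by blast
next
  case (add f g)
  then obtain P Q where "\<forall>z. of_real (f z) = poly (poly P [:z:]) (cnj z)" 
     "\<forall>z. of_real (g z) = poly (poly Q [:z:]) (cnj z)" by blast
  then have "\<forall>z. of_real (f z + g z) = poly (poly (P + Q) [:z:]) (cnj z)" by simp
  then show ?case by blast
next
  case (mult f g)
  then obtain P Q where "\<forall>z. of_real (f z) = poly (poly P [:z:]) (cnj z)" 
     "\<forall>z. of_real (g z) = poly (poly Q [:z:]) (cnj z)" by blast
  then have "\<forall>z. of_real (f z * g z) = poly (poly (P * Q) [:z:]) (cnj z)" by simp
  then show ?case by blast
qed

text \<open>The monomials are convenient in three settings: on the unit circle they are integer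
  frequencies of \<open>rot\<close>, Green's formula has an explicit antiderivative for them, and on
  a real segment they are ordinary powers.\<close>

lemma Stone_Weierstrass_complex:
  fixes u :: "complex \<Rightarrow> complex"
  assumes "compact S" "continuous_on S u" "0 < \<epsilon>"
  obtains c :: "nat \<Rightarrow> nat \<Rightarrow> complex" and N :: nat
  where "\<And>z. z \<in> S \<Longrightarrow> norm (u z - (\<Sum>i<N. \<Sum>j<N. c i j * (z ^ i * cnj z ^ j))) < \<epsilon>"
proof -
  obtain g where g: "polynomial_function g" "\<And>z. z \<in> S \<Longrightarrow> norm (u z - g z) < \<epsilon>"
    using Stone_Weierstrass_polynomial_function[OF assms] by blast
  have "real_polynomial_function (\<lambda>z. Re (g z))" "real_polynomial_function (\<lambda>z. Im (g z))"
    using g(1) polynomial_function_iff_Basis_inner[of g] by (auto simp: Basis_complex_def inner_complex_def)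
  then obtain P Q where PQ: "\<And>z. of_real (Re (g z)) = poly (poly P [:z:]) (cnj z)"
      "\<And>z. of_real (Im (g z)) = poly (poly Q [:z:]) (cnj z)"
    using real_polynomial_function_complex by metis
  define R where "R = P + [:[:\<i>:]:] * Q"
  have R: "g z = poly (poly R [:z:]) (cnj z)" for z
    unfolding R_def by (subst complex_eq) (simp add: PQ)
  define N where "N = Suc (degree R + (\<Sum>i\<le>degree R. degree (coeff R i)))"
  define c where "c i j = coeff (coeff R i) j" for i j
  have "g z = (\<Sum>i<N. \<Sum>j<N. c i j * (z ^ i * cnj z ^ j))" for z
  proof -
    have "poly R [:z:] = (\<Sum>i<N. coeff R i * [:z:] ^ i)"
      unfolding poly_altdef by (rule sum.mono_neutral_left) (auto simp: N_def coeff_eq_0)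
    then have "g z = (\<Sum>i<N. poly (coeff R i) (cnj z) * z ^ i)"
      by (simp add: R poly_sum)
    also have "\<dots> = (\<Sum>i<N. (\<Sum>j<N. c i j * cnj z ^ j) * z ^ i)"
    proof (intro sum.cong refl arg_cong2[where f = times])
      fix i
      have "degree (coeff R i) < N"
      proof (cases "i \<le> degree R")
        case True
        then have "degree (coeff R i) \<le> (\<Sum>i\<le>degree R. degree (coeff R i))"
          by (intro member_le_sum) auto
        then show ?thesis by (simp add: N_def)
      qed (simp add: coeff_eq_0 N_def)
      then show "poly (coeff R i) (cnj z) = (\<Sum>j<N. c i j * cnj z ^ j)"
        unfolding poly_altdef c_def by (intro sum.mono_neutral_left) (auto simp: coeff_eq_0)
    qed
    finally show ?thesis by (simp add: sum_distrib_left sum_distrib_right mult_ac)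
  qed
  then show ?thesis using g(2) by (intro that[where N = N and c = c]) auto
qed

text \<open>The kernel is a trigonometric polynomial close to a normalised bump function.\<close>

lemma trigonometric_kernel:
  assumes "\<delta> > 0" "\<eta> > 0"
  obtains c :: "nat \<Rightarrow> nat \<Rightarrow> complex" and N :: nat
  where "\<And>h M \<omega>. continuous_on (sphere 0 1) h \<Longrightarrow> (\<And>u. norm u = 1 \<Longrightarrow> norm (h u) \<le> M) \<Longrightarrow>
    (\<And>u. norm u = 1 \<Longrightarrow> norm (u - 1) < \<delta> \<Longrightarrow> norm (h u - h 1) \<le> \<omega>) \<Longrightarrow>
    norm ((\<Sum>i<N. \<Sum>j<N. c i j * integral {0..1} (\<lambda>t. h (rot t) * rot (of_int (int i - int j) * t))) - h 1)
      \<le> \<omega> + \<eta> * M"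
proof -
  \<comment> \<open>A tent around 1 that vanishes from distance \<delta> on. Its sign and support
    will give the term \<omega>; the polynomial close to it may change sign, which costs the term
    \<open>\<eta> * M\<close>.\<close>
  define b0 :: "complex \<Rightarrow> real" where "b0 u = max 0 (\<delta> - norm (u - 1))" for u
  have cb0: "continuous_on A b0" for A unfolding b0_def by (intro continuous_intros)
  define I where "I = integral {0..1} (\<lambda>t. b0 (rot t))"
  have cb0r: "continuous_on {0..1} (\<lambda>t. b0 (rot t))"
    unfolding b0_def by (intro continuous_intros)
  have "I \<noteq> 0"
  proof
    assume "I = 0"
    then have "\<forall>t\<in>{0..1}. b0 (rot t) = 0"
      unfolding I_def using cb0r by (subst (asm) integral_eq_0_iff) (auto simp: b0_def)
    then have "b0 (rot 0) = 0" by force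
    then show False using assms by (simp add: b0_def)
  qed
  moreover have "I \<ge> 0" unfolding I_def by (rule integral_nonneg) (auto intro!: integrable_continuous_real cb0r, auto simp: b0_def)
  ultimately have I: "I > 0" by simp
  define b :: "complex \<Rightarrow> real" where "b u = b0 u / I" for u
  have cb: "continuous_on A b" for A unfolding b_def using I by (intro continuous_intros cb0) auto
  have b0: "b u \<ge> 0" for u using I by (simp add: b_def b0_def)
  have cbr: "continuous_on {0..1} (\<lambda>t. b (rot t))"
    using I unfolding b_def by (intro continuous_intros cb0r) auto
  have b1: "integral {0..1} (\<lambda>t. b (rot t)) = 1"
    using I by (simp add: b_def I_def)
  have "continuous_on (sphere 0 1) (\<lambda>u. complex_of_real (b u))"
    by (intro continuous_intros cb)
  then obtain c N where c: "\<And>z. z \<in> sphere 0 1 \<Longrightarrow>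
      norm (of_real (b z) - (\<Sum>i<N. \<Sum>j<N. c i j * (z ^ i * cnj z ^ j))) < \<eta>"
    by (rule Stone_Weierstrass_complex[OF compact_sphere _ assms(2)]) blast
  show ?thesis
  proof (rule that[where c = c and N = N])
    fix h :: "complex \<Rightarrow> complex" and M \<omega>
    assume ch: "continuous_on (sphere 0 1) h" and M: "\<And>u. norm u = 1 \<Longrightarrow> norm (h u) \<le> M"
      and w: "\<And>u. norm u = 1 \<Longrightarrow> norm (u - 1) < \<delta> \<Longrightarrow> norm (h u - h 1) \<le> \<omega>"
    have w0: "\<omega> \<ge> 0" using w[of 1] assms by (auto intro: order_trans[OF norm_ge_zero])
    have chr: "continuous_on {0..1} (\<lambda>t. h (rot t))"
      by (rule continuous_on_compose2[OF ch]) (auto intro!: continuous_intros)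
    define k where "k z = (\<Sum>i<N. \<Sum>j<N. c i j * (z ^ i * cnj z ^ j))" for z
    have k: "k (rot t) = (\<Sum>i<N. \<Sum>j<N. c i j * rot (of_int (int i - int j) * t))" for t
    proof -
      have "rot t ^ i * cnj (rot t) ^ j = rot (of_int (int i - int j) * t)" for i j
        by (simp add: rot_power flip: rot_minus rot_add) (simp add: algebra_simps)
      then show ?thesis by (simp add: k_def)
    qed
    have "(\<Sum>i<N. \<Sum>j<N. c i j * integral {0..1} (\<lambda>t. h (rot t) * rot (of_int (int i - int j) * t)))
       = (\<Sum>i<N. \<Sum>j<N. integral {0..1} (\<lambda>t. c i j * (h (rot t) * rot (of_int (int i - int j) * t))))"
      by simp
    also have "\<dots> = (\<Sum>i<N. integral {0..1} (\<lambda>t. \<Sum>j<N. c i j * (h (rot t) * rot (of_int (int i - int j) * t))))"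
      by (intro sum.cong refl integral_sum[symmetric] integrable_continuous_real continuous_intros chr) auto
    also have "\<dots> = integral {0..1} (\<lambda>t. \<Sum>i<N. \<Sum>j<N. c i j * (h (rot t) * rot (of_int (int i - int j) * t)))"
      by (intro integral_sum[symmetric] integrable_continuous_real continuous_intros chr) auto
    also have "\<dots> = integral {0..1} (\<lambda>t. h (rot t) * k (rot t))"
      by (simp add: k sum_distrib_left mult_ac)
    finally have eq: "(\<Sum>i<N. \<Sum>j<N. c i j * integral {0..1} (\<lambda>t. h (rot t) * rot (of_int (int i - int j) * t)))
        = integral {0..1} (\<lambda>t. h (rot t) * k (rot t))" .
    have ckr: "continuous_on {0..1} (\<lambda>t. k (rot t))" unfolding k_def by (intro continuous_intros)
    have cbrc: "continuous_on {0..1} (\<lambda>t. complex_of_real (b (rot t)))" by (intro continuous_intros cbr)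
    have hb1: "integral {0..1} (\<lambda>t. h 1 * of_real (b (rot t))) = h 1"
    proof -
      have "((\<lambda>t. b (rot t)) has_integral 1) {0..1}"
        using integrable_integral[OF integrable_continuous_real[OF cbr]] b1 by simp
      from has_integral_mult_right[OF has_integral_of_real[OF this], of "h 1"] show ?thesis
        by (intro integral_unique) simp
    qed
    have "integral {0..1} (\<lambda>t. h (rot t) * k (rot t)) - h 1 =
       integral {0..1} (\<lambda>t. h (rot t) * k (rot t)) - integral {0..1} (\<lambda>t. h 1 * of_real (b (rot t)))"
      by (simp only: hb1)
    also have "\<dots> = integral {0..1} (\<lambda>t. h (rot t) * k (rot t) - h 1 * of_real (b (rot t)))"
      by (intro integral_diff[symmetric] integrable_continuous_real continuous_intros chr ckr cbrc)
    \<comment> \<open>The first product is at most \<open>\<omega> * b\<close>: near 1 by the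
      assumption on \<open>h\<close>, elsewhere because \<open>b\<close> is 0. The second carries
      the error of the polynomial approximation.\<close>
    also have "\<dots> = integral {0..1} (\<lambda>t. (h (rot t) - h 1) * of_real (b (rot t)) + h (rot t) * (k (rot t) - of_real (b (rot t))))"
      (is "_ = integral _ ?f")
      by (intro integral_cong) (simp add: algebra_simps)
    also have "norm \<dots> \<le> integral {0..1} (\<lambda>t. \<omega> * b (rot t) + \<eta> * M)"
    proof (rule integral_norm_bound_integral)
      show "?f integrable_on {0..1}"
        by (auto intro!: integrable_continuous_real continuous_intros chr ckr cbrc)
      show "(\<lambda>t. \<omega> * b (rot t) + \<eta> * M) integrable_on {0..1}"
        by (auto intro!: integrable_continuous_real continuous_intros cbr)
      fix t :: real
      have "norm (h (rot t) - h 1) * b (rot t) \<le> \<omega> * b (rot t)"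
      proof (cases "norm (rot t - 1) < \<delta>")
        case True
        then show ?thesis by (intro mult_right_mono w b0) auto
      qed (simp add: b_def b0_def)
      moreover have "0 \<le> M"
        using M[of 1] by (auto intro: order_trans[OF norm_ge_zero])
      then have "norm (h (rot t)) * norm (k (rot t) - of_real (b (rot t))) \<le> M * \<eta>"
        using c[of "rot t"] by (intro mult_mono M) (auto simp: k_def norm_minus_commute intro: order_trans[OF norm_ge_zero M])
      ultimately show "norm (?f t) \<le> \<omega> * b (rot t) + \<eta> * M"
        using b0[of "rot t"] by (intro order_trans[OF norm_triangle_ineq]) (simp add: norm_mult mult.commute)
    qed
    also have "\<dots> = \<omega> + \<eta> * M"
      using b1 by (subst integral_add) (auto intro!: integrable_continuous_real continuous_intros cbr)
    finally show "norm ((\<Sum>i<N. \<Sum>j<N. c i j * integral {0..1} (\<lambda>t. h (rot t) * rot (of_int (int i - int j) * t))) - h 1)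
      \<le> \<omega> + \<eta> * M" by (simp only: eq)
  qed
qed

section \<open>Area means over families of circles\<close>

text \<open>With \<open>l = k / (1 + k)\<close>, the circles \<open>\<bar>z\<bar>\<^sup>2 + k * \<bar>z - a\<bar>\<^sup>2 = 1\<close> are the projections to the first
  coordinate of the sections of the sphere by the complex lines \<open>w = c * (z - a)\<close> with \<open>\<bar>c\<bar>\<^sup>2 = k\<close>.
  The density is the Jacobian of \<open>(l, t) \<mapsto> z\<close> divided by \<open>pi\<close>, so that \<open>disc_mean a\<close> is the
  normalised area mean for every \<open>a\<close>.\<close>

definition circle_radius :: "real \<Rightarrow> real \<Rightarrow> real" where
  "circle_radius a l = sqrt ((1 - l) * (1 - l * a\<^sup>2))"

definition circle_point :: "real \<Rightarrow> real \<Rightarrow> real \<Rightarrow> complex" where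
  "circle_point a l t = of_real (l * a) + of_real (circle_radius a l) * rot t"

definition circle_density :: "real \<Rightarrow> real \<Rightarrow> real \<Rightarrow> complex" where
  "circle_density a l t = of_real (1 + a\<^sup>2 - 2 * a * Re (circle_point a l t))"

definition disc_mean :: "real \<Rightarrow> (complex \<Rightarrow> complex) \<Rightarrow> complex" where
  "disc_mean a k = integral {0..1} (\<lambda>l. integral {0..1} (\<lambda>t. k (circle_point a l t) * circle_density a l t))"

text \<open>The last bound keeps the circle with centre \<open>l * a\<close> inside the closed unit
  disc; the difference of the squares of its two sides is
  \<open>l * (1 - \<bar>a\<bar>) ^ 2\<close>.\<close>

lemma circle_radius_facts:
  assumes "\<bar>a\<bar> \<le> 1" "0 \<le> l" "l \<le> 1"
  shows "l * a\<^sup>2 \<le> l" "0 \<le> circle_radius a l" "(circle_radius a l)\<^sup>2 = (1 - l) * (1 - l * a\<^sup>2)" "circle_radius a l \<le> 1 - l * \<bar>a\<bar>"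
proof -
  have a2: "a\<^sup>2 \<le> 1" using assms by (simp add: abs_square_le_1)
  show la: "l * a\<^sup>2 \<le> l" using mult_left_mono[OF a2 assms(2)] by simp
  have nn: "0 \<le> (1 - l) * (1 - l * a\<^sup>2)" using la assms by (intro mult_nonneg_nonneg) auto
  show "0 \<le> circle_radius a l" using nn by (simp add: circle_radius_def)
  show "(circle_radius a l)\<^sup>2 = (1 - l) * (1 - l * a\<^sup>2)" using nn by (simp add: circle_radius_def)
  have "l * \<bar>a\<bar> \<le> 1" using mult_mono[of l 1 "\<bar>a\<bar>" 1] assms by simp
  moreover have "(1 - l) * (1 - l * a\<^sup>2) \<le> (1 - l * \<bar>a\<bar>)\<^sup>2"
  proof -
    have "0 \<le> l * (1 - \<bar>a\<bar>)\<^sup>2" using assms by simp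
    also have "\<dots> = (1 - l * \<bar>a\<bar>)\<^sup>2 - (1 - l) * (1 - l * \<bar>a\<bar>\<^sup>2)"
      by (simp add: power2_eq_square algebra_simps)
    finally show ?thesis by simp
  qed
  ultimately show "circle_radius a l \<le> 1 - l * \<bar>a\<bar>"
    unfolding circle_radius_def by (intro real_le_lsqrt) auto
qed

lemma norm_circle_point_le:
  assumes "\<bar>a\<bar> \<le> 1" "0 \<le> l" "l \<le> 1"
  shows "norm (circle_point a l t) \<le> 1"
proof -
  have "norm (circle_point a l t) \<le> norm (complex_of_real (l * a)) + norm (of_real (circle_radius a l) * rot t)"
    unfolding circle_point_def by (rule norm_triangle_ineq)
  also have "\<dots> = l * \<bar>a\<bar> + circle_radius a l"
    using circle_radius_facts[OF assms] assms by (simp add: norm_mult abs_mult del: of_real_mult)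
  finally show ?thesis using circle_radius_facts(4)[OF assms] by simp
qed

lemma continuous_on_circle_radius [continuous_intros]:
  "continuous_on S f \<Longrightarrow> continuous_on S (\<lambda>x. circle_radius a (f x))"
  unfolding circle_radius_def by (auto intro!: continuous_intros)

lemma continuous_on_circle_point [continuous_intros]:
  "continuous_on S f \<Longrightarrow> continuous_on S g \<Longrightarrow> continuous_on S (\<lambda>x. circle_point a (f x) (g x))"
  unfolding circle_point_def by (auto intro!: continuous_intros)

lemma continuous_on_circle_density [continuous_intros]:
  "continuous_on S f \<Longrightarrow> continuous_on S g \<Longrightarrow> continuous_on S (\<lambda>x. circle_density a (f x) (g x))"
  unfolding circle_density_def by (auto intro!: continuous_intros)

lemma continuous_on_compose_circle_point:
  assumes "continuous_on (cball 0 1) k" "\<bar>a\<bar> \<le> 1" "continuous_on S f" "continuous_on S g" "f ` S \<subseteq> {0..1}"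
  shows "continuous_on S (\<lambda>x. k (circle_point a (f x) (g x)))"
  by (rule continuous_on_compose2[OF assms(1)]) (use assms in \<open>auto intro!: continuous_intros norm_circle_point_le\<close>)

lemma continuous_on_integral_01:
  assumes "continuous_on (U \<times> {0..1::real}) (\<lambda>x. F (fst x) (snd x))"
  shows "continuous_on U (\<lambda>l. integral {0..1} (F l) :: complex)"
  using integral_continuous_on_param[of U 0 1 F] assms by (simp add: case_prod_unfold)

lemma norm_circle_density_le:
  assumes "\<bar>a\<bar> \<le> 1" "0 \<le> l" "l \<le> 1"
  shows "norm (circle_density a l t) \<le> 4"
proof -
  have "\<bar>a * Re (circle_point a l t)\<bar> \<le> 1 * 1"
    unfolding abs_mult using assms norm_circle_point_le[OF assms] abs_Re_le_cmod[of "circle_point a l t"] 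
    by (intro mult_mono) (auto intro: order_trans)
  moreover have "a\<^sup>2 \<le> 1" using assms by (simp add: abs_square_le_1)
  ultimately have "\<bar>1 + a\<^sup>2 - 2 * (a * Re (circle_point a l t))\<bar> \<le> 4"
    using zero_le_power2[of a] by linarith
  then show ?thesis by (simp only: circle_density_def norm_of_real mult.assoc)
qed

context
  fixes a :: real
  assumes a: "\<bar>a\<bar> \<le> 1"
begin

lemma continuous_disc_mean_integrand:
  assumes "continuous_on (cball 0 1) k"
  shows "continuous_on ({0..1} \<times> {0..1}) (\<lambda>x. k (circle_point a (fst x) (snd x)) * circle_density a (fst x) (snd x))"
  by (intro continuous_intros continuous_on_compose_circle_point assms a) auto

lemma disc_mean_inner_continuous:
  assumes "continuous_on (cball 0 1) k"
  shows "continuous_on {0..1} (\<lambda>l. integral {0..1} (\<lambda>t. k (circle_point a l t) * circle_density a l t))"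
  using continuous_on_integral_01[OF continuous_disc_mean_integrand[OF assms]] by simp

lemma disc_mean_inner_integrable:
  assumes "continuous_on (cball 0 1) k" "l \<in> {0..1}"
  shows "(\<lambda>t. k (circle_point a l t) * circle_density a l t) integrable_on {0..1}"
  by (intro integrable_continuous_real continuous_intros continuous_on_compose_circle_point assms a)
     (use assms in auto)

lemma disc_mean_cmult: "disc_mean a (\<lambda>z. c * k z) = c * disc_mean a k"
  by (simp add: disc_mean_def mult.assoc)

lemma disc_mean_cong:
  assumes "\<And>z. norm z \<le> 1 \<Longrightarrow> k z = k' z"
  shows "disc_mean a k = disc_mean a k'"
  unfolding disc_mean_def by (intro integral_cong) (use assms norm_circle_point_le[OF a] in auto)

lemma disc_mean_add:
  assumes "continuous_on (cball 0 1) k" "continuous_on (cball 0 1) k'"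
  shows "disc_mean a (\<lambda>z. k z + k' z) = disc_mean a k + disc_mean a k'"
proof -
  have "disc_mean a (\<lambda>z. k z + k' z) = integral {0..1} (\<lambda>l. integral {0..1} (\<lambda>t. k (circle_point a l t) * circle_density a l t)
      + integral {0..1} (\<lambda>t. k' (circle_point a l t) * circle_density a l t))"
    unfolding disc_mean_def
    by (intro integral_cong) (use disc_mean_inner_integrable assms in \<open>simp add: ring_distribs integral_add\<close>)
  also have "\<dots> = disc_mean a k + disc_mean a k'"
    unfolding disc_mean_def
    by (intro integral_add integrable_continuous_real disc_mean_inner_continuous assms)
  finally show ?thesis .
qed

lemma disc_mean_diff:
  assumes "continuous_on (cball 0 1) k" "continuous_on (cball 0 1) k'"
  shows "disc_mean a (\<lambda>z. k z - k' z) = disc_mean a k - disc_mean a k'"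
  using disc_mean_add[of k "\<lambda>z. (-1) * k' z"] disc_mean_cmult[of "-1" k'] assms
  by (simp add: continuous_on_minus)

lemma disc_mean_sum:
  assumes "finite I" "\<And>i. i \<in> I \<Longrightarrow> continuous_on (cball 0 1) (k i)"
  shows "disc_mean a (\<lambda>z. \<Sum>i\<in>I. k i z) = (\<Sum>i\<in>I. disc_mean a (k i))"
  using assms
proof (induction I rule: finite_induct)
  case empty
  then show ?case by (simp add: disc_mean_def)
next
  case (insert i I)
  then show ?case by (simp add: disc_mean_add continuous_on_sum)
qed

text \<open>The 4 is the crude bound for the density. Some constant is enough, since the lemma
  serves to pass to uniform limits under the mean.\<close>

lemma disc_mean_bound:
  assumes "continuous_on (cball 0 1) k" "\<And>z. norm z \<le> 1 \<Longrightarrow> norm (k z) \<le> M"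
  shows "norm (disc_mean a k) \<le> 4 * M"
proof -
  have in1: "norm (integral {0..1} (\<lambda>t. k (circle_point a l t) * circle_density a l t)) \<le> 4 * M" if "l \<in> {0..1}" for l
  proof -
    have "norm (integral {0..1} (\<lambda>t. k (circle_point a l t) * circle_density a l t)) \<le> integral {0..1} (\<lambda>t::real. M * 4)"
    proof (intro integral_norm_bound_integral disc_mean_inner_integrable assms that)
      fix t :: real
      have "norm (k (circle_point a l t)) \<le> M" using that by (intro assms norm_circle_point_le a) auto
      then show "norm (k (circle_point a l t) * circle_density a l t) \<le> M * 4"
        unfolding norm_mult using that a
        by (intro mult_mono norm_circle_density_le) (auto intro: order_trans[OF norm_ge_zero])
    qed auto
    then show ?thesis by simp
  qed
  have "norm (disc_mean a k) \<le> integral {0..1} (\<lambda>l::real. 4 * M)"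
    unfolding disc_mean_def
    by (intro integral_norm_bound_integral integrable_continuous_real disc_mean_inner_continuous assms in1) auto
  then show ?thesis by simp
qed

lemma has_vector_derivative_monomial:
  fixes z :: "real \<Rightarrow> complex"
  assumes "(z has_vector_derivative z') (at x within S)"
  shows "((\<lambda>x. z x ^ i * cnj (z x) ^ j) has_vector_derivative
     (of_nat i * z x ^ (i - 1) * z' * cnj (z x) ^ j + z x ^ i * (of_nat j * cnj (z x) ^ (j - 1) * cnj z'))) (at x within S)"
proof -
  have p: "((\<lambda>x. z x ^ n) has_vector_derivative of_nat n * z x ^ (n - 1) * z') (at x within S)" for n
  proof -
    have "((\<lambda>w. w ^ n) has_field_derivative of_nat n * z x ^ (n - 1)) (at (z x) within z ` S)"
      by (auto intro!: derivative_eq_intros)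
    from field_vector_diff_chain_within[OF assms this] show ?thesis by (simp add: o_def mult_ac)
  qed
  have "((\<lambda>x. cnj (z x ^ j)) has_vector_derivative cnj (of_nat j * z x ^ (j - 1) * z')) (at x within S)"
    by (rule has_vector_derivative_cnj[OF p])
  from has_vector_derivative_mult[OF p[of i] this] show ?thesis by (simp add: algebra_simps)
qed

text \<open>Green's formula, with the antiderivative of the monomial in \<open>cnj z\<close>.\<close>

lemma disc_mean_monomial:
  "disc_mean a (\<lambda>z. z ^ i * cnj z ^ j) =
     integral {0..1} (\<lambda>t. rot t ^ i * cnj (rot t) ^ (j + 1) / of_nat (j + 1) * rot t)"
proof -
  define K where "K z = z ^ i * cnj z ^ (j + 1) / of_nat (j + 1)" for z
  define r' where "r' l = - ((1 + a\<^sup>2) - 2 * l * a\<^sup>2) / (2 * circle_radius a l)" for l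
  define zl where "zl l t = of_real a + of_real (r' l) * rot t" for l t
  define zt where "zt l t = of_real (circle_radius a l) * (of_real (2 * pi) * \<i> * rot t)" for l t
  define K' where "K' z v = of_nat i * z ^ (i - 1) * v * cnj z ^ (j + 1) / of_nat (j + 1) + z ^ i * cnj z ^ j * cnj v" for z v
  \<comment> \<open>In the coordinates \<open>(l, t)\<close> the form \<open>K dz\<close> has the
    components \<open>2 * pi * \<i> * F\<close> (along \<open>t\<close>) and \<open>Q\<close> (along
    \<open>l\<close>). \<open>F'\<close> is the derivative of \<open>F\<close> in \<open>l\<close>
    and \<open>Q'\<close> that of \<open>Q\<close> in \<open>t\<close>; their combination in
    \<open>key\<close> is the exterior derivative, in which only the derivative of \<open>K\<close>
    in \<open>cnj z\<close>, the given monomial, survives.\<close>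
  define F where "F l t = K (circle_point a l t) * (of_real (circle_radius a l) * rot t)" for l t
  define F' where "F' l t = K' (circle_point a l t) (zl l t) * (of_real (circle_radius a l) * rot t) + K (circle_point a l t) * (of_real (r' l) * rot t)" for l t
  define Q where "Q l t = K (circle_point a l t) * zl l t" for l t
  define Q' where "Q' l t = K' (circle_point a l t) (zt l t) * zl l t + K (circle_point a l t) * (of_real (r' l) * (of_real (2 * pi) * \<i> * rot t))" for l t
  have dK: "((\<lambda>x. K (z x)) has_vector_derivative K' (z x) z') (at x within S)"
    if "(z has_vector_derivative z') (at x within S)" for z z' x S
  proof -
    have "of_nat i * z x ^ (i - 1) * z' * cnj (z x) ^ (j+1) + z x ^ i * (of_nat (j+1) * cnj (z x) ^ (j+1 - 1) * cnj z')
        = K' (z x) z' * of_nat (j + 1)"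
      unfolding K'_def by (simp add: field_simps del: of_nat_Suc)
    with has_vector_derivative_mult_left[OF has_vector_derivative_monomial[OF that, of i "j+1"], of "1 / of_nat (j + 1)"]
    show ?thesis by (simp add: K_def del: of_nat_Suc of_nat_add)
  qed
  have drot: "(rot has_vector_derivative (of_real (2 * pi) * \<i> * rot t)) (at t within S)" for t S
    using rot_has_vector_derivative[of 1 t S] by simp
  have rpos: "circle_radius a l > 0" if "l \<in> {0<..<1}" for l
  proof -
    have l: "0 \<le> l" "l \<le> 1" "l < 1" using that by auto
    have "l * a\<^sup>2 < 1" using circle_radius_facts(1)[OF a l(1,2)] l(3) by linarith
    then have "0 < (1 - l) * (1 - l * a\<^sup>2)" using l(3) by simp
    then show ?thesis by (simp add: circle_radius_def)
  qed
  have dr: "(circle_radius a has_real_derivative r' l) (at l within S)" if "l \<in> {0<..<1}" for l S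
  proof -
    have pos: "(1 - l) * (1 - l * a\<^sup>2) > 0" using rpos[OF that] by (simp add: circle_radius_def)
    have "((\<lambda>l. (1 - l) * (1 - l * a\<^sup>2)) has_real_derivative (- ((1 + a\<^sup>2) - 2 * l * a\<^sup>2))) (at l within S)"
    proof -
      have "((\<lambda>l. (1 - l) * (1 - l * b)) has_real_derivative (- ((1 + b) - 2 * l * b))) (at l within S)" for b
        by (rule DERIV_cong, (rule derivative_intros)+) (simp add: algebra_simps)
      then show ?thesis .
    qed
    from DERIV_chain2[OF DERIV_real_sqrt[OF pos] this] show ?thesis
      unfolding circle_radius_def [abs_def] r'_def by (simp add: field_simps)
  qed
  have dzl: "((\<lambda>l. circle_point a l t) has_vector_derivative zl l t) (at l within S)" if "l \<in> {0<..<1}" for l t S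
  proof -
    have "((\<lambda>l. l * a) has_real_derivative a) (at l within S)"
      by (auto intro!: derivative_eq_intros)
    from has_vector_derivative_add[OF has_vector_derivative_of_real[OF this]
        has_vector_derivative_mult_left[OF has_vector_derivative_of_real[OF dr[OF that]]]]
    show ?thesis by (simp add: circle_point_def zl_def)
  qed
  have dzt: "((\<lambda>t. circle_point a l t) has_vector_derivative zt l t) (at t within S)" for l t S
    using has_vector_derivative_add[OF has_vector_derivative_const has_vector_derivative_mult_right[OF drot]]
    by (simp add: circle_point_def [abs_def] zt_def)
  have dF: "((\<lambda>l. F l t) has_vector_derivative F' l t) (at l within S)" if "l \<in> {0<..<1}" for l t S
    unfolding F_def F'_def
    using has_vector_derivative_mult[OF dK[OF dzl[OF that]]
        has_vector_derivative_mult_left[OF has_vector_derivative_of_real[OF dr[OF that]], of "rot t"]]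
    by (simp add: add.commute)
  have dQ: "((\<lambda>t. Q l t) has_vector_derivative Q' l t) (at t within S)" for l t S
  proof -
    have "((\<lambda>t. zl l t) has_vector_derivative of_real (r' l) * (of_real (2 * pi) * \<i> * rot t)) (at t within S)"
      using has_vector_derivative_add[OF has_vector_derivative_const has_vector_derivative_mult_right[OF drot]]
      by (simp add: zl_def)
    from has_vector_derivative_mult[OF dK[OF dzt] this] show ?thesis
      by (simp add: Q_def Q'_def add.commute)
  qed
  have key: "F' l t = Q' l t / (of_real (2 * pi) * \<i>) - circle_point a l t ^ i * cnj (circle_point a l t) ^ j * circle_density a l t"
    if "l \<in> {0<..<1}" for l t
  proof -
    define R where "R = rot t"
    define \<rho> where "\<rho> = complex_of_real (circle_radius a l)"
    define s where "s = complex_of_real (r' l)"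
    define A where "A = complex_of_real a"
    have RC: "R * cnj R = 1" by (simp add: R_def)
    have "2 * circle_radius a l * r' l = - ((1 + a\<^sup>2) - 2 * l * a\<^sup>2)"
      using rpos[OF that] by (simp add: r'_def)
    then have "of_real (2 * circle_radius a l * r' l) = (of_real (- ((1 + a\<^sup>2) - 2 * l * a\<^sup>2)) :: complex)" by (rule arg_cong)
    then have rr: "2 * \<rho> * s = - ((1 + A\<^sup>2) - 2 * of_real l * A\<^sup>2)"
      by (simp add: \<rho>_def s_def A_def)
    have "circle_density a l t = 1 + A\<^sup>2 - 2 * of_real l * A\<^sup>2 - A * \<rho> * (R + cnj R)"
      unfolding complex_add_cnj by (simp add: circle_density_def circle_point_def A_def \<rho>_def R_def power2_eq_square algebra_simps)
    also have "\<dots> = - (2 * \<rho> * s) - A * \<rho> * (R + cnj R)" using rr by simp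
    also have "\<dots> = - (\<rho> * (cnj (zl l t) * R + cnj R * zl l t))"
      using RC by (simp add: zl_def A_def s_def R_def algebra_simps)
    finally have dens: "circle_density a l t = - (\<rho> * (cnj (zl l t) * R + cnj R * zl l t))" .
    have ztc: "zt l t = \<rho> * (of_real (2 * pi) * \<i> * R)" "cnj (zt l t) = - (\<rho> * (of_real (2 * pi) * \<i> * cnj R))"
      by (simp_all add: zt_def \<rho>_def R_def)
    define m where "m = circle_point a l t ^ i * cnj (circle_point a l t) ^ j"
    define n where "n = of_nat i * circle_point a l t ^ (i - 1) * cnj (circle_point a l t) ^ (j + 1) / of_nat (j + 1)"
    have K': "K' (circle_point a l t) v = n * v + m * cnj v" for v
      by (simp add: K'_def n_def m_def)
    define P where "P = complex_of_real (2 * pi) * \<i>"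
    have "P \<noteq> 0" "cnj P = - P" "cnj \<rho> = \<rho>" by (simp_all add: P_def \<rho>_def)
    have "F' l t * P = Q' l t - m * circle_density a l t * P"
      unfolding F'_def Q'_def K' dens ztc R_def[symmetric] P_def[symmetric] \<rho>_def[symmetric] s_def[symmetric]
      using \<open>cnj P = - P\<close> \<open>cnj \<rho> = \<rho>\<close> by (simp add: algebra_simps)
    then have "F' l t = (Q' l t - m * circle_density a l t * P) / P" using \<open>P \<noteq> 0\<close> by (metis nonzero_eq_divide_eq)
    then have "F' l t = Q' l t / P - m * circle_density a l t" using \<open>P \<noteq> 0\<close> by (simp add: diff_divide_distrib)
    then show ?thesis by (simp add: P_def m_def)
  qed
  define \<Phi> where "\<Phi> l = integral {0..1} (F l)" for l
  have cF: "continuous_on ({0..1} \<times> {0..1}) (\<lambda>x. F (fst x) (snd x))"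
    unfolding F_def K_def by (intro continuous_intros) (auto simp del: of_nat_Suc of_nat_add)
  have c\<Phi>: "continuous_on {0..1} \<Phi>"
    unfolding \<Phi>_def by (rule continuous_on_integral_01[OF cF])
  have cr': "continuous_on ({0<..<1} \<times> {0..1}) (\<lambda>x. r' (fst x))"
    unfolding r'_def using rpos by (intro continuous_intros) (auto simp: less_imp_neq[OF rpos, symmetric])
  have "continuous_on ({0<..<1} \<times> {0..1}) (\<lambda>x. F' (fst x) (snd x))"
    unfolding F'_def K'_def zl_def K_def by (intro continuous_intros cr') (auto simp del: of_nat_Suc of_nat_add)
  then have cF': "continuous_on ({0<..<1} \<times> cbox 0 1) (\<lambda>(x, t). F' x t)"
    by (simp add: case_prod_unfold)
  have d\<Phi>: "(\<Phi> has_vector_derivative (- integral {0..1} (\<lambda>t. circle_point a l t ^ i * cnj (circle_point a l t) ^ j * circle_density a l t))) (at l)"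
    if l: "l \<in> {0<..<1}" for l
  proof -
    have "((\<lambda>x. integral (cbox 0 1) (F x)) has_vector_derivative integral (cbox 0 1) (F' l)) (at l within {0<..<1})"
    proof (rule leibniz_rule_vector_derivative[OF _ _ cF' l])
      show "((\<lambda>x. F x t) has_vector_derivative F' x t) (at x within {0<..<1})" if "x \<in> {0<..<1}" for x t
        by (rule dF[OF that])
      show "F x integrable_on cbox 0 1" if "x \<in> {0<..<1}" for x
        unfolding F_def K_def cbox_interval by (intro integrable_continuous_real continuous_intros) (auto simp del: of_nat_Suc of_nat_add)
    qed auto
    then have 1: "(\<Phi> has_vector_derivative integral {0..1} (F' l)) (at l)"
      using at_within_open[OF l] by (simp add: \<Phi>_def [abs_def])
    have "(Q' l has_integral (Q l 1 - Q l 0)) {0..1}"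
      by (rule fundamental_theorem_of_calculus) (use dQ in auto)
    moreover have "Q l 1 = Q l 0" by (simp add: Q_def zl_def circle_point_def)
    ultimately have Q0: "(Q' l has_integral 0) {0..1}" by simp
    have "((\<lambda>t. Q' l t / (of_real (2 * pi) * \<i>) - circle_point a l t ^ i * cnj (circle_point a l t) ^ j * circle_density a l t) has_integral
       (0 / (of_real (2 * pi) * \<i>) - integral {0..1} (\<lambda>t. circle_point a l t ^ i * cnj (circle_point a l t) ^ j * circle_density a l t))) {0..1}"
      by (intro has_integral_diff has_integral_divide Q0 integrable_integral integrable_continuous_real continuous_intros)
    then have "integral {0..1} (F' l) = - integral {0..1} (\<lambda>t. circle_point a l t ^ i * cnj (circle_point a l t) ^ j * circle_density a l t)"
      unfolding key[OF l, abs_def] by (subst integral_unique, assumption) simp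
    with 1 show ?thesis by simp
  qed
  \<comment> \<open>For \<open>\<bar>a\<bar> < 1\<close> the square root in the radius has no
    derivative at \<open>l = 1\<close>, so the fundamental theorem is used with mere continuity at
    the end points. There the circle has shrunk to a point, while at \<open>l = 0\<close> it is the
    unit circle.\<close>
  have "((\<lambda>l. - integral {0..1} (\<lambda>t. circle_point a l t ^ i * cnj (circle_point a l t) ^ j * circle_density a l t)) has_integral (\<Phi> 1 - \<Phi> 0)) {0..1}"
    by (rule fundamental_theorem_of_calculus_interior[OF _ c\<Phi> d\<Phi>]) auto
  from integral_unique[OF this] have "- disc_mean a (\<lambda>z. z ^ i * cnj z ^ j) = \<Phi> 1 - \<Phi> 0"
    unfolding disc_mean_def by (simp only: integral_neg)
  then have "disc_mean a (\<lambda>z. z ^ i * cnj z ^ j) = \<Phi> 0 - \<Phi> 1"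
    by (metis minus_diff_eq minus_minus)
  moreover have "\<Phi> 1 = 0" by (simp add: \<Phi>_def F_def [abs_def] circle_radius_def)
  ultimately show ?thesis by (simp add: \<Phi>_def F_def [abs_def] K_def circle_point_def circle_radius_def)
qed

end

text \<open>This is the link between the two pencils. For a monomial, Green's formula leaves an
  integral over the unit circle in which the centre no longer occurs; linear combinations of
  monomials are uniformly dense.\<close>

lemma disc_mean_independent:
  assumes k: "continuous_on (cball 0 1) k" and "\<bar>a\<bar> \<le> 1" "\<bar>b\<bar> \<le> 1"
  shows "disc_mean a k = disc_mean b k"
proof -
  have "norm (disc_mean a k - disc_mean b k) \<le> \<epsilon>" if "\<epsilon> > 0" for \<epsilon>
  proof -
    have "\<epsilon> / 8 > 0" using that by simp
    then obtain c N where c: "\<And>z. z \<in> cball 0 1 \<Longrightarrow>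
        norm (k z - (\<Sum>i<N. \<Sum>j<N. c i j * (z ^ i * cnj z ^ j))) < \<epsilon> / 8"
      by (rule Stone_Weierstrass_complex[OF compact_cball k]) blast
    define P where "P z = (\<Sum>i<N. \<Sum>j<N. c i j * (z ^ i * cnj z ^ j))" for z
    have cP: "continuous_on (cball 0 1) P" unfolding P_def by (intro continuous_intros)
    have mono: "disc_mean s P = (\<Sum>i<N. \<Sum>j<N. c i j *
       integral {0..1} (\<lambda>t. rot t ^ i * cnj (rot t) ^ (j + 1) / of_nat (j + 1) * rot t))" if "\<bar>s\<bar> \<le> 1" for s
      unfolding P_def
      by (simp add: disc_mean_sum[OF that] disc_mean_cmult[OF that] disc_mean_monomial[OF that]
           continuous_intros del: of_nat_Suc of_nat_add)
    have near: "norm (disc_mean s k - disc_mean s P) \<le> \<epsilon> / 2" if s: "\<bar>s\<bar> \<le> 1" for s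
    proof -
      have "norm (disc_mean s (\<lambda>z. k z - P z)) \<le> 4 * (\<epsilon> / 8)"
        using c by (intro disc_mean_bound s continuous_intros k cP) (auto simp: P_def intro: less_imp_le)
      then show ?thesis by (simp add: disc_mean_diff[OF s k cP])
    qed
    have "disc_mean a P = disc_mean b P" by (simp only: mono assms)
    then have "norm (disc_mean a k - disc_mean b k) = norm ((disc_mean a k - disc_mean a P) - (disc_mean b k - disc_mean b P))"
      by simp
    also have "\<dots> \<le> \<epsilon> / 2 + \<epsilon> / 2"
      by (intro order_trans[OF norm_triangle_ineq4] add_mono near assms)
    finally show ?thesis by simp
  qed
  then have "norm (disc_mean a k - disc_mean b k) \<le> 0" by (rule field_le_epsilon) (simp only: add_0_left)
  then show ?thesis by simp
qed

section \<open>Dipole potentials on the real line\<close>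

lemma has_integral_inverse_square:
  assumes "\<delta> > 0" "\<kappa> > (0::real)"
  shows "((\<lambda>l. 1 / (\<delta> + \<kappa> * l)\<^sup>2) has_integral (1 / (\<kappa> * \<delta>) - 1 / (\<kappa> * (\<delta> + \<kappa>)))) {0..1}"
proof -
  have "((\<lambda>l. 1 / (\<delta> + \<kappa> * l)\<^sup>2) has_integral (- 1 / (\<kappa> * (\<delta> + \<kappa> * 1)) - - 1 / (\<kappa> * (\<delta> + \<kappa> * 0)))) {0..1}"
  proof (rule fundamental_theorem_of_calculus)
    fix l :: real assume "l \<in> {0..1}"
    then have pos: "\<delta> + \<kappa> * l > 0" using assms by (simp add: add_pos_nonneg)
    have "((\<lambda>l. - 1 / (\<kappa> * (\<delta> + \<kappa> * l))) has_real_derivative 1 / (\<delta> + \<kappa> * l)\<^sup>2) (at l within {0..1})"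
    proof -
      have "((\<lambda>l. \<delta> + \<kappa> * l) has_real_derivative \<kappa>) (at l within {0..1})"
        by (auto intro!: derivative_eq_intros)
      from DERIV_cmult[OF DERIV_inverse_fun[OF this], of "-1/\<kappa>"] pos show ?thesis
        using assms by (simp add: field_simps power2_eq_square)
    qed
    then show "((\<lambda>l. - 1 / (\<kappa> * (\<delta> + \<kappa> * l))) has_vector_derivative 1 / (\<delta> + \<kappa> * l)\<^sup>2) (at l within {0..1})"
      by (simp add: has_real_derivative_iff_has_vector_derivative)
  qed simp
  then show ?thesis by (simp add: add.commute)
qed

text \<open>A potential of charges \<open>A\<close> and dipoles \<open>B\<close> spread over a real
  curve \<open>\<zeta>\<close>: simple and double poles, one pair for each circle of a
  pencil.\<close>

definition dipole :: "(real \<Rightarrow> complex) \<Rightarrow> (real \<Rightarrow> complex) \<Rightarrow> (real \<Rightarrow> real) \<Rightarrow> complex \<Rightarrow> complex" where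
  "dipole A B \<zeta> \<mu> = integral {0..1} (\<lambda>l. A l / (\<mu> - of_real (\<zeta> l)) + B l / (\<mu> - of_real (\<zeta> l))\<^sup>2)"

lemma dipole_holomorphic:
  assumes cont: "continuous_on {0..1} A" "continuous_on {0..1} B" "continuous_on {0..1} \<zeta>"
    and U: "open U" "\<And>l. l \<in> {0..1} \<Longrightarrow> of_real (\<zeta> l) \<notin> U"
  shows "dipole A B \<zeta> holomorphic_on U"
proof -
  have "dipole A B \<zeta> field_differentiable at \<mu>" if \<mu>: "\<mu> \<in> U" for \<mu>
  proof -
    obtain r where r: "r > 0" "ball \<mu> r \<subseteq> U" using U(1) \<mu> by (auto simp: open_contains_ball)
    have ne: "x - of_real (\<zeta> l) \<noteq> 0" if "x \<in> ball \<mu> r" "l \<in> {0..1}" for x l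
      using that r(2) U(2) by auto
    define f' where "f' x l = - A l / (x - of_real (\<zeta> l))\<^sup>2 - 2 * B l / (x - of_real (\<zeta> l)) ^ 3" for x l
    have c': "continuous_on (ball \<mu> r \<times> {0..1}) (\<lambda>y. g (snd y))" if "continuous_on {0..1} g" for g :: "real \<Rightarrow> 'a::topological_space"
      by (rule continuous_on_compose2[OF that]) (auto intro!: continuous_intros)
    have "(\<lambda>x. integral (cbox 0 1) (\<lambda>l. A l / (x - of_real (\<zeta> l)) + B l / (x - of_real (\<zeta> l))\<^sup>2)) holomorphic_on ball \<mu> r"
    proof (rule leibniz_rule_holomorphic)
      fix x and l :: real assume x: "x \<in> ball \<mu> r" "l \<in> cbox 0 1"
      define d where "d = x - complex_of_real (\<zeta> l)"
      have d: "d \<noteq> 0" using ne[of x l] x by (auto simp: d_def)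
      have "((\<lambda>x. A l / (x - of_real (\<zeta> l))) has_field_derivative (- A l / d\<^sup>2)) (at x within ball \<mu> r)"
        using d by (auto intro!: derivative_eq_intros simp: d_def power2_eq_square)
      moreover have "((\<lambda>x. B l / (x - of_real (\<zeta> l))\<^sup>2) has_field_derivative (- 2 * B l / d ^ 3)) (at x within ball \<mu> r)"
      proof -
        have "((\<lambda>x. (x - complex_of_real (\<zeta> l))\<^sup>2) has_field_derivative (2 * d)) (at x within ball \<mu> r)"
          by (auto intro!: derivative_eq_intros simp: d_def)
        from DERIV_cmult[OF DERIV_inverse'[OF this], of "B l"] d
        have "((\<lambda>x. B l * inverse ((x - complex_of_real (\<zeta> l))\<^sup>2)) has_field_derivative
            B l * - (inverse (d\<^sup>2) * (2 * d) * inverse (d\<^sup>2))) (at x within ball \<mu> r)"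
          unfolding d_def by (metis power_eq_0_iff)
        moreover have "B l * - (inverse (d\<^sup>2) * (2 * d) * inverse (d\<^sup>2)) = - 2 * B l / d ^ 3"
          using d by (simp add: field_simps power2_eq_square power3_eq_cube)
        ultimately show ?thesis by (simp only: divide_inverse)
      qed
      ultimately have "((\<lambda>x. A l / (x - of_real (\<zeta> l)) + B l / (x - of_real (\<zeta> l))\<^sup>2)
          has_field_derivative (- A l / d\<^sup>2 + - 2 * B l / d ^ 3)) (at x within ball \<mu> r)"
        by (rule DERIV_add)
      then show "((\<lambda>x. A l / (x - of_real (\<zeta> l)) + B l / (x - of_real (\<zeta> l))\<^sup>2)
          has_field_derivative f' x l) (at x within ball \<mu> r)"
        by (simp add: f'_def d_def)
    next
      fix x assume "x \<in> ball \<mu> r"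
      then show "(\<lambda>l. A l / (x - of_real (\<zeta> l)) + B l / (x - of_real (\<zeta> l))\<^sup>2) integrable_on cbox 0 1"
        unfolding cbox_interval using ne by (intro integrable_continuous_real continuous_intros cont) auto
    next
      show "continuous_on (ball \<mu> r \<times> cbox 0 1) (\<lambda>(x, l). f' x l)"
        unfolding f'_def case_prod_unfold cbox_interval
        using ne by (intro continuous_intros c' cont) auto
    qed simp
    then have "dipole A B \<zeta> holomorphic_on ball \<mu> r" by (simp add: dipole_def [abs_def])
    then show ?thesis using r(1) by (simp add: holomorphic_on_imp_differentiable_at)
  qed
  then show ?thesis by (simp add: holomorphic_on_def field_differentiable_at_within)
qed

text \<open>Double poles on a curve through a point at distance \<delta> could give
  \<open>1 / \<delta> ^ 2\<close>. Here the curve recedes at linear rate \<kappa>; averaging the two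
  distance bounds gives the denominator \<open>(\<delta> + \<kappa> * l) / 2\<close>, whose inverse
  square integrates to order \<open>1 / \<delta>\<close>, as for simple poles. This is what limits
  the singularity at \<open>p\<close> to a simple pole.\<close>

lemma dipole_bound:
  assumes cont: "continuous_on {0..1} A" "continuous_on {0..1} B" "continuous_on {0..1} \<zeta>"
    and bnd: "\<And>l. l \<in> {0..1} \<Longrightarrow> norm (A l) \<le> M" "\<And>l. l \<in> {0..1} \<Longrightarrow> norm (B l) \<le> M"
    and \<kappa>: "\<kappa> > 0" and \<delta>: "\<delta> > 0"
    and far: "\<And>l. l \<in> {0..1} \<Longrightarrow> \<delta> \<le> norm (\<mu> - of_real (\<zeta> l))"
      "\<And>l. l \<in> {0..1} \<Longrightarrow> \<kappa> * l \<le> norm (\<mu> - of_real (\<zeta> l))"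
  shows "norm (dipole A B \<zeta> \<mu>) \<le> (M + 4 * M / \<kappa>) / \<delta>"
proof -
  have M: "M \<ge> 0" using bnd(1)[of 0] by (auto intro: order_trans[OF norm_ge_zero])
  have ne: "\<mu> - of_real (\<zeta> l) \<noteq> 0" if "l \<in> {0..1}" for l using far(1)[OF that] \<delta> by auto
  have hi: "((\<lambda>l. M / \<delta> + 4 * M * (1 / (\<delta> + \<kappa> * l)\<^sup>2)) has_integral
      (M / \<delta> + 4 * M * (1 / (\<kappa> * \<delta>) - 1 / (\<kappa> * (\<delta> + \<kappa>))))) {0..1}"
    using has_integral_const_real[of "M / \<delta>" 0 1]
    by (intro has_integral_add has_integral_mult_right has_integral_inverse_square \<kappa> \<delta>) simp
  have "norm (dipole A B \<zeta> \<mu>) \<le> integral {0..1} (\<lambda>l. M / \<delta> + 4 * M * (1 / (\<delta> + \<kappa> * l)\<^sup>2))"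
    unfolding dipole_def
  proof (rule integral_norm_bound_integral)
    show "(\<lambda>l. A l / (\<mu> - of_real (\<zeta> l)) + B l / (\<mu> - of_real (\<zeta> l))\<^sup>2) integrable_on {0..1}"
      using ne by (intro integrable_continuous_real continuous_intros cont) auto
    show "(\<lambda>l. M / \<delta> + 4 * M * (1 / (\<delta> + \<kappa> * l)\<^sup>2)) integrable_on {0..1}"
      using hi by blast
    fix l :: real assume l: "l \<in> {0..1}"
    define d where "d = norm (\<mu> - of_real (\<zeta> l))"
    have pos: "\<delta> + \<kappa> * l > 0" using \<delta> \<kappa> l by (simp add: add_pos_nonneg)
    have d: "\<delta> \<le> d" "(\<delta> + \<kappa> * l) / 2 \<le> d" using far[OF l] by (auto simp: d_def)
    have "norm (A l) / d \<le> M / \<delta>" using d \<delta> bnd(1)[OF l] M by (intro frac_le) auto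
    moreover have "norm (B l) / d\<^sup>2 \<le> M / ((\<delta> + \<kappa> * l) / 2)\<^sup>2"
      using d pos bnd(2)[OF l] M by (intro frac_le power_mono) auto
    moreover have "M / ((\<delta> + \<kappa> * l) / 2)\<^sup>2 = 4 * M * (1 / (\<delta> + \<kappa> * l)\<^sup>2)"
      by (simp add: power_divide)
    ultimately show "norm (A l / (\<mu> - of_real (\<zeta> l)) + B l / (\<mu> - of_real (\<zeta> l))\<^sup>2) \<le> M / \<delta> + 4 * M * (1 / (\<delta> + \<kappa> * l)\<^sup>2)"
      by (intro order_trans[OF norm_triangle_ineq]) (simp add: norm_divide norm_power d_def)
  qed
  also have "\<dots> = M / \<delta> + 4 * M * (1 / (\<kappa> * \<delta>) - 1 / (\<kappa> * (\<delta> + \<kappa>)))"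
    using hi by (rule integral_unique)
  also have "\<dots> \<le> M / \<delta> + 4 * M * (1 / (\<kappa> * \<delta>))"
    using M \<kappa> \<delta> by (intro add_left_mono mult_left_mono) auto
  also have "\<dots> = (M + 4 * M / \<kappa>) / \<delta>"
    by (simp add: add_divide_distrib)
  finally show ?thesis .
qed

lemma dipole_glue:
  fixes p \<kappa> :: real
  assumes cont: "continuous_on {0..1} A1" "continuous_on {0..1} B1" "continuous_on {0..1} \<zeta>1"
       "continuous_on {0..1} A2" "continuous_on {0..1} B2" "continuous_on {0..1} \<zeta>2"
    and \<kappa>: "\<kappa> > 0"
    and z1: "\<And>l. l \<in> {0..1} \<Longrightarrow> -1 \<le> \<zeta>1 l" "\<And>l. l \<in> {0..1} \<Longrightarrow> \<zeta>1 l \<le> p - \<kappa> * l"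
    and z2: "\<And>l. l \<in> {0..1} \<Longrightarrow> \<zeta>2 l \<le> 1" "\<And>l. l \<in> {0..1} \<Longrightarrow> p + \<kappa> * l \<le> \<zeta>2 l"
    and eq: "\<And>\<mu>. norm \<mu> > 1 \<Longrightarrow> dipole A1 B1 \<zeta>1 \<mu> = dipole A2 B2 \<zeta>2 \<mu>"
  shows "\<exists>C. \<forall>\<mu>. norm \<mu> > 1 \<longrightarrow> (\<mu> - of_real p) * dipole A1 B1 \<zeta>1 \<mu> = C"
proof -
  have p: "-1 \<le> p" "p \<le> 1" using z1[of 0] z2[of 0] by auto
  define S1 where "S1 = complex_of_real ` {-1..p}"
  define S2 where "S2 = complex_of_real ` {p..1}"
  have cl: "closed S1" "closed S2" unfolding S1_def S2_def
    by (intro compact_imp_closed compact_continuous_image continuous_intros compact_Icc)+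
  have S12: "S1 \<union> S2 = complex_of_real ` {-1..1}" "S1 \<inter> S2 = {of_real p}"
    using p unfolding S1_def S2_def by (auto simp flip: image_Un)
  have m1: "\<zeta>1 l \<in> {-1..p}" if "l \<in> {0..1}" for l
    using z1[OF that] mult_nonneg_nonneg[of \<kappa> l] \<kappa> that by (simp del: mult_nonneg_nonneg zero_le_mult_iff)
  have m2: "\<zeta>2 l \<in> {p..1}" if "l \<in> {0..1}" for l
    using z2[OF that] mult_nonneg_nonneg[of \<kappa> l] \<kappa> that by (simp del: mult_nonneg_nonneg zero_le_mult_iff)
  define w1 where "w1 = dipole A1 B1 \<zeta>1"
  define w2 where "w2 = dipole A2 B2 \<zeta>2"
  have h1: "w1 holomorphic_on - S1" unfolding w1_def
    by (intro dipole_holomorphic cont open_Compl cl) (use m1 in \<open>auto simp: S1_def\<close>)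
  have h2: "w2 holomorphic_on - S2" unfolding w2_def
    by (intro dipole_holomorphic cont open_Compl cl) (use m2 in \<open>auto simp: S2_def\<close>)
  have conn: "connected (- (S1 \<union> S2))"
  proof (rule connected_complement_bounded_convex)
    have "convex (complex_of_real ` {-1..1})"
      by (intro convex_linear_image linear_of_real) simp_all
    then show "convex (S1 \<union> S2)" by (simp add: S12)
    show "bounded (S1 \<union> S2)" by (auto simp: S12 bounded_iff intro!: exI[of _ 1])
  qed simp
  have w12: "w1 \<mu> = w2 \<mu>" if "\<mu> \<in> - (S1 \<union> S2)" for \<mu>
  proof (rule analytic_continuation_open[of "- cball 0 1" "- (S1 \<union> S2)" w1 w2])
    show "- cball (0::complex) 1 \<noteq> {}" using norm_of_real[of 2, where 'a = complex] by (intro notI) (metis ComplI UNIV_I compl_bot_eq double_complement empty_iff mem_cball_0 norm_numeral one_less_numeral_iff semiring_norm(76) not_le)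
    show "- cball 0 1 \<subseteq> - (S1 \<union> S2)" by (auto simp: S12)
  qed (use that eq conn cl h1 h2 in \<open>auto simp: w1_def w2_def intro!: open_Compl closed_Un intro: holomorphic_on_subset\<close>)
  \<comment> \<open>On the first segment only \<open>w2\<close> is meaningful, elsewhere
    \<open>w1\<close> is; off both segments they agree. The value at \<open>p\<close> itself is
    arbitrary and is replaced when the singularity is removed.\<close>
  define H where "H \<mu> = (if \<mu> \<in> S1 then w2 \<mu> else w1 \<mu>)" for \<mu>
  have "H holomorphic_on - S1" by (rule holomorphic_transform[OF h1]) (simp add: H_def)
  moreover have "H holomorphic_on - S2" by (rule holomorphic_transform[OF h2]) (use w12 in \<open>auto simp: H_def\<close>)
  ultimately have "H holomorphic_on (- S1 \<union> - S2)"
    using cl by (intro holomorphic_on_Un open_Compl)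
  moreover have "- S1 \<union> - S2 = - {complex_of_real p}" using S12(2) by blast
  ultimately have H: "H holomorphic_on - {complex_of_real p}" by simp
  have "\<exists>M. \<forall>l\<in>{0..1}. norm (F l) \<le> M" if "continuous_on {0..1::real} F" for F :: "real \<Rightarrow> complex"
    using compact_continuous_image[OF that compact_Icc] by (auto dest!: compact_imp_bounded simp: bounded_iff)
  with cont obtain M1 M2 M3 M4 where Ms: "\<forall>l\<in>{0..1}. norm (A1 l) \<le> M1" "\<forall>l\<in>{0..1}. norm (B1 l) \<le> M2"
     "\<forall>l\<in>{0..1}. norm (A2 l) \<le> M3" "\<forall>l\<in>{0..1}. norm (B2 l) \<le> M4" by meson
  define M where "M = max (max M1 M2) (max M3 M4)"
  have M: "norm (A1 l) \<le> M" "norm (B1 l) \<le> M" "norm (A2 l) \<le> M" "norm (B2 l) \<le> M" if "l \<in> {0..1}" for l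
    using Ms that by (fastforce simp: M_def)+
  have bound: "norm ((\<mu> - of_real p) * H \<mu>) \<le> M + 4 * M / \<kappa>" if \<mu>: "\<mu> \<noteq> of_real p" for \<mu>
  proof -
    have "norm (H \<mu>) \<le> (M + 4 * M / \<kappa>) / norm (\<mu> - of_real p)"
    \<comment> \<open>On each side of the line \<open>Re \<mu> = p\<close> the potential whose curve
      lies on the other side is used: every point of that curve is at least as far from \<mu> as
      \<open>p\<close>, and its horizontal distance from \<mu> is at least
      \<open>\<kappa> * l\<close>.\<close>
    proof (cases "Re \<mu> \<ge> p")
      case True
      then have "\<mu> \<notin> S1" using \<mu> by (auto simp: S1_def)
      then have "H \<mu> = w1 \<mu>" by (simp add: H_def)
      moreover have "norm (w1 \<mu>) \<le> (M + 4 * M / \<kappa>) / norm (\<mu> - of_real p)"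
        unfolding w1_def
      proof (rule dipole_bound[OF cont(1,2,3) M(1,2) \<kappa>])
        fix l :: real assume l: "l \<in> {0..1}"
        show "\<kappa> * l \<le> norm (\<mu> - of_real (\<zeta>1 l))"
          using abs_Re_le_cmod[of "\<mu> - of_real (\<zeta>1 l)"] z1(2)[OF l] True by simp
        have "\<zeta>1 l \<le> p" using m1[OF l] by simp
        then show "norm (\<mu> - of_real p) \<le> norm (\<mu> - of_real (\<zeta>1 l))"
          using True by (simp add: cmod_def power_mono)
      qed (use \<mu> in auto)
      ultimately show ?thesis by simp
    next
      case False
      then have "\<mu> \<notin> S2" by (auto simp: S2_def)
      then have "H \<mu> = w2 \<mu>" using w12 by (auto simp: H_def)
      moreover have "norm (w2 \<mu>) \<le> (M + 4 * M / \<kappa>) / norm (\<mu> - of_real p)"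
        unfolding w2_def
      proof (rule dipole_bound[OF cont(4,5,6) M(3,4) \<kappa>])
        fix l :: real assume l: "l \<in> {0..1}"
        show "\<kappa> * l \<le> norm (\<mu> - of_real (\<zeta>2 l))"
          using abs_Re_le_cmod[of "\<mu> - of_real (\<zeta>2 l)"] z2(2)[OF l] False by simp
        have "p \<le> \<zeta>2 l" using m2[OF l] by simp
        then have "(Re \<mu> - p)\<^sup>2 \<le> (Re \<mu> - \<zeta>2 l)\<^sup>2"
          using False by (simp add: abs_le_square_iff[symmetric])
        then show "norm (\<mu> - of_real p) \<le> norm (\<mu> - of_real (\<zeta>2 l))"
          by (simp add: cmod_def)
      qed (use \<mu> in auto)
      ultimately show ?thesis by simp
    qed
    then show ?thesis using \<mu> by (simp add: norm_mult pos_le_divide_eq mult.commute)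
  qed
  define G where "G \<mu> = (\<mu> - of_real p) * H \<mu>" for \<mu>
  have hG: "G holomorphic_on UNIV - {of_real p}"
    unfolding G_def using H by (intro holomorphic_intros) (simp add: Compl_eq_Diff_UNIV)
  have "\<exists>g. g holomorphic_on UNIV \<and> (\<forall>z\<in>UNIV - {complex_of_real p}. g z = G z)"
    using holomorphic_on_extend_bounded[OF hG] bound
    by (auto simp: G_def eventually_at_filter intro!: exI[of _ "M + 4 * M / \<kappa>"] always_eventually)
  then obtain g where g: "g holomorphic_on UNIV" "\<And>z. z \<noteq> of_real p \<Longrightarrow> g z = G z" by auto
  have "bounded (range g)"
    unfolding bounded_iff
  proof (intro exI ballI)
    fix y assume "y \<in> range g"
    then obtain z where y: "y = g z" by blast
    show "norm y \<le> max (norm (g (of_real p))) (M + 4 * M / \<kappa>)"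
      using y g(2)[of z] bound[of z] by (cases "z = of_real p") (auto simp: G_def)
  qed
  then have "g constant_on UNIV" using Liouville_theorem g(1) by blast
  then obtain C where C: "\<And>z. g z = C" by (auto simp: constant_on_def)
  have "(\<mu> - of_real p) * dipole A1 B1 \<zeta>1 \<mu> = C" if "norm \<mu> > 1" for \<mu>
  proof -
    have "\<mu> \<noteq> of_real p" using that p by auto
    moreover have "\<mu> \<notin> S1" using that p by (auto simp: S1_def)
    ultimately show ?thesis using C[of \<mu>] g(2)[of \<mu>] by (simp add: G_def H_def w1_def)
  qed
  then show ?thesis by blast
qed

section \<open>Functions orthogonal to two families of circles\<close>

text \<open>On a circle \<open>dz\<close> is a constant multiple of \<open>rot t dt\<close>, so
  these are integrals of \<open>g h dz\<close>. The tests \<open>h\<close> are holomorphic on the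
  whole unit disc and not only inside the circle; this is wide enough for polynomials divided by
  \<open>\<mu> - z\<close> with \<open>\<bar>\<mu>\<bar> > 1\<close>. The end values of
  \<open>l\<close>, the unit circle and a point, are left out.\<close>

definition annihilates_circles :: "(complex \<Rightarrow> complex) \<Rightarrow> real \<Rightarrow> bool" where
  "annihilates_circles g a \<longleftrightarrow> (\<forall>l\<in>{0<..<1}. \<forall>h. continuous_on (cball 0 1) h \<longrightarrow> h holomorphic_on ball 0 1 \<longrightarrow>
     integral {0..1} (\<lambda>t. g (circle_point a l t) * h (circle_point a l t) * rot t) = 0)"

definition zeta :: "real \<Rightarrow> real \<Rightarrow> real \<Rightarrow> real" where
  "zeta a p l = p + l * (a - p) * (1 - a * p) / (1 - l * a * p)"

lemma mult_less_one_abs: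
  fixes l a p :: real
  assumes "\<bar>a\<bar> \<le> 1" "\<bar>p\<bar> < 1" "0 \<le> l" "l \<le> 1"
  shows "l * a * p < 1" "- 1 < l * a * p" 
proof -
  have "\<bar>l * a\<bar> \<le> 1 * 1" unfolding abs_mult using assms by (intro mult_mono) auto
  then have "\<bar>l * a * p\<bar> \<le> 1 * \<bar>p\<bar>" unfolding abs_mult[of "l * a" p] by (intro mult_right_mono) auto
  then have "\<bar>l * a * p\<bar> < 1" using assms by linarith
  then show "l * a * p < 1" "- 1 < l * a * p" by auto
qed

text \<open>The curve leads from \<open>p\<close> at \<open>l = 0\<close> to \<open>a\<close> at
  \<open>l = 1\<close>. The lower bound for \<open>s\<close>, from a denominator below 2, is the
  linear rate at which it leaves \<open>p\<close>, as the growth estimate for dipoles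
  requires.\<close>

lemma zeta_between:
  assumes "\<bar>a\<bar> \<le> 1" "\<bar>p\<bar> < 1" "0 \<le> l" "l \<le> 1"
  shows "\<exists>s\<ge>0. s \<le> 1 \<and> l * (1 - a * p) / 2 \<le> s \<and> zeta a p l = p + s * (a - p)"
proof -
  define D where "D = 1 - l * a * p"
  have D: "D > 0" "D < 2" using mult_less_one_abs[OF assms] by (auto simp: D_def)
  have q: "1 - a * p > 0" using mult_less_one_abs[of a p 1] assms by simp
  define s where "s = l * (1 - a * p) / D"
  have "1 - s = (1 - l) / D" using D by (simp add: s_def D_def field_simps)
  moreover have "(1 - l) / D \<ge> 0" using D assms by simp
  ultimately have "s \<le> 1" by linarith
  moreover have "l * (1 - a * p) / 2 \<le> s" unfolding s_def using D q assms by (intro divide_left_mono) auto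
  moreover have "s \<ge> 0" using D q assms by (simp add: s_def)
  moreover have "zeta a p l = p + s * (a - p)" by (simp add: zeta_def s_def D_def)
  ultimately show ?thesis by blast
qed

lemma zeta_abs_le:
  assumes "\<bar>a\<bar> \<le> 1" "\<bar>p\<bar> < 1" "0 \<le> l" "l \<le> 1"
  shows "\<bar>zeta a p l\<bar> \<le> 1"
proof -
  obtain s where s: "s \<ge> 0" "s \<le> 1" "zeta a p l = p + s * (a - p)" using zeta_between[OF assms] by blast
  have "\<bar>(1 - s) * p + s * a\<bar> \<le> (1 - s) * 1 + s * 1"
    by (intro order_trans[OF abs_triangle_ineq] add_mono) (use s assms in \<open>auto simp: abs_mult intro!: mult_left_mono mult_left_le\<close>)
  then show ?thesis using s(3) by (simp add: algebra_simps)
qed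

lemma continuous_on_zeta:
  assumes "\<bar>a\<bar> \<le> 1" "\<bar>p\<bar> < 1"
  shows "continuous_on {0..1} (zeta a p)"
  unfolding zeta_def [abs_def] using mult_less_one_abs[OF assms]
  by (intro continuous_intros) fastforce

lemma mult_cnj_neq_1: "norm p < 1 \<Longrightarrow> norm z \<le> 1 \<Longrightarrow> p * cnj z \<noteq> 1"
proof
  assume *: "norm p < 1" "norm z \<le> 1" "p * cnj z = 1"
  then have "norm p * norm z = 1" by (metis complex_mod_cnj norm_mult norm_one)
  moreover have "norm p * norm z \<le> norm p * 1" using * by (intro mult_left_mono) auto
  ultimately show False using * by simp
qed

text \<open>On a circle, \<open>cnj z\<close> is a fractional linear function of \<open>z\<close>; \<open>zeta\<close> is the point where it takes the
  value \<open>1 / p\<close>, hence the pole of the Bergman kernel continued into the disc bounded by the circle.\<close>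

lemma circle_point_kernel_zero:
  assumes "\<bar>a\<bar> \<le> 1" "\<bar>p\<bar> < 1" "0 \<le> l" "l \<le> 1"
  shows "of_real (circle_radius a l) * rot t * (1 - of_real p * cnj (circle_point a l t)) =
     of_real (1 - l * a * p) * (circle_point a l t - of_real (zeta a p l))"
proof -
  define R where "R = rot t"
  define \<rho> where "\<rho> = complex_of_real (circle_radius a l)"
  define D where "D = 1 - l * a * p"
  have D: "D > 0" using mult_less_one_abs[OF assms] by (auto simp: D_def)
  have "D * (l * a - zeta a p l) = D * (l * a - p) - l * (a - p) * (1 - a * p)"
    using D by (simp add: zeta_def D_def field_simps)
  also have "\<dots> = - p * ((1 - l) * (1 - l * a\<^sup>2))"
    by (simp add: D_def power2_eq_square algebra_simps)
  also have "\<dots> = - p * (circle_radius a l)\<^sup>2" using circle_radius_facts(3)[of a l] assms by simp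
  finally have "complex_of_real (D * (l * a - zeta a p l)) = of_real (- p * (circle_radius a l)\<^sup>2)" by simp
  then have e: "of_real D * (of_real l * of_real a - complex_of_real (zeta a p l)) = - of_real p * \<rho>\<^sup>2"
    by (simp add: \<rho>_def)
  have RC: "R * cnj R = 1" by (simp add: R_def)
  have "\<rho> * R * (1 - of_real p * cnj (of_real l * of_real a + \<rho> * R)) = 
     \<rho> * R * of_real D - of_real p * \<rho>\<^sup>2"
    using RC by (simp add: D_def \<rho>_def power2_eq_square algebra_simps)
  also have "\<dots> = of_real D * (of_real l * of_real a + \<rho> * R - of_real (zeta a p l))"
    using e by (simp add: algebra_simps)
  finally show ?thesis by (simp add: circle_point_def \<rho>_def R_def D_def)
qed

text \<open>Taylor expansion in \<open>z\<close> at \<zeta> with exact remainder. The square in the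
  remainder is there to cancel the double pole that the kernel has at \<zeta>.\<close>

lemma double_pole_expansion:
  fixes z \<zeta> \<mu> :: complex
  assumes "\<mu> \<noteq> \<zeta>" "\<mu> \<noteq> z"
  shows "1 / (\<mu> - z) = 1 / (\<mu> - \<zeta>) + (z - \<zeta>) / (\<mu> - \<zeta>)\<^sup>2 + (z - \<zeta>)\<^sup>2 / ((\<mu> - \<zeta>)\<^sup>2 * (\<mu> - z))"
proof -
  define x where "x = \<mu> - \<zeta>"
  define y where "y = \<mu> - z"
  have z: "z - \<zeta> = x - y" "\<mu> - \<zeta> = x" "\<mu> - z = y" by (auto simp: x_def y_def)
  have nz: "x \<noteq> 0" "y \<noteq> 0" using assms by (auto simp: x_def y_def)
  have "1 / x + (x - y) / x\<^sup>2 + (x - y)\<^sup>2 / (x\<^sup>2 * y) = 1 / y"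
    using nz by (simp add: divide_simps) (simp add: power2_eq_square algebra_simps)
  then show ?thesis by (simp only: z)
qed

text \<open>On one circle the first two Taylor terms of \<open>1 / (\<mu> - z)\<close> at \<zeta>
  have integrals \<open>A l\<close> and \<open>B l\<close> that are independent of \<mu>. In the
  remainder the pole of the kernel is cancelled, so that it becomes \<open>g\<close> times a
  holomorphic test function times \<open>dz\<close>, and the circle condition kills it.\<close>

lemma disc_mean_dipole:
  assumes g: "continuous_on (cball 0 1) g" and a: "\<bar>a\<bar> \<le> 1" and p: "\<bar>p\<bar> < 1"
    and ann: "annihilates_circles g a"
  obtains A B where "continuous_on {0..1} A" "continuous_on {0..1} B"
    "\<And>\<mu>. norm \<mu> > 1 \<Longrightarrow>
       disc_mean a (\<lambda>z. g z / (1 - of_real p * cnj z)\<^sup>2 / (\<mu> - z)) = dipole A B (zeta a p) \<mu>"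
proof -
  define u where "u z = g z / (1 - of_real p * cnj z)\<^sup>2" for z
  have cu: "continuous_on (cball 0 1) u"
    unfolding u_def using p mult_cnj_neq_1[of "of_real p"] by (intro continuous_intros g) auto
  define A where "A l = integral {0..1} (\<lambda>t. u (circle_point a l t) * circle_density a l t)" for l
  define B where "B l = integral {0..1} (\<lambda>t. u (circle_point a l t) * (circle_point a l t - of_real (zeta a p l)) * circle_density a l t)" for l
  have cA: "continuous_on {0..1} A"
    unfolding A_def by (rule disc_mean_inner_continuous[OF a cu])
  have "continuous_on ({0..1} \<times> {0..1::real}) (\<lambda>x. zeta a p (fst x))"
    by (rule continuous_on_compose2[OF continuous_on_zeta[OF a p]]) (auto intro!: continuous_intros)
  then have "continuous_on ({0..1} \<times> {0..1}) (\<lambda>x. u (circle_point a (fst x) (snd x)) * (circle_point a (fst x) (snd x) - of_real (zeta a p (fst x))) * circle_density a (fst x) (snd x))"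
    by (intro continuous_intros continuous_on_compose_circle_point[OF cu] a) auto
  then have cB: "continuous_on {0..1} B"
    unfolding B_def by (rule continuous_on_integral_01)
  have main: "disc_mean a (\<lambda>z. u z / (\<mu> - z)) = dipole A B (zeta a p) \<mu>" if \<mu>: "norm \<mu> > 1" for \<mu>
  proof -
    have \<mu>z: "\<mu> \<noteq> z" if "norm z \<le> 1" for z using that \<mu> by auto
    have \<mu>\<zeta>: "\<mu> \<noteq> of_real (zeta a p l)" if "l \<in> {0..1}" for l
      using zeta_abs_le[OF a p, of l] that \<mu> by auto
    have inner: "integral {0..1} (\<lambda>t. u (circle_point a l t) / (\<mu> - circle_point a l t) * circle_density a l t)
       = A l / (\<mu> - of_real (zeta a p l)) + B l / (\<mu> - of_real (zeta a p l))\<^sup>2" if l: "l \<in> {0<..<1}" for l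
    proof -
      have l01: "0 \<le> l" "l \<le> 1" "l \<in> {0..1}" using l by auto
      define \<zeta> where "\<zeta> = complex_of_real (zeta a p l)"
      define D where "D = complex_of_real (1 - l * a * p)"
      define \<rho> where "\<rho> = complex_of_real (circle_radius a l)"
      define c where "c = complex_of_real (l * a)"
      \<comment> \<open>The product of \<open>\<rho> * rot t\<close> and the density, written as a
        polynomial in \<open>z\<close>: on the circle
        \<open>(z - c) * cnj (z - c) = \<rho> ^ 2\<close>, so multiplying by \<open>z - c\<close>
        removes the conjugate.\<close>
      define j where "j z = (1 + of_real (a\<^sup>2) - 2 * of_real a * c) * (z - c) - of_real a * ((z - c)\<^sup>2 + \<rho>\<^sup>2)" for z
      have D: "D \<noteq> 0" using mult_less_one_abs[OF a p l01(1,2)] unfolding D_def of_real_eq_0_iff by linarith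
      have pt: "u (circle_point a l t) / (\<mu> - circle_point a l t) * circle_density a l t =
          u (circle_point a l t) * circle_density a l t / (\<mu> - \<zeta>) + u (circle_point a l t) * (circle_point a l t - \<zeta>) * circle_density a l t / (\<mu> - \<zeta>)\<^sup>2
          + \<rho> / (D\<^sup>2 * (\<mu> - \<zeta>)\<^sup>2) * (g (circle_point a l t) * (j (circle_point a l t) / (\<mu> - circle_point a l t)) * rot t)" for t
      proof -
        define z where "z = circle_point a l t"
        have z1: "norm z \<le> 1" unfolding z_def by (rule norm_circle_point_le[OF a l01(1,2)])
        define w where "w = 1 - of_real p * cnj z"
        have w: "w \<noteq> 0" unfolding w_def using p z1 mult_cnj_neq_1[of "of_real p" z] by auto
        have ker: "\<rho> * rot t * w = D * (z - \<zeta>)"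
          unfolding w_def z_def \<rho>_def D_def \<zeta>_def by (rule circle_point_kernel_zero[OF a p l01(1,2)])
        have zc: "z - c = \<rho> * rot t" by (simp add: z_def circle_point_def c_def \<rho>_def)
        have "circle_density a l t = 1 + of_real (a\<^sup>2) - of_real a * (z + cnj z)"
          unfolding complex_add_cnj by (simp add: circle_density_def z_def algebra_simps)
        also have "z + cnj z = 2 * c + \<rho> * rot t + \<rho> * cnj (rot t)"
          by (simp add: z_def circle_point_def c_def \<rho>_def)
        finally have dens: "circle_density a l t = 1 + of_real (a\<^sup>2) - of_real a * (2 * c + \<rho> * rot t + \<rho> * cnj (rot t))" .
        have "\<rho> * rot t * circle_density a l t = (1 + of_real (a\<^sup>2) - 2 * of_real a * c) * (\<rho> * rot t)
            - of_real a * ((\<rho> * rot t)\<^sup>2 + \<rho>\<^sup>2 * (rot t * cnj (rot t)))"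
          unfolding dens by (simp add: power2_eq_square algebra_simps del: rot_cnj_mult)
        then have jz: "\<rho> * rot t * circle_density a l t = j z" by (simp add: j_def zc)
        \<comment> \<open>Of the two factors \<open>\<rho> * rot t\<close> produced here, one turns
          the density into the polynomial \<open>j\<close> and the other supplies
          \<open>dz\<close>.\<close>
        have sq: "(z - \<zeta>)\<^sup>2 / w\<^sup>2 = (\<rho> * rot t)\<^sup>2 / D\<^sup>2"
        proof -
          have "(\<rho> * rot t)\<^sup>2 * w\<^sup>2 = D\<^sup>2 * (z - \<zeta>)\<^sup>2" using ker by (metis power_mult_distrib)
          then show ?thesis using w D by (simp add: field_simps)
        qed
        have uz: "u z = g z / w\<^sup>2" by (simp add: u_def w_def)
        have "u z / (\<mu> - z) * circle_density a l t = u z * (1 / (\<mu> - z)) * circle_density a l t" by simp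
        also have "\<dots> = u z * circle_density a l t / (\<mu> - \<zeta>) + u z * (z - \<zeta>) * circle_density a l t / (\<mu> - \<zeta>)\<^sup>2
            + g z * ((z - \<zeta>)\<^sup>2 / w\<^sup>2) * circle_density a l t / ((\<mu> - \<zeta>)\<^sup>2 * (\<mu> - z))"
          using \<mu>z[OF z1] \<mu>\<zeta>[OF l01(3)]
          by (subst double_pole_expansion[of \<mu> \<zeta> z]) (auto simp: \<zeta>_def uz distrib_left distrib_right)
        also have "g z * ((z - \<zeta>)\<^sup>2 / w\<^sup>2) * circle_density a l t / ((\<mu> - \<zeta>)\<^sup>2 * (\<mu> - z)) =
            \<rho> / (D\<^sup>2 * (\<mu> - \<zeta>)\<^sup>2) * (g z * ((\<rho> * rot t * circle_density a l t) / (\<mu> - z)) * rot t)"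
          unfolding sq by (simp add: power2_eq_square mult_ac)
        finally show ?thesis unfolding jz by (simp add: z_def)
      qed
      have cj: "continuous_on S j" for S unfolding j_def by (intro continuous_intros)
      have "integral {0..1} (\<lambda>t. g (circle_point a l t) * (j (circle_point a l t) / (\<mu> - circle_point a l t)) * rot t) = 0"
      proof -
        have "continuous_on (cball 0 1) (\<lambda>z. j z / (\<mu> - z))"
          by (intro continuous_intros cj) (use \<mu>z in auto)
        moreover have "(\<lambda>z. j z / (\<mu> - z)) holomorphic_on ball 0 1"
          unfolding j_def by (intro holomorphic_intros) (use \<mu>z in fastforce)
        ultimately show ?thesis using ann l unfolding annihilates_circles_def by blast
      qed
      moreover have "continuous_on {0..1} (\<lambda>t. g (circle_point a l t) * (j (circle_point a l t) / (\<mu> - circle_point a l t)) * rot t)"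
        by (intro continuous_intros continuous_on_compose_circle_point[OF g] a continuous_on_compose_circle_point[OF cj])
           (use l01 \<mu>z norm_circle_point_le[OF a] in auto)
      ultimately have h0: "((\<lambda>t. g (circle_point a l t) * (j (circle_point a l t) / (\<mu> - circle_point a l t)) * rot t) has_integral 0) {0..1}"
        using integrable_integral[OF integrable_continuous_real] by metis
      have hA: "((\<lambda>t. u (circle_point a l t) * circle_density a l t) has_integral A l) {0..1}"
        unfolding A_def by (intro integrable_integral disc_mean_inner_integrable[OF a cu l01(3)])
      have hB: "((\<lambda>t. u (circle_point a l t) * (circle_point a l t - \<zeta>) * circle_density a l t) has_integral B l) {0..1}"
        unfolding B_def \<zeta>_def
        by (intro integrable_integral integrable_continuous_real continuous_intros continuous_on_compose_circle_point[OF cu] a)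
           (use l01 in auto)
      have "((\<lambda>t. u (circle_point a l t) / (\<mu> - circle_point a l t) * circle_density a l t) has_integral
          A l / (\<mu> - \<zeta>) + B l / (\<mu> - \<zeta>)\<^sup>2 + \<rho> / (D\<^sup>2 * (\<mu> - \<zeta>)\<^sup>2) * 0) {0..1}"
        unfolding pt by (intro has_integral_add has_integral_divide has_integral_mult_right hA hB h0)
      then show ?thesis by (simp add: integral_unique \<zeta>_def)
    qed
    \<comment> \<open>The circle condition is available for \<open>0 < l < 1\<close> only; the two
      end values do not affect the integral over \<open>l\<close>.\<close>
    show ?thesis
      unfolding disc_mean_def dipole_def
      by (rule integral_spike[of "{0,1}"]) (use inner in auto)
  qed
  show ?thesis
    by (rule that[OF cA cB]) (use main in \<open>simp add: u_def\<close>)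
qed

lemma disc_mean_pole:
  assumes g: "continuous_on (cball 0 1) g" and ab: "-1 \<le> a" "a < p" "p < b" "b \<le> 1"
    and ann: "annihilates_circles g a" "annihilates_circles g b"
  shows "\<exists>C. \<forall>\<mu>. norm \<mu> > 1 \<longrightarrow> (\<mu> - of_real p) * disc_mean 0 (\<lambda>z. g z / (1 - of_real p * cnj z)\<^sup>2 / (\<mu> - z)) = C"
proof -
  have a: "\<bar>a\<bar> \<le> 1" and b: "\<bar>b\<bar> \<le> 1" and p: "\<bar>p\<bar> < 1" using ab by auto
  obtain A1 B1 where 1: "continuous_on {0..1} A1" "continuous_on {0..1} B1"
    "\<And>\<mu>. norm \<mu> > 1 \<Longrightarrow>
       disc_mean a (\<lambda>z. g z / (1 - of_real p * cnj z)\<^sup>2 / (\<mu> - z)) = dipole A1 B1 (zeta a p) \<mu>"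
    using disc_mean_dipole[OF g a p ann(1)] by blast
  obtain A2 B2 where 2: "continuous_on {0..1} A2" "continuous_on {0..1} B2"
    "\<And>\<mu>. norm \<mu> > 1 \<Longrightarrow>
       disc_mean b (\<lambda>z. g z / (1 - of_real p * cnj z)\<^sup>2 / (\<mu> - z)) = dipole A2 B2 (zeta b p) \<mu>"
    using disc_mean_dipole[OF g b p ann(2)] by blast
  have indep: "disc_mean s (\<lambda>z. g z / (1 - of_real p * cnj z)\<^sup>2 / (\<mu> - z)) = disc_mean 0 (\<lambda>z. g z / (1 - of_real p * cnj z)\<^sup>2 / (\<mu> - z))"
    if "norm \<mu> > 1" "\<bar>s\<bar> \<le> 1" for \<mu> s
  proof (rule disc_mean_independent[OF _ that(2)])
    show "continuous_on (cball 0 1) (\<lambda>z. g z / (1 - complex_of_real p * cnj z)\<^sup>2 / (\<mu> - z))"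
      using p that mult_cnj_neq_1[of "of_real p"] by (intro continuous_intros g) auto
  qed simp
  \<comment> \<open>A common lower bound for the rates at which the two curves leave
    \<open>p\<close>, taken from \<open>zeta_between\<close>.\<close>
  define \<kappa> where "\<kappa> = min ((p - a) * (1 - a * p) / 2) ((b - p) * (1 - b * p) / 2)"
  have "1 - a * p > 0" "1 - b * p > 0" using mult_less_one_abs[of a p 1] mult_less_one_abs[of b p 1] a b p by auto
  then have \<kappa>: "\<kappa> > 0" using ab by (simp add: \<kappa>_def)
  have z1: "-1 \<le> zeta a p l" "zeta a p l \<le> p - \<kappa> * l" if l: "l \<in> {0..1}" for l
  proof -
    show "-1 \<le> zeta a p l" using zeta_abs_le[OF a p, of l] l by auto
    obtain s where s: "l * (1 - a * p) / 2 \<le> s" "zeta a p l = p + s * (a - p)"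
      using zeta_between[OF a p, of l] l by auto
    have "\<kappa> * l \<le> (p - a) * (1 - a * p) / 2 * l" using l by (intro mult_right_mono) (auto simp: \<kappa>_def)
    also have "\<dots> = (p - a) * (l * (1 - a * p) / 2)" by simp
    also have "\<dots> \<le> (p - a) * s" using s ab by (intro mult_left_mono) auto
    finally show "zeta a p l \<le> p - \<kappa> * l" using s(2) by (simp add: algebra_simps)
  qed
  have z2: "zeta b p l \<le> 1" "p + \<kappa> * l \<le> zeta b p l" if l: "l \<in> {0..1}" for l
  proof -
    show "zeta b p l \<le> 1" using zeta_abs_le[OF b p, of l] l by auto
    obtain s where s: "l * (1 - b * p) / 2 \<le> s" "zeta b p l = p + s * (b - p)"
      using zeta_between[OF b p, of l] l by auto
    have "\<kappa> * l \<le> (b - p) * (1 - b * p) / 2 * l" using l by (intro mult_right_mono) (auto simp: \<kappa>_def)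
    also have "\<dots> = (b - p) * (l * (1 - b * p) / 2)" by simp
    also have "\<dots> \<le> (b - p) * s" using s ab by (intro mult_left_mono) auto
    finally show "p + \<kappa> * l \<le> zeta b p l" using s(2) by (simp add: algebra_simps)
  qed
  have "\<exists>C. \<forall>\<mu>. norm \<mu> > 1 \<longrightarrow> (\<mu> - of_real p) * dipole A1 B1 (zeta a p) \<mu> = C"
  proof (rule dipole_glue[OF 1(1,2) continuous_on_zeta[OF a p] 2(1,2) continuous_on_zeta[OF b p] \<kappa> z1 z2])
    show "dipole A1 B1 (zeta a p) \<mu> = dipole A2 B2 (zeta b p) \<mu>" if "norm \<mu> > 1" for \<mu>
      unfolding 1(3)[OF that, symmetric] 2(3)[OF that, symmetric] indep[OF that a] indep[OF that b] ..
  qed auto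
  then obtain C where C: "\<And>\<mu>. norm \<mu> > 1 \<Longrightarrow> (\<mu> - of_real p) * dipole A1 B1 (zeta a p) \<mu> = C" by blast
  show ?thesis
  proof (intro exI allI impI)
    fix \<mu> :: complex assume \<mu>: "norm \<mu> > 1"
    show "(\<mu> - of_real p) * disc_mean 0 (\<lambda>z. g z / (1 - of_real p * cnj z)\<^sup>2 / (\<mu> - z)) = C"
      unfolding indep[OF \<mu> a, symmetric] 1(3)[OF \<mu>] by (rule C[OF \<mu>])
  qed
qed

section \<open>Moment relations from power series in the two parameters\<close>

lemma power_series_real_vanish:
  fixes a :: "nat \<Rightarrow> complex"
  assumes r: "r > 0" and s: "\<And>x. 0 < x \<Longrightarrow> x < r \<Longrightarrow> (\<lambda>n. a n * of_real x ^ n) sums 0"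
  shows "a n = 0"
proof -
  define K where "K = complex_of_real (r / 2)"
  have sK: "summable (\<lambda>n. a n * K ^ n)" using s[of "r/2"] r by (auto simp: K_def sums_iff)
  define f where "f z = (\<Sum>n. a n * z ^ n)" for z
  have nK: "norm K = r / 2" using r by (simp add: K_def)
  have sf: "(\<lambda>n. a n * z ^ n) sums f z" if "norm z < r / 2" for z
    unfolding f_def using powser_inside[OF sK, of z] that nK by (auto intro: summable_sums)
  have f0: "f (of_real x) = 0" if "0 < x" "x < r / 2" for x
    using sf[of "of_real x"] s[of x] that r by (auto intro: sums_unique2)
  have "isCont f 0" unfolding f_def by (rule isCont_powser[OF sK]) (metis nK norm_zero half_gt_zero r)
  then have "(f \<longlongrightarrow> f 0) (at 0)" by (simp add: isCont_def)
  moreover have "((\<lambda>x. complex_of_real x) \<longlongrightarrow> 0) (at_right 0)"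
    by (auto intro!: tendsto_eq_intros)
  then have "filterlim complex_of_real (at 0) (at_right 0)"
    by (auto simp: filterlim_at eventually_at_right_less intro: eventually_mono[OF eventually_at_right_less])
  ultimately have "((\<lambda>x. f (of_real x)) \<longlongrightarrow> f 0) (at_right 0)"
    by (rule filterlim_compose)
  moreover have "((\<lambda>x. f (of_real x)) \<longlongrightarrow> 0) (at_right 0)"
    by (rule tendsto_eventually) (use r f0 in \<open>auto simp: eventually_at_right_field intro!: exI[of _ "r/2"]\<close>)
  ultimately have "f 0 = 0" by (rule tendsto_unique[rotated]) simp
  \<comment> \<open>The small positive reals are zeros accumulating at 0. The constant term has
    vanished by continuity, and a nonzero later coefficient would make 0 an isolated zero.\<close>
  show "a n = 0"
  proof (cases "n = 0")
    case True
    then show ?thesis using \<open>f 0 = 0\<close> by (simp add: f_def powser_zero)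
  next
    case False
    show ?thesis
    proof (rule ccontr)
      assume "a n \<noteq> 0"
      then obtain e where e: "e > 0" "\<And>z. z \<in> cball 0 e - {0} \<Longrightarrow> f z \<noteq> 0"
        using powser_0_nonzero[of "r/2" 0 a f n] sf r False \<open>f 0 = 0\<close> by auto
      define x where "x = min e (r / 4)"
      have "0 < x" "x < r / 2" "x \<le> e" using e r by (auto simp: x_def)
      then show False using f0[of x] e(2)[of "of_real x"] by auto
    qed
  qed
qed

lemma disc_mean_sums:
  assumes cv: "\<And>n. continuous_on (cball 0 1) (v n)"
    and b: "\<And>n z. norm z \<le> 1 \<Longrightarrow> norm (v n z) \<le> b n" "summable b"
    and w: "\<And>z. norm z \<le> 1 \<Longrightarrow> (\<lambda>n. v n z) sums w z"
    and a: "\<bar>a\<bar> \<le> 1"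
  shows "(\<lambda>n. disc_mean a (v n)) sums disc_mean a w"
proof -
  have "uniform_limit (cball 0 1) (\<lambda>n z. \<Sum>i<n. v i z) (\<lambda>z. suminf (\<lambda>i. v i z)) sequentially"
    by (rule Weierstrass_m_test) (use b in auto)
  moreover have "w z = suminf (\<lambda>i. v i z)" if "z \<in> cball 0 1" for z
    using w[of z] that by (simp add: sums_iff)
  ultimately have ul: "uniform_limit (cball 0 1) (\<lambda>n z. \<Sum>i<n. v i z) w sequentially"
    unfolding uniform_limit_iff by simp
  have cs: "continuous_on (cball 0 1) (\<lambda>z. \<Sum>i<n. v i z)" for n
    by (intro continuous_intros cv)
  have cw: "continuous_on (cball 0 1) w"
    by (rule uniform_limit_theorem[OF _ ul]) (use cs in auto)
  show ?thesis
    unfolding sums_def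
  proof (rule tendstoI)
    fix e :: real assume e: "e > 0"
    then have e8: "e / 8 > 0" by simp
    have "eventually (\<lambda>n. \<forall>z\<in>cball 0 1. dist (\<Sum>i<n. v i z) (w z) < e / 8) sequentially"
      by (rule uniform_limitD[OF ul e8])
    then show "eventually (\<lambda>n. dist (\<Sum>i<n. disc_mean a (v i)) (disc_mean a w) < e) sequentially"
    proof eventually_elim
      case (elim n)
      have "norm (disc_mean a (\<lambda>z. (\<Sum>i<n. v i z) - w z)) \<le> 4 * (e / 8)"
        using elim by (intro disc_mean_bound a continuous_intros cs cw) (auto simp: dist_norm less_imp_le)
      then show ?case using e
        by (simp add: disc_mean_diff[OF a cs cw] disc_mean_sum[OF a _ cv] dist_norm)
    qed
  qed
qed

definition moment :: "(complex \<Rightarrow> complex) \<Rightarrow> nat \<Rightarrow> nat \<Rightarrow> complex" where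
  "moment g i j = disc_mean 0 (\<lambda>z. g z * (z ^ i * cnj z ^ j))"

lemma continuous_cball_bounded:
  assumes "continuous_on (cball (0::complex) 1) g"
  obtains M where "M \<ge> 0" "\<And>z. norm z \<le> 1 \<Longrightarrow> norm (g z :: complex) \<le> M"
  using compact_imp_bounded[OF compact_continuous_image[OF assms compact_cball]]
  by (auto simp: bounded_pos) (meson imageI less_imp_le mem_cball_0)

text \<open>Writing \<open>(\<mu> - p) / (\<mu> - z)\<close> as
  \<open>1 + (z - p) / (\<mu> - z)\<close> shows that the mean of the kernel times
  \<open>g z * (z - p) / (\<mu> - z)\<close> is constant in \<mu>. Its expansion in powers of
  \<open>1 / \<mu>\<close> has no constant term, so every coefficient is 0, and these coefficients
  are the means in the statement.\<close>

lemma disc_mean_pole_residual: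
  assumes g: "continuous_on (cball 0 1) g" and ab: "-1 \<le> a" "a < p" "p < b" "b \<le> 1"
    and ann: "annihilates_circles g a" "annihilates_circles g b"
  shows "disc_mean 0 (\<lambda>z. g z * ((z - of_real p) / (1 - of_real p * cnj z)\<^sup>2) * z ^ i) = 0"
proof -
  have p: "\<bar>p\<bar> < 1" using ab by auto
  obtain C where C: "\<And>\<mu>. norm \<mu> > 1 \<Longrightarrow> (\<mu> - of_real p) * disc_mean 0 (\<lambda>z. g z / (1 - of_real p * cnj z)\<^sup>2 / (\<mu> - z)) = C"
    using disc_mean_pole[OF g ab ann] by blast
  define u where "u z = g z / (1 - of_real p * cnj z)\<^sup>2" for z
  have cu: "continuous_on (cball 0 1) u"
    unfolding u_def using p mult_cnj_neq_1[of "of_real p"] by (intro continuous_intros g) auto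
  define v where "v z = u z * (z - of_real p)" for z
  have cv: "continuous_on (cball 0 1) v" unfolding v_def by (intro continuous_intros cu)
  obtain M where M: "M \<ge> 0" "\<And>z. norm z \<le> 1 \<Longrightarrow> norm (v z) \<le> M"
    using continuous_cball_bounded[OF cv] by blast
  define C' where "C' = C - disc_mean 0 u"
  have const: "disc_mean 0 (\<lambda>z. v z / (\<mu> - z)) = C'" if \<mu>: "norm \<mu> > 1" for \<mu>
  proof -
    have ne: "\<mu> \<noteq> z" if "norm z \<le> 1" for z using that \<mu> by auto
    have "C = disc_mean 0 (\<lambda>z. (\<mu> - of_real p) * (u z / (\<mu> - z)))"
      unfolding disc_mean_cmult[of 0, simplified] C[OF \<mu>, symmetric] u_def ..
    also have "\<dots> = disc_mean 0 (\<lambda>z. u z + v z / (\<mu> - z))"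
      by (rule disc_mean_cong) (use ne in \<open>auto simp: v_def field_simps\<close>)
    also have "\<dots> = disc_mean 0 u + disc_mean 0 (\<lambda>z. v z / (\<mu> - z))"
      by (rule disc_mean_add) (use ne cu cv in \<open>auto intro!: continuous_intros\<close>)
    finally show ?thesis by (simp add: C'_def)
  qed
  define m where "m n = disc_mean 0 (\<lambda>z. v z * z ^ n)" for n
  have ser: "(\<lambda>n. m n * \<nu> ^ n * \<nu>) sums C'" if \<nu>: "norm \<nu> < 1" "\<nu> \<noteq> 0" for \<nu>
  proof -
    have "(\<lambda>n. disc_mean 0 (\<lambda>z. v z * z ^ n * \<nu> ^ n * \<nu>)) sums disc_mean 0 (\<lambda>z. v z / (1 / \<nu> - z))"
    proof (rule disc_mean_sums[where b = "\<lambda>n. M * norm \<nu> ^ n * norm \<nu>"])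
      show "norm (v z * z ^ n * \<nu> ^ n * \<nu>) \<le> M * norm \<nu> ^ n * norm \<nu>" if z: "norm z \<le> 1" for n z
      proof -
        have "norm (v z) * norm z ^ n \<le> M * 1" using M z by (intro mult_mono power_le_one) auto
        then show ?thesis unfolding norm_mult norm_power by (intro mult_right_mono) auto
      qed
      show "summable (\<lambda>n. M * norm \<nu> ^ n * norm \<nu>)"
        using \<nu> by (intro summable_mult summable_mult2 summable_geometric) auto
      show "(\<lambda>n. v z * z ^ n * \<nu> ^ n * \<nu>) sums (v z / (1 / \<nu> - z))" if z: "norm z \<le> 1" for z
      proof -
        have lt: "norm (z * \<nu>) < 1"
          using mult_right_mono[OF z norm_ge_zero[of \<nu>]] \<nu> unfolding norm_mult by linarith
        then have "z * \<nu> \<noteq> 1" by auto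
        have "(\<lambda>n. v z * \<nu> * (z * \<nu>) ^ n) sums (v z * \<nu> * (1 / (1 - z * \<nu>)))"
          by (intro sums_mult geometric_sums lt)
        moreover have "v z * \<nu> * (1 / (1 - z * \<nu>)) = v z / (1 / \<nu> - z)"
          using \<nu> \<open>z * \<nu> \<noteq> 1\<close> by (simp add: divide_simps)
        ultimately show ?thesis by (simp add: power_mult_distrib mult_ac)
      qed
    qed (auto intro!: continuous_intros cv)
    moreover have "disc_mean 0 (\<lambda>z. v z * z ^ n * \<nu> ^ n * \<nu>) = m n * \<nu> ^ n * \<nu>" for n
      using disc_mean_cmult[of 0 "\<nu> ^ n * \<nu>" "\<lambda>z. v z * z ^ n"] by (simp add: m_def mult_ac)
    moreover have "disc_mean 0 (\<lambda>z. v z / (1 / \<nu> - z)) = C'"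
      using \<nu> by (intro const) (simp add: norm_divide)
    ultimately show ?thesis by simp
  qed
  \<comment> \<open>The series and its constant sum are merged into one power series with sum 0; the
    shift by one comes from the extra factor \<nu>.\<close>
  define a' where "a' n = (case n of 0 \<Rightarrow> - C' | Suc k \<Rightarrow> m k)" for n
  have "a' (Suc i) = 0"
  proof (rule power_series_real_vanish[of 1])
    fix x :: real assume "0 < x" "x < 1"
    then have "(\<lambda>n. m n * of_real x ^ n * of_real x) sums C'" by (intro ser) auto
    then have "(\<lambda>n. a' (Suc n) * of_real x ^ Suc n) sums C'" by (simp add: a'_def mult_ac)
    then show "(\<lambda>n. a' n * of_real x ^ n) sums 0"
      by (subst (asm) sums_Suc_iff) (simp add: a'_def)
  qed simp
  then show ?thesis by (simp add: a'_def m_def v_def u_def mult_ac)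
qed

text \<open>The coefficient of \<open>p ^ j\<close> in \<open>(z - p) / (1 - p * cnj z) ^ 2\<close>
  is \<open>(j + 1) * z * cnj z ^ j - j * cnj z ^ (j - 1)\<close>, and the positive \<open>p\<close>
  near 0 determine it. The moments of each power of \<open>z\<close> satisfy the same
  recurrence.\<close>

lemma moment_recurrence:
  assumes g: "continuous_on (cball 0 1) g" and ab: "-1 \<le> a" "a < 0" "0 < b" "b \<le> 1"
    and ann: "annihilates_circles g a" "annihilates_circles g b"
  shows "of_nat (j + 1) * moment g (i + 1) j = of_nat j * moment g i (j - 1)"
proof -
  obtain M where M: "M \<ge> 0" "\<And>z. norm z \<le> 1 \<Longrightarrow> norm (g z) \<le> M"
    using continuous_cball_bounded[OF g] by blast
  define r where "r = min b 1"
  \<comment> \<open>For \<open>j = 0\<close> the truncated exponent \<open>j - 1\<close> is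
    harmless, because the factor \<open>of_nat j\<close> removes the term.\<close>
  define v where "v j z = of_nat (j + 1) * (g z * (z ^ (i + 1) * cnj z ^ j)) - of_nat j * (g z * (z ^ i * cnj z ^ (j - 1)))" for j z
  have cv: "continuous_on (cball 0 1) (v j)" for j unfolding v_def by (intro continuous_intros g)
  have "disc_mean 0 (v j) = 0" for j
  proof (rule power_series_real_vanish[of r])
    fix x :: real assume x: "0 < x" "x < r"
    have "(\<lambda>j. disc_mean 0 (\<lambda>z. of_real x ^ j * v j z)) sums
         disc_mean 0 (\<lambda>z. g z * ((z - of_real x) / (1 - of_real x * cnj z)\<^sup>2) * z ^ i)"
    proof (rule disc_mean_sums[where b = "\<lambda>j. 2 * M * (of_nat (Suc j) * x ^ j)"])
      show "norm (of_real x ^ j * v j z) \<le> 2 * M * (of_nat (Suc j) * x ^ j)" if z: "norm z \<le> 1" for j z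
      proof -
        have gz: "norm (g z) * (norm z ^ k * norm z ^ l) \<le> M * (1 * 1)" for k l
          using M z by (intro mult_mono power_le_one mult_nonneg_nonneg) auto
        have "norm (v j z) \<le> real (j + 1) * (M * (1 * 1)) + real j * (M * (1 * 1))"
          unfolding v_def by (intro order_trans[OF norm_triangle_ineq4] add_mono)
             (simp_all only: norm_mult norm_power complex_mod_cnj norm_of_nat, (intro mult_left_mono gz of_nat_0_le_iff)+)
        also have "\<dots> \<le> 2 * M * real (Suc j)" using M(1) by (simp add: algebra_simps)
        finally have "x ^ j * norm (v j z) \<le> x ^ j * (2 * M * real (Suc j))"
          using x by (intro mult_left_mono) auto
        then show ?thesis using x by (simp add: norm_mult norm_power mult_ac)
      qed
      have "summable (\<lambda>j. of_nat (Suc j) * x ^ j)"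
        using geometric_deriv_sums[of x] x by (auto simp: r_def sums_iff)
      then show "summable (\<lambda>j. 2 * M * (of_nat (Suc j) * x ^ j))" by (rule summable_mult)
      show "(\<lambda>j. of_real x ^ j * v j z) sums (g z * ((z - of_real x) / (1 - of_real x * cnj z)\<^sup>2) * z ^ i)"
        if z: "norm z \<le> 1" for z
      proof -
        define w where "w = of_real x * cnj z"
        have "norm w \<le> norm (complex_of_real x) * 1" unfolding w_def norm_mult using z by (intro mult_left_mono) auto
        then have w: "norm w < 1" using x by (simp add: r_def)
        have G: "(\<lambda>j. of_nat (Suc j) * w ^ j) sums (1 / (1 - w)\<^sup>2)" by (rule geometric_deriv_sums[OF w])
        have "(\<lambda>j. of_nat (Suc j) * (of_real x ^ Suc j * cnj z ^ j)) sums (of_real x * (1 / (1 - w)\<^sup>2))"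
          using sums_mult[OF G, of "of_real x"] by (simp add: w_def power_mult_distrib mult_ac)
        then have "(\<lambda>j. of_nat j * (of_real x ^ j * cnj z ^ (j - 1))) sums (of_real x * (1 / (1 - w)\<^sup>2))"
          using sums_Suc_iff[of "\<lambda>j. of_nat j * (of_real x ^ j * cnj z ^ (j - 1))"] by simp
        from sums_diff[OF sums_mult[OF G, of "g z * z ^ (i + 1)"] sums_mult[OF this, of "g z * z ^ i"]]
        show ?thesis by (simp add: v_def w_def power_mult_distrib algebra_simps diff_divide_distrib)
      qed
    qed (auto intro!: continuous_intros cv)
    moreover have "disc_mean 0 (\<lambda>z. g z * ((z - of_real x) / (1 - of_real x * cnj z)\<^sup>2) * z ^ i) = 0"
      by (rule disc_mean_pole_residual[OF g _ _ _ _ ann]) (use ab x in \<open>auto simp: r_def\<close>)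
    moreover have "disc_mean 0 (\<lambda>z. of_real x ^ j * v j z) = disc_mean 0 (v j) * of_real x ^ j" for j
      using disc_mean_cmult[of 0 "of_real x ^ j" "v j"] by (simp add: mult.commute)
    ultimately show "(\<lambda>n. disc_mean 0 (v n) * of_real x ^ n) sums 0"
      by (simp only:)
  qed (use ab in \<open>auto simp: r_def\<close>)
  moreover have "disc_mean 0 (v j) = of_nat (j + 1) * moment g (i + 1) j - of_nat j * moment g i (j - 1)"
    unfolding v_def moment_def
    by (subst disc_mean_diff) (auto intro!: continuous_intros g simp: disc_mean_cmult)
  ultimately show ?thesis by simp
qed

section \<open>From moments to Fourier coefficients on concentric circles\<close>

lemma integral_periodic_shift:
  fixes F :: "real \<Rightarrow> complex"
  assumes c: "continuous_on UNIV F" and per: "\<And>t. F (t + 1) = F t" and s: "0 \<le> s" "s \<le> 1"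
  shows "integral {0..1} (\<lambda>t. F (s + t)) = integral {0..1} F"
proof -
  have int: "F integrable_on {x..y}" for x y
    by (intro integrable_continuous_real continuous_on_subset[OF c]) auto
  have shift: "((\<lambda>t. F (t + d)) has_integral integral {x..y} F) {x - d..y - d}" for x y d
    using has_integral_affinity'[of F "integral {x..y} F" x y 1 d] integrable_integral[OF int[of x y]] by simp
  have "integral {0..1} (\<lambda>t. F (s + t)) = integral {s..s + 1} F"
    using integral_unique[OF shift[of s s "s + 1"]] by (simp add: add.commute)
  also have "\<dots> = integral {s..1} F + integral {1..s + 1} F"
    using Henstock_Kurzweil_Integration.integral_combine[where f = F and a = s and b = "s + 1" and c = 1] s int by simp
  also have "integral {1..s + 1} F = integral {0..s} F"
    using integral_unique[OF shift[of 1 1 "s + 1"]] by (simp add: per)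
  also have "integral {s..1} F + integral {0..s} F = integral {0..1} F"
    using Henstock_Kurzweil_Integration.integral_combine[OF s int] by (simp add: add.commute)
  finally show ?thesis .
qed

text \<open>Orthogonality to all polynomials passes by uniform approximation to
  \<open>cnj (v l)\<close>, so the integral of the squared modulus of \<open>v\<close> is 0. Powers
  of \<open>1 - l\<close> appear because \<open>1 - l\<close> is the squared radius of the circles
  around 0.\<close>

lemma moments_vanish:
  fixes v :: "real \<Rightarrow> complex"
  assumes c: "continuous_on {0..1} v" and m: "\<And>n. integral {0..1} (\<lambda>l. of_real (1 - l) ^ n * v l) = 0"
    and l: "l \<in> {0..1}"
  shows "v l = 0"
proof -
  obtain M where M: "M > 0" "\<And>l. l \<in> {0..1} \<Longrightarrow> norm (v l) \<le> M"
    using compact_imp_bounded[OF compact_continuous_image[OF c compact_Icc]] by (auto simp: bounded_pos)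
  have small: "norm (integral {0..1} (\<lambda>l. v l * cnj (v l))) \<le> \<epsilon>" if "\<epsilon> > 0" for \<epsilon>
  proof -
    \<comment> \<open>The approximation lemma concerns subsets of the plane, so the interval is
      embedded there with \<open>1 - l\<close> as coordinate; then \<open>z\<close> and
      \<open>cnj z\<close> coincide.\<close>
    have "continuous_on (complex_of_real ` {0..1}) (\<lambda>z. cnj (v (1 - Re z)))"
      by (intro continuous_intros continuous_on_compose2[OF c]) auto
    note cont = this
    have comp: "compact (complex_of_real ` {0..1})"
      by (intro compact_continuous_image continuous_intros compact_Icc)
    have "\<epsilon> / M > 0" using that M by simp
    then obtain k N where k: "\<And>z. z \<in> complex_of_real ` {0..1} \<Longrightarrow>
        norm (cnj (v (1 - Re z)) - (\<Sum>i<N. \<Sum>j<N. k i j * (z ^ i * cnj z ^ j))) < \<epsilon> / M"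
      by (rule Stone_Weierstrass_complex[OF comp cont]) blast
    define P where "P l = (\<Sum>i<N. \<Sum>j<N. k i j * (of_real (1 - l) ^ i * of_real (1 - l) ^ j))" for l :: real
    have kP: "norm (cnj (v l) - P l) \<le> \<epsilon> / M" if "l \<in> {0..1}" for l
    proof -
      have "complex_of_real (1 - l) \<in> complex_of_real ` {0..1}"
        by (rule imageI) (use that in auto)
      from k[OF this] show ?thesis by (simp add: P_def)
    qed
    have cP: "continuous_on {0..1} P" unfolding P_def by (intro continuous_intros)
    have "integral {0..1} (\<lambda>l. v l * P l) = integral {0..1} (\<lambda>l. \<Sum>i<N. \<Sum>j<N. k i j * (of_real (1 - l) ^ (i + j) * v l))"
      by (intro integral_cong) (simp add: P_def sum_distrib_left power_add mult_ac)
    also have "\<dots> = (\<Sum>i<N. \<Sum>j<N. k i j * integral {0..1} (\<lambda>l. of_real (1 - l) ^ (i + j) * v l))"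
      by (subst integral_sum, simp, intro integrable_continuous_real continuous_intros c,
          intro sum.cong refl, subst integral_sum, simp, intro integrable_continuous_real continuous_intros c) simp
    also have "\<dots> = 0" by (simp only: m) simp
    finally have vP: "integral {0..1} (\<lambda>l. v l * P l) = 0" .
    have "integral {0..1} (\<lambda>l. v l * cnj (v l)) = integral {0..1} (\<lambda>l. v l * cnj (v l)) - integral {0..1} (\<lambda>l. v l * P l)"
      by (simp only: vP) simp
    also have "\<dots> = integral {0..1} (\<lambda>l. v l * cnj (v l) - v l * P l)"
      by (intro integral_diff[symmetric] integrable_continuous_real continuous_intros c cP)
    also have "norm \<dots> \<le> integral {0..1} (\<lambda>l::real. M * (\<epsilon> / M))"
    proof (intro integral_norm_bound_integral integrable_continuous_real continuous_intros c cP)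
      fix l :: real assume l: "l \<in> {0..1}"
      have "norm (v l * (cnj (v l) - P l)) \<le> M * (\<epsilon> / M)"
        unfolding norm_mult using l M kP by (intro mult_mono) auto
      then show "norm (v l * cnj (v l) - v l * P l) \<le> M * (\<epsilon> / M)" by (simp add: right_diff_distrib)
    qed
    finally show ?thesis using M by simp
  qed
  have "norm (integral {0..1} (\<lambda>l. v l * cnj (v l))) \<le> 0"
    by (rule field_le_epsilon) (use small in simp)
  moreover have "((\<lambda>l. complex_of_real ((norm (v l))\<^sup>2)) has_integral of_real (integral {0..1} (\<lambda>l. (norm (v l))\<^sup>2))) {0..1}"
    by (intro has_integral_of_real integrable_integral integrable_continuous_real continuous_intros c)
  then have "integral {0..1} (\<lambda>l. v l * cnj (v l)) = of_real (integral {0..1} (\<lambda>l. (norm (v l))\<^sup>2))"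
    by (simp only: complex_norm_square[symmetric] integral_unique)
  ultimately have "integral {0..1} (\<lambda>l. (norm (v l))\<^sup>2) = 0" by simp
  then have "\<forall>l\<in>{0..1}. (norm (v l))\<^sup>2 = 0"
    by (subst (asm) integral_eq_0_iff) (auto intro!: continuous_intros c)
  then show ?thesis using l by simp
qed

lemma has_integral_one_minus_power:
  "((\<lambda>l. complex_of_real (1 - l) ^ n) has_integral 1 / of_nat (n + 1)) {0..1}"
proof -
  have "((\<lambda>l. (1 - l) ^ n) has_integral (- ((1 - 1) ^ (n + 1)) / real (n + 1) - - ((1 - 0) ^ (n + 1)) / real (n + 1))) {0..1}"
  proof (rule fundamental_theorem_of_calculus)
    fix l :: real
    have "((\<lambda>l. - ((1 - l) ^ (n + 1)) / real (n + 1)) has_real_derivative (- (real (n + 1) * (1 - l) ^ n * (- 1)) / real (n + 1))) (at l within {0..1})"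
    proof -
      have "((\<lambda>l. 1 - l) has_real_derivative -1) (at l within {0..1})"
        by (auto intro!: derivative_eq_intros)
      from DERIV_cmult[OF DERIV_power[OF this, of "n + 1"], of "- 1 / real (n + 1)"]
      show ?thesis by (simp del: of_nat_Suc of_nat_add)
    qed
    then show "((\<lambda>l. - ((1 - l) ^ (n + 1)) / real (n + 1)) has_vector_derivative (1 - l) ^ n) (at l within {0..1})"
      by (simp add: has_real_derivative_iff_has_vector_derivative del: of_nat_Suc of_nat_add)
  qed simp
  from has_integral_of_real[OF this, where 'b = complex] show ?thesis by simp
qed

text \<open>With this sign it is the Fourier coefficient of order \<open>- m\<close>; for a
  holomorphic function it vanishes when \<open>m > 0\<close>.\<close>

definition circle_coeff :: "(complex \<Rightarrow> complex) \<Rightarrow> int \<Rightarrow> real \<Rightarrow> complex" where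
  "circle_coeff g m l = integral {0..1} (\<lambda>t. g (circle_point 0 l t) * rot (of_int m * t))"

lemma moment_circle_coeff:
  "moment g i j = integral {0..1} (\<lambda>l. of_real (circle_radius 0 l) ^ (i + j) * circle_coeff g (int i - int j) l)"
proof -
  have "g (circle_point 0 l t) * (circle_point 0 l t ^ i * cnj (circle_point 0 l t) ^ j) * circle_density 0 l t =
      of_real (circle_radius 0 l) ^ (i + j) * (g (circle_point 0 l t) * rot (of_int (int i - int j) * t))" for l t
  proof -
    have "rot t ^ i * cnj (rot t) ^ j = rot (of_int (int i - int j) * t)"
      by (simp add: rot_power flip: rot_minus rot_add) (simp add: algebra_simps)
    then show ?thesis
      by (simp add: circle_point_def circle_density_def power_mult_distrib power_add mult_ac)
  qed
  then show ?thesis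
    unfolding moment_def disc_mean_def circle_coeff_def by (simp only: integral_mult_right)
qed

lemma continuous_on_circle_coeff:
  assumes "continuous_on (cball 0 1) g"
  shows "continuous_on {0..1} (circle_coeff g m)"
proof -
  have "continuous_on ({0..1} \<times> {0..1}) (\<lambda>x. g (circle_point 0 (fst x) (snd x)) * rot (of_int m * snd x))"
    by (intro continuous_intros continuous_on_compose_circle_point assms) auto
  from continuous_on_integral_01[OF this] show ?thesis by (simp add: circle_coeff_def [abs_def])
qed

text \<open>By the recurrence the moments with \<open>i > j\<close> vanish, and
  \<open>(n + k + 1) * moment g n (n + k)\<close> does not depend on \<open>n\<close>: these are the
  moments of a multiple of \<open>z ^ k\<close>. The moments with a fixed difference
  \<open>i - j\<close> are those of a single Fourier coefficient, times a power of the radius,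
  against all powers of \<open>1 - l\<close>, and they determine it.\<close>

lemma circle_coeff_power:
  assumes g: "continuous_on (cball 0 1) g"
    and rec: "\<And>i j. of_nat (j + 1) * moment g (i + 1) j = of_nat j * moment g i (j - 1)"
    and l: "0 \<le> l" "l < 1"
  shows "m > 0 \<Longrightarrow> circle_coeff g m l = 0"
    and "circle_coeff g (- int k) l = of_nat (k + 1) * moment g 0 k * of_real (circle_radius 0 l) ^ k"
proof -
  have r2: "(complex_of_real (circle_radius 0 l))\<^sup>2 = of_real (1 - l)" if "l \<in> {0..1}" for l
    using that by (simp add: circle_radius_def flip: of_real_power)
  have r2n: "complex_of_real (1 - l) ^ n = of_real (circle_radius 0 l) ^ n * of_real (circle_radius 0 l) ^ n" if "l \<in> {0..1}" for l n
    unfolding r2[OF that, symmetric] by (simp add: power2_eq_square power_mult_distrib)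
  have rpos: "of_real (circle_radius 0 l) \<noteq> (0 :: complex)" using l by (simp add: circle_radius_def)
  have l01: "l \<in> {0..1}" using l by simp
  have zero: "moment g i j = 0" if "i > j" for i j
    using that
  proof (induction j arbitrary: i)
    case 0
    then show ?case using rec[of 0 "i - 1"] by simp
  next
    case (Suc j)
    then have "moment g (i - 1) j = 0" by simp
    then show ?case using rec[of "Suc j" "i - 1"] Suc.prems by (simp del: of_nat_Suc of_nat_add)
  qed
  show "circle_coeff g m l = 0" if "m > 0"
  proof -
    define k where "k = nat m"
    have k: "m = int k" "k > 0" using that by (auto simp: k_def)
    \<comment> \<open>The factor makes the total power of the radius even, hence a power of
      \<open>1 - l\<close>. It can be divided out because \<open>l < 1\<close>.\<close>
    have "of_real (circle_radius 0 l) ^ k * circle_coeff g m l = 0"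
    proof (rule moments_vanish[of "\<lambda>l. of_real (circle_radius 0 l) ^ k * circle_coeff g m l"])
      fix n
      have "moment g (n + k) n = 0" using k by (intro zero) simp
      also have "moment g (n + k) n = integral {0..1} (\<lambda>l. of_real (1 - l) ^ n * (of_real (circle_radius 0 l) ^ k * circle_coeff g m l))"
        unfolding moment_circle_coeff
      proof (rule integral_cong)
        fix l :: real assume "l \<in> {0..1}"
        show "of_real (circle_radius 0 l) ^ (n + k + n) * circle_coeff g (int (n + k) - int n) l =
           of_real (1 - l) ^ n * (of_real (circle_radius 0 l) ^ k * circle_coeff g m l)"
          unfolding r2n[OF \<open>l \<in> {0..1}\<close>] by (simp add: k power_add mult_ac)
      qed
      finally show "integral {0..1} (\<lambda>l. of_real (1 - l) ^ n * (of_real (circle_radius 0 l) ^ k * circle_coeff g m l)) = 0" by simp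
    next
      show "continuous_on {0..1} (\<lambda>l. of_real (circle_radius 0 l) ^ k * circle_coeff g m l)"
        by (intro continuous_intros continuous_on_circle_coeff g)
    next
      show "l \<in> {0..1}" by (rule l01)
    qed
    then show ?thesis using rpos by simp
  qed
  define \<gamma> where "\<gamma> = of_nat (k + 1) * moment g 0 k"
  have mk: "of_nat (n + k + 1) * moment g n (n + k) = \<gamma>" for n
  proof (induction n)
    case 0
    then show ?case by (simp add: \<gamma>_def)
  next
    case (Suc n)
    then show ?case using rec[of "Suc n + k" n] by (simp add: add.commute)
  qed
  have "of_real (circle_radius 0 l) ^ k * circle_coeff g (- int k) l - \<gamma> * of_real (1 - l) ^ k = 0"
  proof (rule moments_vanish[of "\<lambda>l. of_real (circle_radius 0 l) ^ k * circle_coeff g (- int k) l - \<gamma> * of_real (1 - l) ^ k"])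
    fix n
    have c1: "continuous_on {0..1} (\<lambda>l. of_real (1 - l) ^ n * (of_real (circle_radius 0 l) ^ k * circle_coeff g (- int k) l))"
      by (intro continuous_intros continuous_on_circle_coeff g)
    have "integral {0..1} (\<lambda>l. of_real (1 - l) ^ n * (of_real (circle_radius 0 l) ^ k * circle_coeff g (- int k) l)) = moment g n (n + k)"
      unfolding moment_circle_coeff
    proof (rule integral_cong)
      fix l :: real assume "l \<in> {0..1}"
      show "of_real (1 - l) ^ n * (of_real (circle_radius 0 l) ^ k * circle_coeff g (- int k) l) =
          of_real (circle_radius 0 l) ^ (n + (n + k)) * circle_coeff g (int n - int (n + k)) l"
        unfolding r2n[OF \<open>l \<in> {0..1}\<close>] by (simp add: power_add mult_ac)
    qed
    then have "((\<lambda>l. of_real (1 - l) ^ n * (of_real (circle_radius 0 l) ^ k * circle_coeff g (- int k) l)) has_integral moment g n (n + k)) {0..1}"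
      using integrable_integral[OF integrable_continuous_real[OF c1]] by simp
    from has_integral_diff[OF this has_integral_mult_right[OF has_integral_one_minus_power[of "n + k"], of \<gamma>]]
    have "((\<lambda>l. of_real (1 - l) ^ n * (of_real (circle_radius 0 l) ^ k * circle_coeff g (- int k) l - \<gamma> * of_real (1 - l) ^ k))
        has_integral (moment g n (n + k) - \<gamma> * (1 / of_nat (n + k + 1)))) {0..1}"
      by (simp add: power_add right_diff_distrib mult_ac del: of_nat_Suc of_nat_add)
    moreover have "moment g n (n + k) - \<gamma> * (1 / of_nat (n + k + 1)) = 0"
      unfolding mk[of n, symmetric] by (simp del: of_nat_Suc of_nat_add)
    ultimately show "integral {0..1} (\<lambda>l. of_real (1 - l) ^ n * (of_real (circle_radius 0 l) ^ k * circle_coeff g (- int k) l - \<gamma> * of_real (1 - l) ^ k)) = 0"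
      by (simp add: integral_unique)
  next
    show "continuous_on {0..1} (\<lambda>l. of_real (circle_radius 0 l) ^ k * circle_coeff g (- int k) l - \<gamma> * of_real (1 - l) ^ k)"
      by (intro continuous_intros continuous_on_circle_coeff g)
  next
    show "l \<in> {0..1}" by (rule l01)
  qed
  then have "of_real (circle_radius 0 l) ^ k * circle_coeff g (- int k) l = of_real (circle_radius 0 l) ^ k * (\<gamma> * of_real (circle_radius 0 l) ^ k)"
    unfolding r2n[OF l01] by (simp add: mult_ac)
  then show "circle_coeff g (- int k) l = of_nat (k + 1) * moment g 0 k * of_real (circle_radius 0 l) ^ k"
    using rpos by (simp add: \<gamma>_def)
qed

text \<open>All circles around 0 carry the Fourier coefficients of one power series. Instead of
  proving its convergence, \<open>g\<close> is averaged along the circles against a trigonometric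
  kernel: this leaves finitely many terms, so \<open>g\<close> is a uniform limit of polynomials in
  \<open>z\<close>.\<close>

theorem holomorphic_of_two_circle_families:
  assumes g: "continuous_on (cball 0 1) g" and ab: "-1 \<le> a" "a < 0" "0 < b" "b \<le> 1"
    and ann: "annihilates_circles g a" "annihilates_circles g b"
  shows "g holomorphic_on ball 0 1"
proof -
  define \<gamma> where "\<gamma> k = of_nat (k + 1) * moment g 0 k" for k
  have rec: "of_nat (j + 1) * moment g (i + 1) j = of_nat j * moment g i (j - 1)" for i j
    by (rule moment_recurrence[OF g ab ann])
  obtain M where M: "M \<ge> 0" "\<And>z. norm z \<le> 1 \<Longrightarrow> norm (g z) \<le> M"
    using continuous_cball_bounded[OF g] by blast
  \<comment> \<open>The origin is left out because the argument divides by the radius; it is a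
    removable singularity, since \<open>g\<close> is continuous.\<close>
  have approx: "\<exists>P. P holomorphic_on UNIV \<and> (\<forall>z\<in>ball 0 1 - {0}. norm (P z - g z) \<le> \<epsilon>)" if \<epsilon>: "\<epsilon> > 0" for \<epsilon>
  proof -
    obtain \<delta> where \<delta>: "\<delta> > 0" "\<And>x y. x \<in> cball 0 1 \<Longrightarrow> y \<in> cball 0 1 \<Longrightarrow> dist y x < \<delta> \<Longrightarrow> dist (g y) (g x) < \<epsilon> / 2"
      using compact_uniformly_continuous[OF g compact_cball] \<epsilon> unfolding uniformly_continuous_on_def
      by (metis half_gt_zero)
    define \<eta> where "\<eta> = \<epsilon> / 2 / (M + 1)"
    have \<eta>: "\<eta> > 0" "\<eta> * M \<le> \<epsilon> / 2"
    proof -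
      show "\<eta> > 0" using \<epsilon> M by (simp add: \<eta>_def)
      have "\<eta> * M \<le> \<eta> * (M + 1)" using \<open>\<eta> > 0\<close> by simp
      also have "\<dots> = \<epsilon> / 2" proof -
        have "M + 1 \<noteq> 0" using M(1) by linarith
        then show ?thesis by (metis \<eta>_def nonzero_divide_eq_eq)
      qed
      finally show "\<eta> * M \<le> \<epsilon> / 2" .
    qed
    \<comment> \<open>The coefficients depend on \<delta> and \<eta> only, so one polynomial serves
      all circles at once.\<close>
    obtain c N where ker: "\<And>h M \<omega>. continuous_on (sphere 0 1) h \<Longrightarrow> (\<And>u. norm u = 1 \<Longrightarrow> norm (h u) \<le> M) \<Longrightarrow>
      (\<And>u. norm u = 1 \<Longrightarrow> norm (u - 1) < \<delta> \<Longrightarrow> norm (h u - h 1) \<le> \<omega>) \<Longrightarrow>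
      norm ((\<Sum>i<N. \<Sum>j<N. c i j * integral {0..1} (\<lambda>t. h (rot t) * rot (of_int (int i - int j) * t))) - h 1)
      \<le> \<omega> + \<eta> * M"
      by (rule trigonometric_kernel[OF \<delta>(1) \<eta>(1)]) blast
    define q where "q i j z = (if i \<le> j then \<gamma> (j - i) * z ^ (j - i) else 0)" for i j :: nat and z :: complex
    define P where "P z = (\<Sum>i<N. \<Sum>j<N. c i j * q i j z)" for z
    have "q i j holomorphic_on UNIV" for i j
      by (cases "i \<le> j") (auto simp: q_def [abs_def] intro!: holomorphic_intros)
    then have "P holomorphic_on UNIV"
      unfolding P_def by (intro holomorphic_intros)
    moreover have "norm (P z - g z) \<le> \<epsilon>" if z: "z \<in> ball 0 1 - {0}" for z
    proof -
      define r where "r = norm z"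
      have r: "0 < r" "r < 1" using z by (auto simp: r_def)
      obtain s where s: "s \<in> {0..1}" "z / of_real r = rot s"
        using rot_surj[of "z / of_real r"] r by (auto simp: r_def norm_divide)
      then have zs: "z = of_real r * rot s" using r by (simp add: field_simps)
      define l where "l = 1 - r\<^sup>2"
      have l: "0 \<le> l" "l < 1" using r by (auto simp: l_def power_le_one)
      have cr: "circle_radius 0 l = r" using r by (simp add: circle_radius_def l_def)
      have cp: "circle_point 0 l t = of_real r * rot t" for t by (simp add: circle_point_def cr)
      \<comment> \<open>Starting the angle at \<open>z = r * rot s\<close> multiplies the
        coefficient by a power of \<open>rot s\<close>, and
        \<open>r ^ (j - i) * rot s ^ (j - i)\<close> is \<open>z ^ (j - i)\<close>.\<close>
      have co: "integral {0..1} (\<lambda>t. g (z * rot t) * rot (of_int (int i - int j) * t)) = q i j z" for i j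
      proof -
        define m where "m = int i - int j"
        define F where "F t = g (of_real r * rot t) * rot (of_int m * t)" for t
        have "continuous_on UNIV F" unfolding F_def
          by (intro continuous_intros continuous_on_compose2[OF g]) (use r in \<open>auto simp: norm_mult\<close>)
        moreover have "F (t + 1) = F t" for t
          by (simp add: F_def rot_add distrib_left)
        ultimately have sh: "integral {0..1} (\<lambda>t. F (s + t)) = integral {0..1} F"
          using s by (intro integral_periodic_shift) auto
        have "g (z * rot t) * rot (of_int m * t) = rot (- (of_int m * s)) * F (s + t)" for t
        proof -
          have "rot (- (of_int m * s)) * rot (of_int m * (s + t)) = rot (of_int m * t)"
            unfolding rot_add[symmetric] by (simp add: algebra_simps)
          then show ?thesis by (simp add: F_def zs rot_add mult_ac)
        qed
        then have "integral {0..1} (\<lambda>t. g (z * rot t) * rot (of_int m * t)) = rot (- (of_int m * s)) * integral {0..1} F"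
          by (simp only: sh integral_mult_right)
        also have "integral {0..1} F = circle_coeff g m l"
          by (simp only: circle_coeff_def F_def [abs_def] cp)
        also have "rot (- (of_int m * s)) * circle_coeff g m l = q i j z"
        proof (cases "i \<le> j")
          case True
          then have m: "m = - int (j - i)" by (simp add: m_def)
          have rs: "rot (- (of_int m * s)) = rot s ^ (j - i)" unfolding rot_power m by simp
          show ?thesis
            unfolding rs unfolding m circle_coeff_power(2)[OF g rec l] cr
            using True by (simp add: q_def \<gamma>_def zs power_mult_distrib)
        next
          case False
          then show ?thesis using circle_coeff_power(1)[OF g rec l, of m] by (simp add: q_def m_def)
        qed
        finally show ?thesis by (simp add: m_def)
      qed
      have in1: "norm (z * u) \<le> 1" if "norm u = 1" for u using that z by (simp add: norm_mult)
      have "norm ((\<Sum>i<N. \<Sum>j<N. c i j * integral {0..1} (\<lambda>t. g (z * rot t) * rot (of_int (int i - int j) * t))) - g (z * 1)) \<le> \<epsilon> / 2 + \<eta> * M"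
      proof (rule ker)
        show "continuous_on (sphere 0 1) (\<lambda>u. g (z * u))"
          by (intro continuous_on_compose2[OF g] continuous_intros) (use in1 in auto)
        show "norm (g (z * u)) \<le> M" if "norm u = 1" for u using M(2) in1 that by blast
        show "norm (g (z * u) - g (z * 1)) \<le> \<epsilon> / 2" if u: "norm u = 1" "norm (u - 1) < \<delta>" for u
        proof -
          have "dist (z * u) z = r * norm (u - 1)"
            by (simp add: dist_norm r_def flip: norm_mult) (simp add: algebra_simps)
          also have "\<dots> \<le> 1 * norm (u - 1)" using r by (intro mult_right_mono) auto
          finally have "dist (z * u) z < \<delta>" using u by simp
          then have "dist (g (z * u)) (g z) < \<epsilon> / 2" using \<delta>(2)[of z "z * u"] in1[OF u(1)] z by auto
          then show ?thesis by (simp add: dist_norm)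
        qed
      qed
      then have "norm (P z - g z) \<le> \<epsilon> / 2 + \<eta> * M" unfolding co P_def by simp
      then show ?thesis using \<eta>(2) by linarith
    qed
    ultimately show ?thesis by blast
  qed
  have "\<exists>P. P holomorphic_on UNIV \<and> (\<forall>z\<in>ball 0 1 - {0}. norm (P z - g z) \<le> inverse (real (Suc n)))" for n
    by (rule approx) simp
  then obtain P where P: "\<And>n. P n holomorphic_on UNIV"
      "\<And>n z. z \<in> ball 0 1 - {0} \<Longrightarrow> norm (P n z - g z) \<le> inverse (real (Suc n))"
    by metis
  have ul: "uniform_limit (ball 0 1 - {0}) P g sequentially"
  proof (rule uniform_limitI)
    fix e :: real assume "e > 0"
    then have "eventually (\<lambda>n. inverse (real (Suc n)) < e) sequentially"
      using LIMSEQ_inverse_real_of_nat by (rule order_tendstoD(2)[rotated])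
    then show "eventually (\<lambda>n. \<forall>z\<in>ball 0 1 - {0}. dist (P n z) (g z) < e) sequentially"
    proof eventually_elim
      case (elim n)
      show ?case
      proof
        fix z :: complex assume "z \<in> ball 0 1 - {0}"
        from P(2)[OF this, of n] elim show "dist (P n z) (g z) < e" by (simp add: dist_norm)
      qed
    qed
  qed
  have "g holomorphic_on (ball 0 1 - {0})"
  proof (rule holomorphic_uniform_sequence)
    show "open (ball (0::complex) 1 - {0})" by auto
    show "P n holomorphic_on ball 0 1 - {0}" for n using P(1) holomorphic_on_subset by blast
    fix z :: complex assume "z \<in> ball 0 1 - {0}"
    then obtain d where "d > 0" "cball z d \<subseteq> ball 0 1 - {0}"
      using open_contains_cball[of "ball (0::complex) 1 - {0}"] by (metis open_ball open_delete)
    then show "\<exists>d>0. cball z d \<subseteq> ball 0 1 - {0} \<and> uniform_limit (cball z d) P g sequentially"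
      using uniform_limit_on_subset[OF ul] by blast
  qed
  then show ?thesis
    by (rule no_isolated_singularity[rotated]) (auto intro: continuous_on_subset[OF g])
qed

section \<open>Fibres of the sphere\<close>

lemma contour_integral_circlepath_rot:
  "contour_integral (circlepath z r) f = integral {0..1} (\<lambda>t. f (z + of_real r * rot t) * (2 * of_real pi * \<i> * of_real r * rot t))"
  unfolding contour_integral_integral vector_derivative_circlepath
  by (intro integral_cong) (simp add: circlepath rot_def cis_conv_exp mult_ac)

text \<open>Cauchy's formula at the centre for \<open>f u * (u - z)\<close>, which vanishes there.
  In this form \<open>f\<close> has to be only continuous up to the circle.\<close>

lemma Cauchy_circle_rot:
  assumes c: "continuous_on (cball z r) f" and h: "f holomorphic_on ball z r" and r: "r > 0"
  shows "integral {0..1} (\<lambda>t. f (z + of_real r * rot t) * rot t) = 0"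
proof -
  have "((\<lambda>u. f u * (u - z) / (u - z)) has_contour_integral (2 * of_real pi * \<i> * (f z * (z - z)))) (circlepath z r)"
    by (rule Cauchy_integral_circlepath) (use r in \<open>auto intro!: continuous_intros holomorphic_intros c h\<close>)
  from contour_integral_unique[OF this]
  have "integral {0..1} (\<lambda>t. 2 * of_real pi * \<i> * of_real r * (f (z + of_real r * rot t) * rot t)) = 0"
    using r by (simp add: contour_integral_circlepath_rot mult_ac)
  then show ?thesis using r by simp
qed

lemma open_slices:
  assumes U: "open U"
  shows "open {z. (z, w) \<in> U}" "open {w. (z, w) \<in> U}"
proof -
  have "continuous_on UNIV (\<lambda>z. (z, w))" "continuous_on UNIV (\<lambda>w. (z, w))" by (intro continuous_intros)+
  then show "open {z. (z, w) \<in> U}" "open {w. (z, w) \<in> U}"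
    using open_vimage[OF U, of "\<lambda>z. (z, w)"] open_vimage[OF U, of "\<lambda>w. (z, w)"]
    by (auto simp: vimage_def)
qed

text \<open>The total derivative exists once the partial derivative in \<open>z\<close> exists at
  the point and the one in \<open>w\<close> is jointly continuous nearby. The latter holds because
  Cauchy's formula gives it as an integral over a fixed circle with jointly continuous
  integrand.\<close>

lemma Osgood:
  fixes F :: "complex \<times> complex \<Rightarrow> complex"
  assumes U: "open U" and c: "continuous_on U F"
    and h1: "\<And>w. (\<lambda>z. F (z, w)) holomorphic_on {z. (z, w) \<in> U}"
    and h2: "\<And>z. (\<lambda>w. F (z, w)) holomorphic_on {w. (z, w) \<in> U}"
    and x: "(z0, w0) \<in> U"
  shows "\<exists>A B. (F has_derivative (\<lambda>(s, t). A * s + B * t)) (at (z0, w0))"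
proof -
  obtain V W where VW: "open V" "open W" "z0 \<in> V" "w0 \<in> W" "V \<times> W \<subseteq> U"
    using open_prod_elim[OF U x] by (metis mem_Sigma_iff)
  obtain r where r: "r > 0" "ball z0 r \<subseteq> V" using VW by (auto simp: open_contains_ball)
  obtain \<rho> where \<rho>: "\<rho> > 0" "cball w0 \<rho> \<subseteq> W" using VW(2,4) by (auto simp: open_contains_cball)
  define X where "X = ball z0 r"
  define Y where "Y = ball w0 \<rho>"
  have XY: "X \<times> cball w0 \<rho> \<subseteq> U" using r \<rho> VW unfolding X_def by blast
  have oU: "open {z. (z, w) \<in> U}" for w
    by (rule open_slices(1)[OF U])
  define Fw where "Fw z w = integral {0..1} (\<lambda>t. F (z, w0 + of_real \<rho> * rot t) / (w0 + of_real \<rho> * rot t - w)\<^sup>2 * (of_real \<rho> * rot t))" for z w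
  have dw: "((\<lambda>w. F (z, w)) has_field_derivative Fw z w) (at w)" if z: "z \<in> X" and w: "w \<in> Y" for z w
  proof -
    have "cball w0 \<rho> \<subseteq> {w. (z, w) \<in> U}" using XY z by auto
    then have h: "(\<lambda>w. F (z, w)) holomorphic_on cball w0 \<rho>" using h2 holomorphic_on_subset by blast
    have "((\<lambda>w. F (z, w)) has_field_derivative (1 / (2 * of_real pi * \<i>) *
        contour_integral (circlepath w0 \<rho>) (\<lambda>u. F (z, u) / (u - w)\<^sup>2))) (at w)"
      by (rule Cauchy_derivative_integral_circlepath(2))
         (use h w in \<open>auto simp: Y_def intro: holomorphic_on_imp_continuous_on holomorphic_on_subset\<close>)
    moreover have "1 / (2 * of_real pi * \<i>) * contour_integral (circlepath w0 \<rho>) (\<lambda>u. F (z, u) / (u - w)\<^sup>2) =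
       1 / (2 * of_real pi * \<i>) * integral {0..1} (\<lambda>t. 2 * of_real pi * \<i> * (F (z, w0 + of_real \<rho> * rot t) / (w0 + of_real \<rho> * rot t - w)\<^sup>2 * (of_real \<rho> * rot t)))"
      unfolding contour_integral_circlepath_rot by (rule arg_cong2[where f = times, OF refl], rule integral_cong) simp
    ultimately show ?thesis unfolding Fw_def integral_mult_right by simp
  qed
  have cFw: "continuous_on (X \<times> Y) (\<lambda>x. Fw (fst x) (snd x))"
  proof -
    have ne: "w0 + of_real \<rho> * rot t - w \<noteq> 0" if "w \<in> Y" for w t
    proof
      assume "w0 + of_real \<rho> * rot t - w = 0"
      then have "w = w0 + of_real \<rho> * rot t" by simp
      then have "dist w0 w = \<rho>" using \<rho> by (simp add: dist_norm norm_mult)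
      then show False using that by (simp add: Y_def)
    qed
    have "continuous_on ((X \<times> Y) \<times> {0..1}) (\<lambda>x. F (fst (fst x), w0 + of_real \<rho> * rot (snd x)))"
    proof (rule continuous_on_compose2[OF c])
      show "(\<lambda>x. (fst (fst x), w0 + of_real \<rho> * rot (snd x))) ` ((X \<times> Y) \<times> {0..1}) \<subseteq> U"
        using XY \<rho> by (auto simp: dist_norm norm_mult subset_iff)
    qed (auto intro!: continuous_intros)
    then have "continuous_on ((X \<times> Y) \<times> {0..1}) (\<lambda>x. F (fst (fst x), w0 + of_real \<rho> * rot (snd x)) /
        (w0 + of_real \<rho> * rot (snd x) - snd (fst x))\<^sup>2 * (of_real \<rho> * rot (snd x)))"
      using ne by (intro continuous_intros) auto
    from continuous_on_integral_01[OF this] show ?thesis by (simp add: Fw_def)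
  qed
  have x0: "(z0, w0) \<in> X \<times> Y" using r \<rho> by (simp add: X_def Y_def)
  have oXY: "open (X \<times> Y)" by (simp add: X_def Y_def open_Times)
  have "(\<lambda>z. F (z, w0)) field_differentiable at z0"
    using holomorphic_on_imp_differentiable_at[OF h1 oU] x by auto
  then obtain A where A: "((\<lambda>z. F (z, w0)) has_field_derivative A) (at z0)"
    by (auto simp: field_differentiable_def)
  have "((\<lambda>(z, w). F (z, w)) has_derivative (\<lambda>(s, t). A * s + blinfun_apply (blinfun_mult_right (Fw z0 w0)) t)) (at (z0, w0) within X \<times> Y)"
  proof (rule has_derivative_partialsI)
    show "((\<lambda>z. F (z, w0)) has_derivative (*) A) (at z0 within X)"
      using A by (simp add: has_field_derivative_def has_derivative_at_withinI)
    show "((\<lambda>w. F (z, w)) has_derivative blinfun_apply (blinfun_mult_right (Fw z w))) (at w within Y)"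
      if "z \<in> X" "w \<in> Y" for z w
      using dw[OF that] by (simp add: has_field_derivative_def has_derivative_at_withinI)
    have "continuous_on (X \<times> Y) (\<lambda>x. blinfun_mult_right (Fw (fst x) (snd x)))"
      by (intro bounded_linear.continuous_on[OF bounded_linear_blinfun_mult_right] cFw)
    then show "continuous (at (z0, w0) within X \<times> Y) (\<lambda>(z, w). blinfun_mult_right (Fw z w))"
      using x0 by (simp add: continuous_on_eq_continuous_within case_prod_unfold)
  qed (use x0 in \<open>auto simp: Y_def\<close>)
  then have "(F has_derivative (\<lambda>(s, t). A * s + Fw z0 w0 * t)) (at (z0, w0))"
    using at_within_open[OF x0 oXY] by simp
  then show ?thesis by blast
qed

definition annihilates_lines :: "(complex \<times> complex \<Rightarrow> complex) \<Rightarrow> real \<Rightarrow> bool" where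
  "annihilates_lines f a \<longleftrightarrow> (\<forall>l\<in>{0<..<1}. \<forall>c h. (norm c)\<^sup>2 * (1 - l) = l \<longrightarrow>
     continuous_on (cball 0 1) h \<longrightarrow> h holomorphic_on ball 0 1 \<longrightarrow>
     integral {0..1} (\<lambda>t. f (circle_point a l t, c * (circle_point a l t - of_real a)) * h (circle_point a l t) * rot t) = 0)"

section \<open>Fourier components along the circles over \<open>z\<close>\<close>

definition height :: "complex \<Rightarrow> real" where
  "height z = sqrt (1 - (norm z)\<^sup>2)"

lemma continuous_on_height [continuous_intros]:
  "continuous_on S f \<Longrightarrow> continuous_on S (\<lambda>x. height (f x))"
  unfolding height_def by (intro continuous_intros)

lemma mem_sphere_pair:
  fixes z w :: complex
  shows "(z, w) \<in> sphere 0 1 \<longleftrightarrow> (norm z)\<^sup>2 + (norm w)\<^sup>2 = 1"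
  by (simp add: norm_Pair)

lemma mem_cball_pair:
  fixes z w :: complex
  shows "(z, w) \<in> cball 0 1 \<longleftrightarrow> (norm z)\<^sup>2 + (norm w)\<^sup>2 \<le> 1"
  by (simp add: norm_Pair)

lemma mem_ball_pair:
  fixes z w :: complex
  shows "(z, w) \<in> ball 0 1 \<longleftrightarrow> (norm z)\<^sup>2 + (norm w)\<^sup>2 < 1"
  by (simp add: norm_Pair)

lemma norm_eq_height:
  fixes z w :: complex
  shows "(z, w) \<in> sphere 0 1 \<Longrightarrow> norm z \<le> 1 \<and> norm w = height z"
proof -
  assume *: "(z, w) \<in> sphere 0 1"
  then have "(norm z)\<^sup>2 + (norm w)\<^sup>2 = 1" by (simp only: mem_sphere_pair)
  moreover from this have "(norm z)\<^sup>2 \<le> 1\<^sup>2" using zero_le_power2[of "norm w"] unfolding power_one by linarith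
  then have "norm z \<le> 1" by (rule power2_le_imp_le) simp
  ultimately show ?thesis by (simp add: height_def real_sqrt_unique[symmetric] algebra_simps)
qed

lemma height_mem_sphere:
  fixes z u :: complex
  shows "norm z \<le> 1 \<Longrightarrow> norm u = 1 \<Longrightarrow> (z, of_real (height z) * u) \<in> sphere 0 1"
  unfolding mem_sphere_pair by (simp add: norm_mult height_def power_le_one)

text \<open>As a function of \<open>(z, w)\<close> this is the component of \<open>f\<close> of
  order \<open>- m\<close> under rotations of \<open>w\<close>: replacing \<open>w\<close> by
  \<open>w * rot s\<close> multiplies it by \<open>rot (- m * s)\<close>. A function
  \<open>w ^ n * G z\<close> is its own component for \<open>m = - n\<close>.\<close>

definition fiber_coeff :: "(complex \<times> complex \<Rightarrow> complex) \<Rightarrow> int \<Rightarrow> complex \<Rightarrow> complex \<Rightarrow> complex" where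
  "fiber_coeff f m z w = integral {0..1} (\<lambda>t. f (z, w * rot t) * rot (of_int m * t))"

lemma fiber_coeff_rot:
  assumes f: "continuous_on (sphere 0 1) f" and zw: "(z, w) \<in> sphere 0 1"
  shows "\<exists>s\<in>{0..1}. w = of_real (height z) * rot s \<and>
    (\<forall>m. fiber_coeff f m z w = rot (- (of_int m * s)) * fiber_coeff f m z (of_real (height z)))"
proof -
  have z: "norm z \<le> 1" and wh: "norm w = height z" using norm_eq_height[OF zw] by auto
  obtain s where s: "s \<in> {0..1}" "w = of_real (height z) * rot s"
  proof (cases "w = 0")
    case True
    then show ?thesis using that[of 0] wh by simp
  next
    case False
    moreover have "height z \<ge> 0" using wh norm_ge_zero[of w] by linarith
    ultimately have "norm (w / of_real (height z)) = 1" using wh by (auto simp: norm_divide)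
    then obtain s where s: "s \<in> {0..1}" "w / of_real (height z) = rot s" by (rule rot_surj)
    have "height z \<noteq> 0" using False wh by auto
    then have "w = of_real (height z) * rot s" unfolding s(2)[symmetric] by simp
    then show ?thesis using that s(1) by blast
  qed
  have "fiber_coeff f m z w = rot (- (of_int m * s)) * fiber_coeff f m z (of_real (height z))" for m
  proof -
    define F where "F t = f (z, of_real (height z) * rot t) * rot (of_int m * t)" for t
    have "continuous_on UNIV F" unfolding F_def
      by (intro continuous_intros continuous_on_compose2[OF f]) (use z in \<open>auto simp del: mem_sphere_0 intro!: height_mem_sphere\<close>)
    moreover have "F (t + 1) = F t" for t
      by (simp add: F_def rot_add distrib_left)
    ultimately have sh: "integral {0..1} (\<lambda>t. F (s + t)) = integral {0..1} F"
      using s by (intro integral_periodic_shift) auto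
    have "f (z, w * rot t) * rot (of_int m * t) = rot (- (of_int m * s)) * F (s + t)" for t
    proof -
      have "rot (- (of_int m * s)) * rot (of_int m * (s + t)) = rot (of_int m * t)"
        unfolding rot_add[symmetric] by (simp add: algebra_simps)
      then show ?thesis by (simp add: F_def s(2) rot_add mult_ac)
    qed
    then have "fiber_coeff f m z w = rot (- (of_int m * s)) * integral {0..1} F"
      by (simp only: fiber_coeff_def sh integral_mult_right)
    then show ?thesis by (simp only: fiber_coeff_def F_def [abs_def])
  qed
  then show ?thesis using s by blast
qed

lemma fiber_coeff_power:
  assumes f: "continuous_on (sphere 0 1) f" and zw: "(z, w) \<in> sphere 0 1"
    and G: "\<And>z. z \<in> cball 0 1 \<Longrightarrow> fiber_coeff f (- int n) z (of_real (height z)) = of_real (height z) ^ n * G z"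
  shows "fiber_coeff f (- int n) z w = w ^ n * G z"
proof -
  obtain s where s: "w = of_real (height z) * rot s"
    "\<And>m. fiber_coeff f m z w = rot (- (of_int m * s)) * fiber_coeff f m z (of_real (height z))"
    using fiber_coeff_rot[OF f zw] by blast
  have "rot (- (of_int (- int n) * s)) = rot s ^ n" unfolding rot_power by simp
  moreover have "z \<in> cball 0 1" using norm_eq_height[OF zw] by simp
  ultimately show ?thesis using s(2)[of "- int n"] G[of z] s(1) by (simp add: power_mult_distrib)
qed

lemma circle_point_on_line:
  assumes "\<bar>a\<bar> \<le> 1" "0 < l" "l < 1" "(norm c)\<^sup>2 * (1 - l) = l"
  shows "(circle_point a l t, c * (circle_point a l t - of_real a)) \<in> sphere 0 1"
proof -
  define x where "x = Re (rot t)"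
  define y where "y = Im (rot t)"
  have xy: "x\<^sup>2 + y\<^sup>2 = 1" using norm_rot[of t] unfolding cmod_def x_def y_def by simp
  define r where "r = circle_radius a l"
  have r2: "r\<^sup>2 = (1 - l) * (1 - l * a\<^sup>2)" using circle_radius_facts(3)[of a l] assms by (simp add: r_def)
  have n1: "(norm (circle_point a l t))\<^sup>2 = (l * a + r * x)\<^sup>2 + (r * y)\<^sup>2"
    unfolding cmod_power2 by (simp add: circle_point_def r_def x_def y_def)
  have n2: "(norm (circle_point a l t - of_real a))\<^sup>2 = (l * a + r * x - a)\<^sup>2 + (r * y)\<^sup>2"
    unfolding cmod_power2 by (simp add: circle_point_def r_def x_def y_def)
  have c2: "(norm c)\<^sup>2 = l / (1 - l)" using assms by (simp add: field_simps)
  have "(1 - l) * ((l * a + r * x)\<^sup>2 + (r * y)\<^sup>2) + l * ((l * a + r * x - a)\<^sup>2 + (r * y)\<^sup>2)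
     = r\<^sup>2 * (x\<^sup>2 + y\<^sup>2) + l * (1 - l) * a\<^sup>2"
    by (simp add: power2_eq_square algebra_simps)
  also have "\<dots> = 1 - l" unfolding xy r2 by (simp add: power2_eq_square algebra_simps)
  finally have "(l * a + r * x)\<^sup>2 + (r * y)\<^sup>2 + l / (1 - l) * ((l * a + r * x - a)\<^sup>2 + (r * y)\<^sup>2) = 1"
    using assms by (simp add: field_simps)
  then show ?thesis
    unfolding mem_sphere_pair norm_mult power_mult_distrib n1 n2 c2 .
qed

text \<open>Rotating \<open>w\<close> changes only the phase of the slope, so the line condition
  survives averaging over rotations. By Fubini the average replaces \<open>f\<close> by its
  component \<open>w ^ n * G z\<close>, and on the line \<open>w\<close> is a multiple of
  \<open>z - a\<close>. The factor \<open>q\<close> leaves room for the corresponding power at the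
  other centre.\<close>

lemma fiber_annihilates_circles:
  assumes f: "continuous_on (sphere 0 1) f" and a: "\<bar>a\<bar> \<le> 1" and ann: "annihilates_lines f a"
    and cG: "continuous_on (cball 0 1) G"
    and G: "\<And>z. z \<in> cball 0 1 \<Longrightarrow> fiber_coeff f (- int n) z (of_real (height z)) = of_real (height z) ^ n * G z"
    and cq: "continuous_on (cball 0 1) q" and hq: "q holomorphic_on ball 0 1"
  shows "annihilates_circles (\<lambda>z. (z - of_real a) ^ n * q z * G z) a"
  unfolding annihilates_circles_def
proof (intro ballI allI impI)
  fix l :: real and h :: "complex \<Rightarrow> complex"
  assume l: "l \<in> {0<..<1}" and ch: "continuous_on (cball 0 1) h" and hh: "h holomorphic_on ball 0 1"
  define c0 where "c0 = sqrt (l / (1 - l))"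
  have c0: "c0 > 0" "c0\<^sup>2 * (1 - l) = l" using l by (auto simp: c0_def)
  define w where "w t = of_real c0 * (circle_point a l t - of_real a)" for t
  have sph: "(circle_point a l t, w t * rot s) \<in> sphere 0 1" for s t
    using circle_point_on_line[of a l "of_real c0 * rot s" t] l c0 a by (simp add: w_def norm_mult mult_ac)
  define k where "k t = q (circle_point a l t) * h (circle_point a l t) * rot t" for t
  have l01: "0 \<le> l" "l \<le> 1" using l by auto
  have ck: "continuous_on A k" for A
    unfolding k_def by (intro continuous_intros continuous_on_compose_circle_point[OF cq] continuous_on_compose_circle_point[OF ch] a) (use l01 in auto)
  define \<Psi> where "\<Psi> s t = f (circle_point a l t, w t * rot s) * k t * rot (- (real n * s))" for s t
  have zero: "integral {0..1} (\<Psi> s) = 0" for s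
  proof -
    have cond: "(norm (of_real c0 * rot s))\<^sup>2 * (1 - l) = l" using c0 by (simp add: norm_mult)
    have "continuous_on (cball 0 1) (\<lambda>z. q z * h z)" "(\<lambda>z. q z * h z) holomorphic_on ball 0 1"
      by (intro continuous_intros holomorphic_intros cq ch hq hh)+
    with ann l cond have "integral {0..1} (\<lambda>t. f (circle_point a l t, of_real c0 * rot s * (circle_point a l t - of_real a)) * (q (circle_point a l t) * h (circle_point a l t)) * rot t) = 0"
      unfolding annihilates_lines_def by blast
    then have "integral {0..1} (\<lambda>t. f (circle_point a l t, w t * rot s) * k t) = 0"
      by (simp add: w_def k_def mult_ac)
    then have "integral {0..1} (\<lambda>t. f (circle_point a l t, w t * rot s) * k t * rot (- (real n * s))) = 0"
      by (simp only: integral_mult_left mult_zero_left)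
    then show ?thesis by (simp only: \<Psi>_def [abs_def])
  qed
  have cf: "continuous_on ({0..1} \<times> {0..1}) (\<lambda>x. f (circle_point a l (snd x), w (snd x) * rot (fst x)))"
    by (rule continuous_on_compose2[OF f]) (use sph in \<open>auto simp: w_def simp del: mem_sphere_0 intro!: continuous_intros\<close>)
  have "continuous_on ({0..1} \<times> {0..1}) (\<lambda>x. \<Psi> (fst x) (snd x))"
    unfolding \<Psi>_def by (intro continuous_intros cf continuous_on_compose2[OF ck[of UNIV]]) auto
  then have c\<Psi>: "continuous_on (cbox (0, 0) (1, 1)) (\<lambda>(s, t). \<Psi> s t)"
    by (simp add: case_prod_unfold cbox_Pair_eq)
  have "integral {0..1} (\<lambda>t. integral {0..1} (\<lambda>s. \<Psi> s t)) = integral {0..1} (\<lambda>s. integral {0..1} (\<Psi> s))"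
    using integral_swap_continuous[OF c\<Psi>] by simp
  also have "\<dots> = 0" by (simp add: zero)
  finally have "integral {0..1} (\<lambda>t. integral {0..1} (\<lambda>s. \<Psi> s t)) = 0" .
  moreover have "integral {0..1} (\<lambda>s. \<Psi> s t) = of_real c0 ^ n * ((circle_point a l t - of_real a) ^ n * q (circle_point a l t) * G (circle_point a l t) * h (circle_point a l t) * rot t)" for t
  proof -
    have "integral {0..1} (\<lambda>s. \<Psi> s t) = integral {0..1} (\<lambda>s. k t * (f (circle_point a l t, w t * rot s) * rot (of_int (- int n) * s)))"
      by (intro integral_cong) (simp add: \<Psi>_def mult_ac)
    also have "\<dots> = k t * fiber_coeff f (- int n) (circle_point a l t) (w t)"
      by (simp only: integral_mult_right fiber_coeff_def)
    also have "fiber_coeff f (- int n) (circle_point a l t) (w t) = w t ^ n * G (circle_point a l t)"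
      using sph[of t 0] by (intro fiber_coeff_power[OF f _ G]) auto
    finally show ?thesis by (simp add: w_def k_def power_mult_distrib mult_ac)
  qed
  ultimately have "of_real c0 ^ n * integral {0..1} (\<lambda>t. (circle_point a l t - of_real a) ^ n * q (circle_point a l t) * G (circle_point a l t) * h (circle_point a l t) * rot t) = 0"
    by simp
  then show "integral {0..1} (\<lambda>t. (circle_point a l t - of_real a) ^ n * q (circle_point a l t) * G (circle_point a l t) * h (circle_point a l t) * rot t) = 0"
    using c0 by simp
qed

lemma fiber_holomorphic:
  assumes f: "continuous_on (sphere 0 1) f" and ab: "-1 \<le> a" "a < 0" "0 < b" "b \<le> 1"
    and ann: "annihilates_lines f a" "annihilates_lines f b"
    and cG: "continuous_on (cball 0 1) G"
    and G: "\<And>z. z \<in> cball 0 1 \<Longrightarrow> fiber_coeff f (- int n) z (of_real (height z)) = of_real (height z) ^ n * G z"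
  shows "G holomorphic_on ball 0 1"
proof -
  \<comment> \<open>Each pencil needs the power at its own centre and tolerates the other as the
    holomorphic factor \<open>q\<close>, so one function fits both. The divisions afterwards leave
    singularities that the continuity of \<open>G\<close> removes.\<close>
  define g where "g z = (z - of_real a) ^ n * (z - of_real b) ^ n * G z" for z
  have cg: "continuous_on (cball 0 1) g" unfolding g_def by (intro continuous_intros cG)
  have pw: "continuous_on (cball 0 1) (\<lambda>z. (z - complex_of_real s) ^ n)"
     "(\<lambda>z. (z - complex_of_real s) ^ n) holomorphic_on ball 0 1" for s
    by (intro continuous_intros holomorphic_intros)+
  have "annihilates_circles g a" unfolding g_def
    by (rule fiber_annihilates_circles[OF f _ ann(1) cG G pw]) (use ab in auto)
  moreover have "annihilates_circles (\<lambda>z. (z - of_real b) ^ n * (z - of_real a) ^ n * G z) b"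
    by (rule fiber_annihilates_circles[OF f _ ann(2) cG G pw]) (use ab in auto)
  then have "annihilates_circles g b" by (simp add: g_def [abs_def] mult_ac)
  ultimately have g: "g holomorphic_on ball 0 1"
    by (rule holomorphic_of_two_circle_families[OF cg ab])
  have "(\<lambda>z. g z / ((z - of_real a) ^ n * (z - of_real b) ^ n)) holomorphic_on (ball 0 1 - {of_real a, of_real b})"
    by (intro holomorphic_intros holomorphic_on_subset[OF g]) auto
  then have "G holomorphic_on (ball 0 1 - {of_real a, of_real b})"
    by (rule holomorphic_transform) (auto simp: g_def)
  then show ?thesis
    by (rule no_isolated_singularity[rotated]) (auto intro: continuous_on_subset[OF cG])
qed

lemma continuous_on_fiber_coeff:
  assumes f: "continuous_on (sphere 0 1) f"
  shows "continuous_on (cball 0 1) (\<lambda>z. fiber_coeff f m z (of_real (height z)))"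
proof -
  have "continuous_on (cball 0 1 \<times> {0..1}) (\<lambda>x. f (fst x, of_real (height (fst x)) * rot (snd x)))"
    by (rule continuous_on_compose2[OF f]) (auto simp del: mem_sphere_0 intro!: continuous_intros height_mem_sphere)
  then have "continuous_on (cball 0 1 \<times> {0..1}) (\<lambda>x. f (fst x, of_real (height (fst x)) * rot (snd x)) * rot (of_int m * snd x))"
    by (intro continuous_intros)
  from continuous_on_integral_01[OF this] show ?thesis by (simp add: fiber_coeff_def)
qed

lemma integral_rot_int: "m \<noteq> 0 \<Longrightarrow> integral {0..1} (\<lambda>t. rot (of_int m * t)) = 0"
proof -
  assume m: "m \<noteq> 0"
  have "((\<lambda>t. of_real (2 * pi * of_int m) * \<i> * rot (of_int m * t)) has_integral (rot (of_int m * 1) - rot (of_int m * 0))) {0..1}"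
    by (rule fundamental_theorem_of_calculus) (auto intro: rot_has_vector_derivative simp del: of_real_mult)
  then have "of_real (2 * pi * of_int m) * \<i> * integral {0..1} (\<lambda>t. rot (of_int m * t)) = 0"
    by (simp only: integral_mult_right[symmetric] integral_unique) simp
  then show ?thesis using m by simp
qed

lemma fiber_coeff_positive_vanishes:
  assumes f: "continuous_on (sphere 0 1) f" and ab: "-1 \<le> a" "a < 0" "0 < b" "b \<le> 1"
    and ann: "annihilates_lines f a" "annihilates_lines f b"
    and m: "m > 0" and zw: "(z, w) \<in> sphere 0 1"
  shows "fiber_coeff f (int m) z w = 0"
proof -
  \<comment> \<open>On a line \<open>w = c * (z - s)\<close> the factor \<open>w ^ m\<close> is a
    polynomial in \<open>z\<close>, which the test function absorbs.\<close>
  define f' where "f' x = f x * snd x ^ m" for x :: "complex \<times> complex"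
  have f': "continuous_on (sphere 0 1) f'" unfolding f'_def by (intro continuous_intros f)
  have ann': "annihilates_lines f' s" if "annihilates_lines f s" for s
    unfolding annihilates_lines_def
  proof (intro ballI allI impI)
    fix l :: real and c :: complex and h :: "complex \<Rightarrow> complex"
    assume *: "l \<in> {0<..<1}" "(norm c)\<^sup>2 * (1 - l) = l" "continuous_on (cball 0 1) h" "h holomorphic_on ball 0 1"
    have "continuous_on (cball 0 1) (\<lambda>z. (c * (z - of_real s)) ^ m * h z)"
      "(\<lambda>z. (c * (z - of_real s)) ^ m * h z) holomorphic_on ball 0 1"
      by (intro continuous_intros holomorphic_intros *)+
    with that *(1,2) have "integral {0..1} (\<lambda>t. f (circle_point s l t, c * (circle_point s l t - of_real s)) * ((c * (circle_point s l t - of_real s)) ^ m * h (circle_point s l t)) * rot t) = 0"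
      unfolding annihilates_lines_def by blast
    then show "integral {0..1} (\<lambda>t. f' (circle_point s l t, c * (circle_point s l t - of_real s)) * h (circle_point s l t) * rot t) = 0"
      by (simp add: f'_def mult.assoc)
  qed
  define G where "G z = fiber_coeff f' 0 z (of_real (height z))" for z
  have cG: "continuous_on (cball 0 1) G" unfolding G_def by (rule continuous_on_fiber_coeff[OF f'])
  have hG: "G holomorphic_on ball 0 1"
    by (rule fiber_holomorphic[OF f' ab ann'[OF ann(1)] ann'[OF ann(2)] cG, of 0]) (simp add: G_def)
  have rel: "G z = of_real (height z) ^ m * fiber_coeff f (int m) z (of_real (height z))" for z
  proof -
    have "G z = integral {0..1} (\<lambda>t. of_real (height z) ^ m * (f (z, of_real (height z) * rot t) * rot (of_int (int m) * t)))"
      unfolding G_def fiber_coeff_def f'_def by (intro integral_cong) (simp add: power_mult_distrib rot_power mult_ac)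
    then show ?thesis by (simp only: integral_mult_right fiber_coeff_def)
  qed
  have G0: "G z = 0" if "z \<in> ball 0 1" for z
  proof -
    have "norm (G z) \<le> 0"
      by (rule maximum_modulus_frontier[of G "ball 0 1"])
         (use hG cG that m rel in \<open>auto simp: height_def\<close>)
    then show ?thesis by simp
  qed
  have z1: "norm z \<le> 1" using norm_eq_height[OF zw] by simp
  have "fiber_coeff f (int m) z (of_real (height z)) = 0"
  \<comment> \<open>Over the unit circle the fibre is the single point \<open>w = 0\<close>;
    \<open>f\<close> is constant on it and its nonzero frequencies vanish. Elsewhere the power of
    the height can be divided out.\<close>
  proof (cases "norm z = 1")
    case True
    then have "height z = 0" by (simp add: height_def)
    then show ?thesis using integral_rot_int[of "int m"] m by (simp add: fiber_coeff_def)
  next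
    case False
    with z1 have "norm z < 1" by linarith
    then have "(norm z)\<^sup>2 < 1" by (simp add: abs_square_less_1)
    then have "height z \<noteq> 0" by (simp add: height_def)
    then show ?thesis using G0[of z] rel[of z] False z1 by simp
  qed
  then show ?thesis using fiber_coeff_rot[OF f zw] by force
qed

section \<open>The maximum principle and the extension to the ball\<close>

definition separately_holomorphic :: "(complex \<times> complex \<Rightarrow> complex) \<Rightarrow> bool" where
  "separately_holomorphic P \<longleftrightarrow> continuous_on (cball 0 1) P \<and>
     (\<forall>w. (\<lambda>z. P (z, w)) holomorphic_on {z. (z, w) \<in> ball 0 1}) \<and>
     (\<forall>z. (\<lambda>w. P (z, w)) holomorphic_on {w. (z, w) \<in> ball 0 1})"

lemma separately_holomorphic_diff:
  "separately_holomorphic P \<Longrightarrow> separately_holomorphic Q \<Longrightarrow> separately_holomorphic (\<lambda>x. P x - Q x)"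
  unfolding separately_holomorphic_def by (intro conjI allI continuous_intros holomorphic_intros) auto

lemma separately_holomorphic_max:
  assumes P: "separately_holomorphic P" and B: "\<And>x. x \<in> sphere 0 1 \<Longrightarrow> norm (P x) \<le> B"
    and x: "x \<in> cball 0 1"
  shows "norm (P x) \<le> B"
proof -
  obtain z w where zw: "x = (z, w)" by (cases x)
  have le: "(norm z)\<^sup>2 + (norm w)\<^sup>2 \<le> 1" using x by (simp only: zw mem_cball_pair)
  define R where "R = height z"
  have z1: "(norm z)\<^sup>2 \<le> 1" using le zero_le_power2[of "norm w"] by linarith
  have R: "R \<ge> 0" "R\<^sup>2 = 1 - (norm z)\<^sup>2" using z1 by (auto simp: R_def height_def)
  have wR: "norm w \<le> R" by (rule power2_le_imp_le[OF _ R(1)]) (use le R(2) in linarith)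
  have slice: "(z, v) \<in> ball 0 1 \<longleftrightarrow> norm v < R" "(z, v) \<in> cball 0 1 \<longleftrightarrow> norm v \<le> R" "(z, v) \<in> sphere 0 1 \<longleftrightarrow> norm v = R" for v :: complex
  proof -
    have "(norm v)\<^sup>2 < R\<^sup>2 \<longleftrightarrow> norm v < R" "(norm v)\<^sup>2 \<le> R\<^sup>2 \<longleftrightarrow> norm v \<le> R" "(norm v)\<^sup>2 = R\<^sup>2 \<longleftrightarrow> norm v = R"
      using power_mono_iff[OF R(1) norm_ge_zero[of v], of 2] power_mono_iff[OF norm_ge_zero[of v] R(1), of 2]
        power_eq_iff_eq_base[of 2 "norm v" R] R(1) by (simp_all only: linorder_not_le[symmetric] norm_ge_zero)
    then show "(z, v) \<in> ball 0 1 \<longleftrightarrow> norm v < R" "(z, v) \<in> cball 0 1 \<longleftrightarrow> norm v \<le> R" "(z, v) \<in> sphere 0 1 \<longleftrightarrow> norm v = R"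
      unfolding mem_ball_pair mem_cball_pair mem_sphere_pair using R(2) by linarith+
  qed
  show ?thesis
  proof (cases "R = 0")
    case True
    then have "(z, w) \<in> sphere 0 1" unfolding slice using wR by simp
    then show ?thesis using B zw by blast
  next
    case False
    have "norm (P (z, w)) \<le> B"
    proof (rule maximum_modulus_frontier[of "\<lambda>v. P (z, v)" "cball 0 R"])
      have "{v :: complex. (z, v) \<in> ball 0 1} = ball 0 R" using slice(1) by (simp only: set_eq_iff mem_Collect_eq mem_ball_0 simp_thms)
      then show "(\<lambda>v. P (z, v)) holomorphic_on interior (cball 0 R)"
        using P unfolding separately_holomorphic_def interior_cball by metis
      show "continuous_on (closure (cball 0 R)) (\<lambda>v. P (z, v))"
      proof (rule continuous_on_compose2[of "cball 0 1" P _ "\<lambda>v. (z, v)"])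
        show "continuous_on (cball 0 1) P" using P by (simp add: separately_holomorphic_def)
        show "(\<lambda>v. (z, v)) ` closure (cball (0 :: complex) R) \<subseteq> cball 0 1"
        proof
          fix y assume "y \<in> (\<lambda>v. (z, v)) ` closure (cball (0 :: complex) R)"
          then obtain v :: complex where "y = (z, v)" "norm v \<le> R" by auto
          then show "y \<in> cball 0 1" using slice(2)[of v] by simp
        qed
      qed (intro continuous_intros)
      show "norm (P (z, v)) \<le> B" if "v \<in> frontier (cball 0 R)" for v
        using that slice(3)[of v] by (intro B) simp
    qed (use wR in auto)
    then show ?thesis by (simp add: zw)
  qed
qed

text \<open>The assumption \<open>reg\<close> is the only form in which smoothness enters: each
  component of order \<open>n \<ge> 0\<close> is divisible by the \<open>n\<close>-th power of the
  height with a continuous quotient.\<close>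

theorem ball_extension_of_two_families:
  assumes f: "continuous_on (sphere 0 1) f" and ab: "-1 \<le> a" "a < 0" "0 < b" "b \<le> 1"
    and ann: "annihilates_lines f a" "annihilates_lines f b"
    and reg: "\<And>n. \<exists>G. continuous_on (cball 0 1) G \<and>
       (\<forall>z\<in>cball 0 1. fiber_coeff f (- int n) z (of_real (height z)) = of_real (height z) ^ n * G z)"
  shows "\<exists>F. continuous_on (cball 0 1) F \<and> (\<forall>x\<in>sphere 0 1. F x = f x) \<and>
    (\<forall>x\<in>ball 0 1. \<exists>A B. (F has_derivative (\<lambda>(s, t). A * s + B * t)) (at x))"
proof -
  obtain G where cG: "\<And>n. continuous_on (cball 0 1) (G n)"
    and G: "\<And>n z. z \<in> cball 0 1 \<Longrightarrow> fiber_coeff f (- int n) z (of_real (height z)) = of_real (height z) ^ n * G n z"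
    using reg by metis
  have hG: "G n holomorphic_on ball 0 1" for n
    by (rule fiber_holomorphic[OF f ab ann cG G])
  obtain M where M: "M > 0" "\<And>x. x \<in> sphere 0 1 \<Longrightarrow> norm (f x) \<le> M"
    using compact_imp_bounded[OF compact_continuous_image[OF f compact_sphere]] by (auto simp: bounded_pos)
  have approx: "\<exists>P. separately_holomorphic P \<and> (\<forall>x\<in>sphere 0 1. norm (P x - f x) \<le> \<epsilon>)" if \<epsilon>: "\<epsilon> > 0" for \<epsilon>
  proof -
    obtain \<delta> where \<delta>: "\<delta> > 0" "\<And>x y. x \<in> sphere 0 1 \<Longrightarrow> y \<in> sphere 0 1 \<Longrightarrow> dist y x < \<delta> \<Longrightarrow> dist (f y) (f x) < \<epsilon> / 2"
      using compact_uniformly_continuous[OF f compact_sphere] \<epsilon> unfolding uniformly_continuous_on_def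
      by (metis half_gt_zero)
    define \<eta> where "\<eta> = \<epsilon> / 2 / M"
    have \<eta>: "\<eta> > 0" "\<eta> * M = \<epsilon> / 2" using \<epsilon> M by (auto simp: \<eta>_def)
    obtain c N where ker: "\<And>h M \<omega>. continuous_on (sphere 0 1) h \<Longrightarrow> (\<And>u. norm u = 1 \<Longrightarrow> norm (h u) \<le> M) \<Longrightarrow>
      (\<And>u. norm u = 1 \<Longrightarrow> norm (u - 1) < \<delta> \<Longrightarrow> norm (h u - h 1) \<le> \<omega>) \<Longrightarrow>
      norm ((\<Sum>i<N. \<Sum>j<N. c i j * integral {0..1} (\<lambda>t. h (rot t) * rot (of_int (int i - int j) * t))) - h 1)
      \<le> \<omega> + \<eta> * M"
      by (rule trigonometric_kernel[OF \<delta>(1) \<eta>(1)]) blast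
    define q where "q i j x = (if i \<le> j then snd x ^ (j - i) * G (j - i) (fst x) else 0)" for i j :: nat and x :: "complex \<times> complex"
    define P where "P x = (\<Sum>i<N. \<Sum>j<N. c i j * q i j x)" for x
    have fst1: "norm z < 1" if "(z, w) \<in> ball 0 1" for z w :: complex
    proof -
      have "(norm z)\<^sup>2 < 1\<^sup>2" using that zero_le_power2[of "norm w"] unfolding mem_ball_pair power_one by linarith
      then show ?thesis by (rule power2_less_imp_less) simp
    qed
    have "separately_holomorphic P"
      unfolding separately_holomorphic_def
    proof (intro conjI allI)
      have "continuous_on (cball 0 1) (q i j)" for i j
      proof (cases "i \<le> j")
        case True
        have "continuous_on (cball 0 1) (\<lambda>x :: complex \<times> complex. G (j - i) (fst x))"
        proof (rule continuous_on_compose2[OF cG])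
          show "fst ` cball (0 :: complex \<times> complex) 1 \<subseteq> cball 0 1"
          proof
            fix y assume "y \<in> fst ` cball (0 :: complex \<times> complex) 1"
            then obtain w :: complex where "norm (y, w) \<le> 1" by auto
            then show "y \<in> cball 0 1" using norm_fst_le[of y w] by simp
          qed
        qed (intro continuous_intros)
        then show ?thesis using True by (simp add: q_def [abs_def]) (intro continuous_intros)
      qed (simp add: q_def [abs_def])
      then show "continuous_on (cball 0 1) P" unfolding P_def by (intro continuous_intros)
      show "(\<lambda>z. P (z, w)) holomorphic_on {z. (z, w) \<in> ball 0 1}" for w
      proof -
        have "(\<lambda>z. q i j (z, w)) holomorphic_on {z. (z, w) \<in> ball 0 1}" for i j
        proof (cases "i \<le> j")
          case True
          have "G (j - i) holomorphic_on {z. (z, w) \<in> ball 0 1}"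
            by (rule holomorphic_on_subset[OF hG]) (use fst1 in auto)
          then show ?thesis using True by (simp add: q_def) (intro holomorphic_intros)
        qed (simp add: q_def)
        then show ?thesis unfolding P_def by (intro holomorphic_intros)
      qed
      show "(\<lambda>w. P (z, w)) holomorphic_on {w. (z, w) \<in> ball 0 1}" for z
      proof -
        have "(\<lambda>w. q i j (z, w)) holomorphic_on {w. (z, w) \<in> ball 0 1}" for i j
          by (cases "i \<le> j") (auto simp: q_def intro!: holomorphic_intros)
        then show ?thesis unfolding P_def by (intro holomorphic_intros)
      qed
    qed
    moreover have "norm (P x - f x) \<le> \<epsilon>" if x: "x \<in> sphere 0 1" for x
    proof -
      obtain z w where zw: "x = (z, w)" by (cases x)
      have sph: "(z, w) \<in> sphere 0 1" using x zw by simp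
      have in1: "(z, w * u) \<in> sphere 0 1" if "norm u = 1" for u
        using sph that unfolding mem_sphere_pair by (simp add: norm_mult)
      have co: "integral {0..1} (\<lambda>t. f (z, w * rot t) * rot (of_int (int i - int j) * t)) = q i j x" for i j
      proof (cases "i \<le> j")
        case True
        then have m: "int i - int j = - int (j - i)" by simp
        have "fiber_coeff f (- int (j - i)) z w = w ^ (j - i) * G (j - i) z"
          by (rule fiber_coeff_power[OF f sph G])
        then show ?thesis
          unfolding m using True by (simp only: fiber_coeff_def q_def zw fst_conv snd_conv if_True)
      next
        case False
        then have m: "int i - int j = int (i - j)" by simp
        have "fiber_coeff f (int (i - j)) z w = 0"
          by (rule fiber_coeff_positive_vanishes[OF f ab ann _ sph]) (use False in simp)
        then show ?thesis
          unfolding m using False by (simp only: fiber_coeff_def q_def if_False)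
      qed
      have "norm ((\<Sum>i<N. \<Sum>j<N. c i j * integral {0..1} (\<lambda>t. f (z, w * rot t) * rot (of_int (int i - int j) * t))) - f (z, w * 1)) \<le> \<epsilon> / 2 + \<eta> * M"
      proof (rule ker)
        show "continuous_on (sphere 0 1) (\<lambda>u. f (z, w * u))"
          by (intro continuous_on_compose2[OF f] continuous_intros) (use in1 in auto)
        show "norm (f (z, w * u)) \<le> M" if "norm u = 1" for u using M(2) in1 that by blast
        show "norm (f (z, w * u) - f (z, w * 1)) \<le> \<epsilon> / 2" if u: "norm u = 1" "norm (u - 1) < \<delta>" for u
        proof -
          have "dist (z, w * u) (z, w) = norm (w * (u - 1))"
            by (simp add: dist_norm norm_Pair right_diff_distrib)
          also have "\<dots> \<le> 1 * norm (u - 1)"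
          proof -
            have "norm w \<le> 1" using norm_snd_le[of w z] sph by simp
            then show ?thesis unfolding norm_mult by (intro mult_right_mono) auto
          qed
          finally have "dist (z, w * u) (z, w) < \<delta>" using u by simp
          then have "dist (f (z, w * u)) (f (z, w)) < \<epsilon> / 2" using \<delta>(2)[OF sph in1[OF u(1)]] by simp
          then show ?thesis by (simp add: dist_norm)
        qed
      qed
      then show ?thesis unfolding co using \<eta>(2) by (simp add: P_def zw)
    qed
    ultimately show ?thesis by blast
  qed
  have "\<exists>P. separately_holomorphic P \<and> (\<forall>x\<in>sphere 0 1. norm (P x - f x) \<le> inverse (real (Suc n)))" for n
    by (rule approx) simp
  then obtain P where P: "\<And>n. separately_holomorphic (P n)"
      "\<And>n x. x \<in> sphere 0 1 \<Longrightarrow> norm (P n x - f x) \<le> inverse (real (Suc n))"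
    by metis
  \<comment> \<open>Inside the ball no limit is known beforehand. The differences
    \<open>P m - P n\<close> are small on the sphere, and the maximum principle carries this
    inwards.\<close>
  have "uniformly_Cauchy_on (cball 0 1) P"
  proof (rule uniformly_Cauchy_onI)
    fix e :: real assume "e > 0"
    then obtain N where N: "inverse (real (Suc N)) < e / 2"
      using reals_Archimedean[of "e / 2"] by auto
    have "dist (P m x) (P n x) < e" if mn: "m \<ge> N" "n \<ge> N" and x: "x \<in> cball 0 1" for m n x
    proof -
      have small: "inverse (real (Suc k)) \<le> inverse (real (Suc N))" if "k \<ge> N" for k using that by simp
      have "norm (P m x - P n x) \<le> 2 * inverse (real (Suc N))"
      proof (rule separately_holomorphic_max[OF separately_holomorphic_diff[OF P(1) P(1)] _ x])
        fix y :: "complex \<times> complex" assume y: "y \<in> sphere 0 1"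
        have "norm (P m y - P n y) = norm ((P m y - f y) - (P n y - f y))" by simp
        also have "\<dots> \<le> norm (P m y - f y) + norm (P n y - f y)" by (rule norm_triangle_ineq4)
        finally show "norm (P m y - P n y) \<le> 2 * inverse (real (Suc N))"
          using P(2)[OF y, of m] P(2)[OF y, of n] small[OF mn(1)] small[OF mn(2)] by linarith
      qed
      then show ?thesis using N unfolding dist_norm by linarith
    qed
    then show "\<exists>N. \<forall>x\<in>cball 0 1. \<forall>m\<ge>N. \<forall>n\<ge>N. dist (P m x) (P n x) < e" by blast
  qed
  then have "uniformly_convergent_on (cball 0 1) P" by (rule Cauchy_uniformly_convergent)
  then obtain F where ul: "uniform_limit (cball 0 1) P F sequentially"
    by (auto simp: uniformly_convergent_on_def)
  have cF: "continuous_on (cball 0 1) F"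
    by (rule uniform_limit_theorem[OF _ ul]) (use P(1) in \<open>auto simp: separately_holomorphic_def\<close>)
  have Ff: "F x = f x" if x: "x \<in> sphere 0 1" for x
  proof -
    have "(\<lambda>n. P n x) \<longlonglongrightarrow> F x" using tendsto_uniform_limitI[OF ul, of x] x by auto
    moreover have "(\<lambda>n. P n x - f x) \<longlonglongrightarrow> 0"
      by (rule Lim_null_comparison[OF always_eventually LIMSEQ_inverse_real_of_nat]) (use P(2)[OF x] in blast)
    then have "(\<lambda>n. P n x) \<longlonglongrightarrow> f x" by (rule LIM_zero_cancel)
    ultimately show ?thesis by (rule LIMSEQ_unique)
  qed
  have op: "open {z. (z, w) \<in> ball 0 1}" "open {w. (z, w) \<in> ball 0 1}" for z w :: complex
    by (rule open_slices[OF open_ball])+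
  have slice: "(\<lambda>v. F (k v)) holomorphic_on S" if S: "open S" "\<And>v. v \<in> S \<Longrightarrow> k v \<in> ball 0 1"
      "\<And>n. (\<lambda>v. P n (k v)) holomorphic_on S" for k :: "complex \<Rightarrow> complex \<times> complex" and S
  proof (rule holomorphic_uniform_sequence[OF S(1) S(3)])
    fix v assume "v \<in> S"
    then obtain d where d: "d > 0" "cball v d \<subseteq> S" using S(1) open_contains_cball by blast
    have "uniform_limit (cball v d) (\<lambda>n v. P n (k v)) (\<lambda>v. F (k v)) sequentially"
      by (rule uniform_limit_compose'[OF ul]) (use S(2) d in \<open>auto simp: less_imp_le\<close>)
    then show "\<exists>d>0. cball v d \<subseteq> S \<and> uniform_limit (cball v d) (\<lambda>n v. P n (k v)) (\<lambda>v. F (k v)) sequentially"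
      using d by blast
  qed
  have "\<exists>A B. (F has_derivative (\<lambda>(s, t). A * s + B * t)) (at x)" if x: "x \<in> ball 0 1" for x
  proof -
    obtain z w where zw: "x = (z, w)" by (cases x)
    have "\<exists>A B. (F has_derivative (\<lambda>(s, t). A * s + B * t)) (at (z, w))"
    proof (rule Osgood[OF open_ball])
      show "continuous_on (ball 0 1) F" using cF continuous_on_subset ball_subset_cball by blast
      show "(\<lambda>z. F (z, w)) holomorphic_on {z. (z, w) \<in> ball 0 1}" for w
        by (rule slice[OF op(1)]) (use P(1) in \<open>auto simp: separately_holomorphic_def simp del: mem_ball_0\<close>)
      show "(\<lambda>w. F (z, w)) holomorphic_on {w. (z, w) \<in> ball 0 1}" for z
        by (rule slice[OF op(2)]) (use P(1) in \<open>auto simp: separately_holomorphic_def simp del: mem_ball_0\<close>)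
      show "(z, w) \<in> ball 0 1" using x zw by simp
    qed
    then show ?thesis by (simp add: zw)
  qed
  then show ?thesis using cF Ff by blast
qed

section \<open>Smooth functions and projective maps\<close>

lemma Ck_on_Suc_imp: "Ck_on (Suc k) F U \<Longrightarrow> Ck_on k F U"
proof (induction k arbitrary: F)
  case 0
  then show ?case
    by (auto intro!: continuous_at_imp_continuous_on differentiable_imp_continuous_within)
next
  case (Suc k)
  have "\<forall>v. Ck_on (Suc k) (\<lambda>x. frechet_derivative F (at x) v) U"
    using Suc.prems by (subst (asm) Ck_on.simps(2)) blast
  then have "\<forall>v. Ck_on k (\<lambda>x. frechet_derivative F (at x) v) U"
    using Suc.IH by blast
  moreover have "\<forall>x\<in>U. F differentiable (at x)" using Suc.prems by simp
  ultimately show ?case by simp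
qed

lemma Ck_on_imp_continuous: "Ck_on k F U \<Longrightarrow> continuous_on U F"
  by (induction k) (simp, metis Ck_on_Suc_imp)

text \<open>\<open>u z t\<close> stands for a function on the circle over \<open>z\<close> at angle
  \<open>t\<close>. Division by powers of the height is delicate where the circle shrinks to a
  point. In the end only \<open>n = k\<close> is used, but the induction on \<open>k\<close> shifts
  \<open>n\<close>, hence the condition for all \<open>n \<ge> k\<close>.\<close>

definition fiber_class :: "nat \<Rightarrow> (complex \<Rightarrow> real \<Rightarrow> complex) \<Rightarrow> bool" where
  "fiber_class k u \<longleftrightarrow> continuous_on (cball 0 1 \<times> {0..1}) (\<lambda>x. u (fst x) (snd x)) \<and>
     (\<forall>n. int k \<le> n \<longrightarrow> (\<exists>G. continuous_on (cball 0 1) G \<and>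
        (\<forall>z\<in>cball 0 1. integral {0..1} (\<lambda>t. u z t * rot (of_int (- n) * t)) = of_real (height z) ^ k * G z)))"

lemma fiber_class_slice:
  assumes "continuous_on (cball 0 1 \<times> {0..1}) (\<lambda>x. u (fst x) (snd x))" "z \<in> cball 0 1"
  shows "continuous_on {0..1} (u z)"
proof -
  have "continuous_on {0..1} (\<lambda>t. (z, t))" by (intro continuous_intros)
  from continuous_on_compose2[OF assms(1) this] assms(2) show ?thesis by (simp add: image_subset_iff)
qed

lemma fiber_class_0:
  assumes "continuous_on (cball 0 1 \<times> {0..1}) (\<lambda>x. u (fst x) (snd x))"
  shows "fiber_class 0 u"
proof -
  have "continuous_on (cball 0 1) (\<lambda>z. integral {0..1} (\<lambda>t. u z t * rot (of_int (- n) * t)))" for n :: int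
    by (intro continuous_on_integral_01 continuous_intros assms)
  then show ?thesis unfolding fiber_class_def using assms by auto
qed

lemma fiber_class_add:
  assumes u: "fiber_class k u" and v: "fiber_class k v"
  shows "fiber_class k (\<lambda>z t. u z t + v z t)"
  unfolding fiber_class_def
proof (intro conjI allI impI)
  have cu: "continuous_on (cball 0 1 \<times> {0..1}) (\<lambda>x. u (fst x) (snd x))"
    and cv: "continuous_on (cball 0 1 \<times> {0..1}) (\<lambda>x. v (fst x) (snd x))"
    using u v by (auto simp: fiber_class_def)
  then show "continuous_on (cball 0 1 \<times> {0..1}) (\<lambda>x. u (fst x) (snd x) + v (fst x) (snd x))"
    by (intro continuous_intros)
  fix n assume n: "int k \<le> n"
  obtain G1 G2 where G: "continuous_on (cball 0 1) G1" "continuous_on (cball 0 1) G2"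
    "\<And>z. z \<in> cball 0 1 \<Longrightarrow> integral {0..1} (\<lambda>t. u z t * rot (of_int (- n) * t)) = of_real (height z) ^ k * G1 z"
    "\<And>z. z \<in> cball 0 1 \<Longrightarrow> integral {0..1} (\<lambda>t. v z t * rot (of_int (- n) * t)) = of_real (height z) ^ k * G2 z"
    using u v n unfolding fiber_class_def by meson
  have "integral {0..1} (\<lambda>t. (u z t + v z t) * rot (of_int (- n) * t)) = of_real (height z) ^ k * (G1 z + G2 z)"
    if z: "z \<in> cball 0 1" for z
  proof -
    have "(\<lambda>t. u z t * rot (of_int (- n) * t)) integrable_on {0..1}" "(\<lambda>t. v z t * rot (of_int (- n) * t)) integrable_on {0..1}"
      using fiber_class_slice[OF cu z] fiber_class_slice[OF cv z]
      by (auto intro!: integrable_continuous_real continuous_intros)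
    from integral_add[OF this] show ?thesis
      unfolding G(3)[OF z] G(4)[OF z] by (simp add: distrib_left distrib_right)
  qed
  then show "\<exists>G. continuous_on (cball 0 1) G \<and>
        (\<forall>z\<in>cball 0 1. integral {0..1} (\<lambda>t. (u z t + v z t) * rot (of_int (- n) * t)) = of_real (height z) ^ k * G z)"
    using G(1,2) by (intro exI[of _ "\<lambda>z. G1 z + G2 z"]) (auto intro!: continuous_intros)
qed

lemma fiber_class_mult:
  assumes u: "fiber_class k u" and q: "continuous_on (cball 0 1) q"
  shows "fiber_class k (\<lambda>z t. q z * u z t)"
  unfolding fiber_class_def
proof (intro conjI allI impI)
  have "continuous_on (cball 0 1 \<times> {0..1::real}) (\<lambda>x. q (fst x))"
    by (rule continuous_on_compose2[OF q]) (auto intro!: continuous_intros)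
  moreover have "continuous_on (cball 0 1 \<times> {0..1}) (\<lambda>x. u (fst x) (snd x))" using u by (simp add: fiber_class_def)
  ultimately show "continuous_on (cball 0 1 \<times> {0..1}) (\<lambda>x. q (fst x) * u (fst x) (snd x))"
    by (intro continuous_intros)
  fix n assume n: "int k \<le> n"
  obtain G where G: "continuous_on (cball 0 1) G"
    "\<And>z. z \<in> cball 0 1 \<Longrightarrow> integral {0..1} (\<lambda>t. u z t * rot (of_int (- n) * t)) = of_real (height z) ^ k * G z"
    using u n unfolding fiber_class_def by meson
  have "integral {0..1} (\<lambda>t. q z * u z t * rot (of_int (- n) * t)) = of_real (height z) ^ k * (q z * G z)"
    if z: "z \<in> cball 0 1" for z
    using G(2)[OF z] by (simp only: mult.assoc integral_mult_right) (simp add: mult_ac)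
  then show "\<exists>G. continuous_on (cball 0 1) G \<and>
        (\<forall>z\<in>cball 0 1. integral {0..1} (\<lambda>t. q z * u z t * rot (of_int (- n) * t)) = of_real (height z) ^ k * G z)"
    using G(1) q by (intro exI[of _ "\<lambda>z. q z * G z"]) (auto intro!: continuous_intros)
qed

text \<open>Multiplication by \<open>w\<close> or \<open>cnj w\<close> brings one power of the
  height and shifts the frequency by \<sigma>. From \<open>n \<ge> k + 1\<close> the shifted
  frequency \<open>n - \<sigma>\<close> is still at least \<open>k\<close>.\<close>

lemma fiber_class_rot:
  assumes u: "fiber_class k u" and \<sigma>: "\<sigma> \<in> {1, -1 :: int}"
  shows "fiber_class (Suc k) (\<lambda>z t. of_real (height z) * rot (of_int \<sigma> * t) * u z t)"
  unfolding fiber_class_def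
proof (intro conjI allI impI)
  have "continuous_on (cball 0 1 \<times> {0..1}) (\<lambda>x. u (fst x) (snd x))" using u by (simp add: fiber_class_def)
  then show "continuous_on (cball 0 1 \<times> {0..1}) (\<lambda>x. of_real (height (fst x)) * rot (of_int \<sigma> * snd x) * u (fst x) (snd x))"
    by (intro continuous_intros)
  fix n assume n: "int (Suc k) \<le> n"
  then have "int k \<le> n - \<sigma>" using \<sigma> by auto
  then obtain G where G: "continuous_on (cball 0 1) G"
    "\<And>z. z \<in> cball 0 1 \<Longrightarrow> integral {0..1} (\<lambda>t. u z t * rot (of_int (- (n - \<sigma>)) * t)) = of_real (height z) ^ k * G z"
    using u unfolding fiber_class_def by meson
  have "integral {0..1} (\<lambda>t. of_real (height z) * rot (of_int \<sigma> * t) * u z t * rot (of_int (- n) * t)) = of_real (height z) ^ Suc k * G z"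
    if z: "z \<in> cball 0 1" for z
  proof -
    have "rot (of_int (- (n - \<sigma>)) * t) = rot (of_int \<sigma> * t) * rot (of_int (- n) * t)" for t
      unfolding rot_add[symmetric] by (simp add: algebra_simps)
    then have "(\<lambda>t. of_real (height z) * rot (of_int \<sigma> * t) * u z t * rot (of_int (- n) * t)) =
       (\<lambda>t. of_real (height z) * (u z t * rot (of_int (- (n - \<sigma>)) * t)))"
      by (simp only: mult_ac)
    then show ?thesis using G(2)[OF z] by (simp only: integral_mult_right) simp
  qed
  then show "\<exists>G. continuous_on (cball 0 1) G \<and>
        (\<forall>z\<in>cball 0 1. integral {0..1} (\<lambda>t. of_real (height z) * rot (of_int \<sigma> * t) * u z t * rot (of_int (- n) * t)) = of_real (height z) ^ Suc k * G z)"
    using G(1) by blast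
qed

text \<open>Integration by parts in the angle.\<close>

lemma fiber_class_antiderivative:
  assumes cu: "continuous_on (cball 0 1 \<times> {0..1}) (\<lambda>x. u (fst x) (snd x))"
    and du: "\<And>z t. z \<in> cball 0 1 \<Longrightarrow> t \<in> {0..1} \<Longrightarrow> (u z has_vector_derivative u' z t) (at t within {0..1})"
    and per: "\<And>z. z \<in> cball 0 1 \<Longrightarrow> u z 1 = u z 0"
    and u': "fiber_class (Suc k) u'"
  shows "fiber_class (Suc k) u"
  unfolding fiber_class_def
proof (intro conjI allI impI cu)
  fix n assume n: "int (Suc k) \<le> n"
  obtain G where G: "continuous_on (cball 0 1) G"
    "\<And>z. z \<in> cball 0 1 \<Longrightarrow> integral {0..1} (\<lambda>t. u' z t * rot (of_int (- n) * t)) = of_real (height z) ^ Suc k * G z"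
    using u' n unfolding fiber_class_def by meson
  define P where "P = complex_of_real (2 * pi * of_int (- n)) * \<i>"
  have P: "P \<noteq> 0" using n by (simp add: P_def)
  have "integral {0..1} (\<lambda>t. u z t * rot (of_int (- n) * t)) = of_real (height z) ^ Suc k * (- G z / P)"
    if z: "z \<in> cball 0 1" for z
  proof -
    have cu': "continuous_on (cball 0 1 \<times> {0..1}) (\<lambda>x. u' (fst x) (snd x))" using u' by (simp add: fiber_class_def)
    have i: "(\<lambda>t. u' z t * rot (of_int (- n) * t)) integrable_on {0..1}" "(\<lambda>t. u z t * (P * rot (of_int (- n) * t))) integrable_on {0..1}"
      using fiber_class_slice[OF cu z] fiber_class_slice[OF cu' z]
      by (auto intro!: integrable_continuous_real continuous_intros)
    have "((\<lambda>t. u z t * (P * rot (of_int (- n) * t)) + u' z t * rot (of_int (- n) * t)) has_integral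
       (u z 1 * rot (of_int (- n) * 1) - u z 0 * rot (of_int (- n) * 0))) {0..1}"
      unfolding P_def
      by (intro fundamental_theorem_of_calculus has_vector_derivative_mult du z rot_has_vector_derivative) auto
    moreover have "rot (of_int (- n) * 1) = 1" by (simp del: of_int_minus)
    ultimately have "((\<lambda>t. u z t * (P * rot (of_int (- n) * t)) + u' z t * rot (of_int (- n) * t)) has_integral 0) {0..1}"
      using per[OF z] by simp
    then have "0 = integral {0..1} (\<lambda>t. u z t * (P * rot (of_int (- n) * t))) + integral {0..1} (\<lambda>t. u' z t * rot (of_int (- n) * t))"
      using integral_add[OF i(2,1)] by (simp add: integral_unique)
    also have "(\<lambda>t. u z t * (P * rot (of_int (- n) * t))) = (\<lambda>t. P * (u z t * rot (of_int (- n) * t)))"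
      by (simp only: mult_ac)
    finally have "P * integral {0..1} (\<lambda>t. u z t * rot (of_int (- n) * t)) = - (of_real (height z) ^ Suc k * G z)"
      unfolding G(2)[OF z] integral_mult_right by (simp add: eq_neg_iff_add_eq_0)
    then have "integral {0..1} (\<lambda>t. u z t * rot (of_int (- n) * t)) = - (of_real (height z) ^ Suc k * G z) / P"
      using P by (metis nonzero_mult_div_cancel_left)
    then show ?thesis by simp
  qed
  then show "\<exists>G. continuous_on (cball 0 1) G \<and>
        (\<forall>z\<in>cball 0 1. integral {0..1} (\<lambda>t. u z t * rot (of_int (- n) * t)) = of_real (height z) ^ Suc k * G z)"
    using G(1) P by (intro exI[of _ "\<lambda>z. - G z / P"]) (auto intro!: continuous_intros)
qed

section \<open>Angular derivatives of functions pulled back by a projective map\<close>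

lemma real_linear_complex2:
  fixes L :: "complex^2 \<Rightarrow> complex"
  assumes "bounded_linear L"
  shows "L x = (\<Sum>l\<in>UNIV. x $ l * ((L (axis l 1) - \<i> * L (axis l \<i>)) / 2) + cnj (x $ l) * ((L (axis l 1) + \<i> * L (axis l \<i>)) / 2))"
proof -
  interpret bounded_linear L by fact
  have "x = (\<Sum>l\<in>UNIV. Re (x $ l) *\<^sub>R axis l 1 + Im (x $ l) *\<^sub>R axis l \<i>)"
    by (simp add: vec_eq_iff sum_2 forall_2 axis_def complex_eq_iff)
  then have "L x = L (\<Sum>l\<in>UNIV. Re (x $ l) *\<^sub>R axis l 1 + Im (x $ l) *\<^sub>R axis l \<i>)" by simp
  also have "\<dots> = (\<Sum>l\<in>UNIV. Re (x $ l) *\<^sub>R L (axis l 1) + Im (x $ l) *\<^sub>R L (axis l \<i>))"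
    by (simp only: sum add scale)
  also have "\<dots> = (\<Sum>l\<in>UNIV. of_real (Re (x $ l)) * L (axis l 1) + of_real (Im (x $ l)) * L (axis l \<i>))"
    by (simp only: scaleR_conv_of_real)
  also have "\<dots> = (\<Sum>l\<in>UNIV. x $ l * ((L (axis l 1) - \<i> * L (axis l \<i>)) / 2) + cnj (x $ l) * ((L (axis l 1) + \<i> * L (axis l \<i>)) / 2))"
  proof (rule sum.cong[OF refl])
    fix l
    have re: "complex_of_real (Re (x $ l)) = (x $ l + cnj (x $ l)) / 2" by (simp add: complex_eq_iff)
    have im: "complex_of_real (Im (x $ l)) = - \<i> * (x $ l - cnj (x $ l)) / 2" by (simp add: complex_eq_iff)
    show "of_real (Re (x $ l)) * L (axis l 1) + of_real (Im (x $ l)) * L (axis l \<i>) =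
      x $ l * ((L (axis l 1) - \<i> * L (axis l \<i>)) / 2) + cnj (x $ l) * ((L (axis l 1) + \<i> * L (axis l \<i>)) / 2)"
      unfolding re im by (simp add: field_simps)
  qed
  finally show ?thesis .
qed

lemma fiber_class_sum:
  assumes "finite I" "I \<noteq> {}" "\<And>i. i \<in> I \<Longrightarrow> fiber_class k (u i)"
  shows "fiber_class k (\<lambda>z t. \<Sum>i\<in>I. u i z t)"
  using assms by (induction I rule: finite_ne_induct) (auto intro: fiber_class_add)

text \<open>A fractional linear map in homogeneous form, with denominator columns
  \<open>d0 d1 d2\<close> and numerator columns \<open>N0 N1 N2\<close>. The regularity of the fibre
  components depends only on the absence of zeros of the denominator; invariance of the sphere is
  added afterwards.\<close>

locale projective_map =
  fixes d0 d1 d2 :: complex and N0 N1 N2 :: "complex^2"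
  assumes den_nonzero: "(z, w) \<in> cball 0 1 \<Longrightarrow> d0 + z * d1 + w * d2 \<noteq> 0"
begin

definition den :: "complex \<times> complex \<Rightarrow> complex" where
  "den x = d0 + fst x * d1 + snd x * d2"

definition num :: "complex \<times> complex \<Rightarrow> complex^2" where
  "num x = N0 + fst x *s N1 + snd x *s N2"

definition \<phi> :: "complex \<times> complex \<Rightarrow> complex^2" where
  "\<phi> x = inverse (den x) *s num x"

lemma den_nz: "x \<in> cball 0 1 \<Longrightarrow> den x \<noteq> 0"
  using den_nonzero[of "fst x" "snd x"] by (simp add: den_def)

lemma continuous_on_scalar_left: "continuous_on S f \<Longrightarrow> continuous_on S (\<lambda>x. f x *s (v :: complex^2))"
  by (rule bounded_linear.continuous_on[OF bounded_linear_scalar_left])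

lemma \<phi>_alt: "\<phi> x = inverse (den x) *s (N0 + fst x *s N1) + (snd x * inverse (den x)) *s N2"
  by (simp add: \<phi>_def num_def vec_eq_iff algebra_simps)

lemma continuous_on_den [continuous_intros]:
  "continuous_on S f \<Longrightarrow> continuous_on S (\<lambda>x. den (f x))"
  unfolding den_def by (intro continuous_intros)

lemma continuous_on_\<phi>: "continuous_on (cball 0 1) \<phi>"
proof -
  have "\<phi> x = inverse (den x) *s N0 + (inverse (den x) * fst x) *s N1 + (snd x * inverse (den x)) *s N2" for x
    by (simp add: \<phi>_def num_def vec_eq_iff algebra_simps)
  then have "\<phi> = (\<lambda>x. inverse (den x) *s N0 + (inverse (den x) * fst x) *s N1 + (snd x * inverse (den x)) *s N2)"
    by blast
  then show ?thesis
    using den_nz by (auto intro!: continuous_intros continuous_on_scalar_left)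
qed

definition pt :: "complex \<Rightarrow> real \<Rightarrow> complex \<times> complex" where
  "pt z t = (z, of_real (height z) * rot t)"

lemma pt_sphere: "norm z \<le> 1 \<Longrightarrow> pt z t \<in> sphere 0 1"
  unfolding pt_def by (rule height_mem_sphere) auto

lemma pt_cball: "norm z \<le> 1 \<Longrightarrow> pt z t \<in> cball 0 1"
  using pt_sphere[of z t] by simp

lemma continuous_on_pt: "continuous_on S f \<Longrightarrow> continuous_on S g \<Longrightarrow> continuous_on S (\<lambda>x. pt (f x) (g x))"
  unfolding pt_def by (intro continuous_intros)

lemma den_pt_derivative:
  "((\<lambda>t. den (pt z t)) has_vector_derivative (2 * of_real pi * \<i> * d2 * (of_real (height z) * rot t))) (at t within S)"
proof -
  have "((\<lambda>t. d0 + z * d1 + of_real (height z) * rot (1 * t) * d2) has_vector_derivative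
      (0 + of_real (height z) * (of_real (2 * pi * 1) * \<i> * rot (1 * t)) * d2)) (at t within S)"
    by (intro has_vector_derivative_add has_vector_derivative_const has_vector_derivative_mult_left
         has_vector_derivative_mult_right rot_has_vector_derivative)
  then show ?thesis by (simp add: den_def pt_def mult_ac)
qed

lemma inverse_power_derivative:
  fixes u :: "real \<Rightarrow> complex"
  assumes "(u has_vector_derivative u') (at t within S)" "u t \<noteq> 0"
  shows "((\<lambda>t. inverse (u t) ^ i) has_vector_derivative (- of_nat i * inverse (u t) ^ (i + 1) * u')) (at t within S)"
proof -
  have "((\<lambda>w. inverse w ^ i) has_field_derivative (of_nat i * (- (inverse (u t) * 1 * inverse (u t)) * inverse (u t) ^ (i - Suc 0)))) (at (u t) within u ` S)"
    by (intro DERIV_power DERIV_inverse' DERIV_ident assms)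
  from field_vector_diff_chain_within[OF assms(1) this]
  have "((\<lambda>t. inverse (u t) ^ i) has_vector_derivative (u' * (of_nat i * (- (inverse (u t) * 1 * inverse (u t)) * inverse (u t) ^ (i - Suc 0))))) (at t within S)"
    by (simp add: o_def)
  moreover have "u' * (of_nat i * (- (inverse (u t) * 1 * inverse (u t)) * inverse (u t) ^ (i - Suc 0))) = - of_nat i * inverse (u t) ^ (i + 1) * u'"
    by (cases i) (simp_all add: algebra_simps)
  ultimately show ?thesis by (simp only:)
qed

text \<open>The derivative of \<open>\<phi>\<close> in \<open>w\<close> times
  \<open>den ^ 2\<close>. The quotient rule cancels \<open>w\<close> from it, so it is a continuous
  coefficient depending on \<open>z\<close> alone, as \<open>fiber_class_mult\<close>
  requires.\<close>

definition \<kappa> :: "complex \<Rightarrow> complex^2" where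
  "\<kappa> z = (d0 + z * d1) *s N2 - d2 *s (N0 + z *s N1)"

lemma \<phi>_pt_derivative:
  assumes z: "norm z \<le> 1"
  shows "((\<lambda>t. \<phi> (pt z t)) has_vector_derivative
     ((2 * of_real pi * \<i> * (of_real (height z) * rot t) * inverse (den (pt z t)) ^ 2) *s \<kappa> z)) (at t within S)"
proof -
  define w where "w t = of_real (height z) * rot t" for t
  define w' where "w' t = 2 * of_real pi * \<i> * w t" for t
  have dw: "(w has_vector_derivative w' t) (at t within S)"
  proof -
    have "((\<lambda>t. of_real (height z) * rot (1 * t)) has_vector_derivative (of_real (height z) * (of_real (2 * pi * 1) * \<i> * rot (1 * t)))) (at t within S)"
      by (intro has_vector_derivative_mult_right rot_has_vector_derivative)
    then show ?thesis by (simp add: w_def [abs_def] w'_def mult_ac)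
  qed
  define D where "D t = den (pt z t)" for t
  have Dw: "D t = d0 + z * d1 + w t * d2" by (simp add: D_def den_def pt_def w_def)
  have D: "D t \<noteq> 0" unfolding D_def by (intro den_nz pt_cball z)
  have dD: "(D has_vector_derivative (d2 * w' t)) (at t within S)"
    using den_pt_derivative[of z t S] by (simp add: D_def [abs_def] w'_def w_def mult_ac)
  have di: "((\<lambda>t. inverse (D t)) has_vector_derivative (- ((inverse (D t))\<^sup>2 * d2 * w' t))) (at t within S)"
    using inverse_power_derivative[OF dD D, of 1] by (simp add: power2_eq_square power_inverse mult_ac)
  have "((\<lambda>t. inverse (D t) *s (N0 + z *s N1) + (w t * inverse (D t)) *s N2) has_vector_derivative
     ((- ((inverse (D t))\<^sup>2 * d2 * w' t)) *s (N0 + z *s N1) + (w t * (- ((inverse (D t))\<^sup>2 * d2 * w' t)) + w' t * inverse (D t)) *s N2)) (at t within S)"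
    by (intro has_vector_derivative_add bounded_linear.has_vector_derivative[OF bounded_linear_scalar_left] has_vector_derivative_mult di dw)
  moreover have "w t * (- ((inverse (D t))\<^sup>2 * d2 * w' t)) + w' t * inverse (D t) = w' t * (inverse (D t))\<^sup>2 * (d0 + z * d1)"
  proof -
    have "w' t * inverse (D t) = w' t * (inverse (D t))\<^sup>2 * D t" using D by (simp add: power2_eq_square)
    then show ?thesis by (simp add: Dw algebra_simps)
  qed
  moreover have "(- ((inverse (D t))\<^sup>2 * d2 * w' t)) *s (N0 + z *s N1) + (w' t * (inverse (D t))\<^sup>2 * (d0 + z * d1)) *s N2
     = (w' t * (inverse (D t))\<^sup>2) *s \<kappa> z"
    by (simp add: \<kappa>_def vec_eq_iff algebra_simps)
  ultimately have "((\<lambda>t. inverse (D t) *s (N0 + z *s N1) + (w t * inverse (D t)) *s N2) has_vector_derivative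
     ((w' t * (inverse (D t))\<^sup>2) *s \<kappa> z)) (at t within S)" by (simp only:)
  moreover have "\<phi> (pt z t) = inverse (D t) *s (N0 + z *s N1) + (w t * inverse (D t)) *s N2" for t
    unfolding \<phi>_alt by (simp add: D_def w_def pt_def)
  ultimately show ?thesis by (simp add: w'_def w_def D_def)
qed

text \<open>Differentiation in the angle produces powers of the inverse denominator, and of its
  conjugate because \<open>F\<close> is not holomorphic. With both exponents free the family is
  closed under such derivatives.\<close>

definition twisted :: "(complex^2 \<Rightarrow> complex) \<Rightarrow> nat \<Rightarrow> nat \<Rightarrow> complex \<Rightarrow> real \<Rightarrow> complex" where
  "twisted F i j z t = F (\<phi> (pt z t)) * inverse (den (pt z t)) ^ i * cnj (inverse (den (pt z t)) ^ j)"

lemma continuous_on_twisted: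
  assumes F: "continuous_on U F" and U: "\<And>x. x \<in> sphere 0 1 \<Longrightarrow> \<phi> x \<in> U"
  shows "continuous_on (cball 0 1 \<times> {0..1}) (\<lambda>x. twisted F i j (fst x) (snd x))"
proof -
  have p: "continuous_on (cball 0 1 \<times> {0..1::real}) (\<lambda>x. pt (fst x) (snd x))"
    by (intro continuous_on_pt continuous_intros)
  have c: "continuous_on (cball 0 1 \<times> {0..1::real}) (\<lambda>x. \<phi> (pt (fst x) (snd x)))"
    by (rule continuous_on_compose2[OF continuous_on_\<phi> p]) (use pt_cball in \<open>auto simp only: mem_cball_0 mem_Times_iff image_subset_iff fst_conv snd_conv\<close>)
  have "continuous_on (cball 0 1 \<times> {0..1::real}) (\<lambda>x. F (\<phi> (pt (fst x) (snd x))))"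
    by (rule continuous_on_compose2[OF F c]) (auto intro!: U pt_sphere)
  moreover have "continuous_on (cball 0 1 \<times> {0..1::real}) (\<lambda>x. inverse (den (pt (fst x) (snd x))))"
    by (intro continuous_intros p) (auto intro!: den_nz pt_cball)
  ultimately show ?thesis
    unfolding twisted_def by (intro continuous_on_mult continuous_on_power continuous_on_cnj)
qed

text \<open>Everything depends on \<open>t\<close> through \<open>w\<close>, so the angular
  derivative has the form \<open>w * A + cnj w * B\<close>. Here \<open>A\<close> and
  \<open>B\<close> are combinations of twisted functions of \<open>F\<close> and its first
  derivatives, hence of class \<open>k\<close> by induction. The factors \<open>w\<close> and
  \<open>cnj w\<close> raise the class to \<open>Suc k\<close>, and integration by parts returns
  this gain to the function itself.\<close>

lemma fiber_class_twisted:
  assumes U: "\<And>x. x \<in> sphere 0 1 \<Longrightarrow> \<phi> x \<in> U" and F: "Ck_on k F U"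
  shows "fiber_class k (twisted F i j)"
  using F
proof (induction k arbitrary: F i j)
  case 0
  then show ?case by (intro fiber_class_0 continuous_on_twisted[OF _ U]) simp
next
  case (Suc k)
  define DF where "DF v x = frechet_derivative F (at x) v" for v x
  have CF: "Ck_on k F U" by (rule Ck_on_Suc_imp[OF Suc.prems])
  have CD: "Ck_on k (DF v) U" for v using Suc.prems by (simp add: DF_def [abs_def])
  have dF: "(F has_derivative (\<lambda>v. DF v x)) (at x)" if "x \<in> U" for x
    using Suc.prems that frechet_derivative_works[of F "at x"] by (simp add: DF_def [abs_def])
  define c where "c = 2 * complex_of_real pi * \<i>"
  have cc: "cnj c = - c" by (simp add: c_def)
  \<comment> \<open>\<open>A\<close> and \<open>B\<close> are the Wirtinger derivatives in
    \<open>w\<close> and \<open>cnj w\<close>, times \<open>c\<close> and \<open>- c\<close>, the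
    rates at which \<open>w\<close> and \<open>cnj w\<close> turn. The exponent rises by 2 through
    the derivative of \<open>\<phi>\<close> and by 1 through that of the twisting factor.\<close>
  define A where "A z t = (\<Sum>l\<in>UNIV. (c * \<kappa> z $ l / 2) * twisted (DF (axis l 1)) (i + 2) j z t + (- c * \<i> * \<kappa> z $ l / 2) * twisted (DF (axis l \<i>)) (i + 2) j z t)
     + (- of_nat i * c * d2) * twisted F (i + 1) j z t" for z t
  define B where "B z t = (\<Sum>l\<in>UNIV. (- c * cnj (\<kappa> z $ l) / 2) * twisted (DF (axis l 1)) i (j + 2) z t + (- c * \<i> * cnj (\<kappa> z $ l) / 2) * twisted (DF (axis l \<i>)) i (j + 2) z t)
     + (of_nat j * c * cnj d2) * twisted F i (j + 1) z t" for z t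
  have c\<kappa>: "continuous_on S (\<lambda>z. \<kappa> z $ l)" for S l
    unfolding \<kappa>_def by (simp, intro continuous_intros)
  have fA: "fiber_class k A" unfolding A_def
    by (intro fiber_class_add fiber_class_sum fiber_class_mult Suc.IH CF CD continuous_intros c\<kappa>) auto
  have fB: "fiber_class k B" unfolding B_def
    by (intro fiber_class_add fiber_class_sum fiber_class_mult Suc.IH CF CD continuous_intros c\<kappa>) auto
  define u' where "u' z t = of_real (height z) * rot (of_int 1 * t) * A z t + of_real (height z) * rot (of_int (- 1) * t) * B z t" for z t
  have fu': "fiber_class (Suc k) u'"
    unfolding u'_def by (intro fiber_class_add fiber_class_rot fA fB) auto
  show ?case
  proof (rule fiber_class_antiderivative[OF _ _ _ fu'])
    show "continuous_on (cball 0 1 \<times> {0..1}) (\<lambda>x. twisted F i j (fst x) (snd x))"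
      by (rule continuous_on_twisted[OF Ck_on_imp_continuous[OF Suc.prems] U])
    show "twisted F i j z 1 = twisted F i j z 0" for z by (simp add: twisted_def pt_def)
    fix z :: complex and t :: real assume "z \<in> cball 0 1"
    then have z: "norm z \<le> 1" by simp
    define S where "S = {0..1::real}"
    define w where "w = of_real (height z) * rot t"
    define I where "I = inverse (den (pt z t))"
    define y where "y = \<phi> (pt z t)"
    have y: "y \<in> U" unfolding y_def by (intro U pt_sphere z)
    have D: "den (pt z t) \<noteq> 0" by (intro den_nz pt_cball z)
    define L where "L v = DF v y" for v
    have bl: "bounded_linear L" unfolding L_def using dF[OF y] by (rule has_derivative_bounded_linear)
    define x where "x = (c * w * I ^ 2) *s \<kappa> z"
    have "((F \<circ> (\<lambda>t. \<phi> (pt z t))) has_vector_derivative L x) (at t within S)"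
    proof (rule vector_derivative_diff_chain_within)
      show "((\<lambda>t. \<phi> (pt z t)) has_vector_derivative x) (at t within S)"
        using \<phi>_pt_derivative[OF z, of t S] by (simp add: x_def w_def I_def c_def)
      show "(F has_derivative L) (at (\<phi> (pt z t)) within (\<lambda>t. \<phi> (pt z t)) ` S)"
        using dF[OF y] unfolding y_def L_def by (rule has_derivative_at_withinI)
    qed
    then have 1: "((\<lambda>t. F (\<phi> (pt z t))) has_vector_derivative L x) (at t within S)" by (simp add: o_def)
    have dd: "((\<lambda>t. den (pt z t)) has_vector_derivative (c * d2 * w)) (at t within S)"
      using den_pt_derivative[of z t S] by (simp add: c_def w_def mult_ac)
    have p: "((\<lambda>t. inverse (den (pt z t)) ^ n) has_vector_derivative (- of_nat n * I ^ (n + 1) * (c * d2 * w))) (at t within S)" for n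
      unfolding I_def by (rule inverse_power_derivative[OF dd D])
    have "((\<lambda>t. twisted F i j z t) has_vector_derivative
       (F y * I ^ i * cnj (- of_nat j * I ^ (j + 1) * (c * d2 * w)) + (F y * (- of_nat i * I ^ (i + 1) * (c * d2 * w)) + L x * I ^ i) * cnj (I ^ j))) (at t within S)"
      using has_vector_derivative_mult[OF has_vector_derivative_mult[OF 1 p[of i]] has_vector_derivative_cnj[OF p[of j]]]
      by (simp only: twisted_def y_def I_def)
    moreover have "F y * I ^ i * cnj (- of_nat j * I ^ (j + 1) * (c * d2 * w)) + (F y * (- of_nat i * I ^ (i + 1) * (c * d2 * w)) + L x * I ^ i) * cnj (I ^ j) = u' z t"
    proof -
      have tw: "twisted G m n z t = G y * I ^ m * cnj I ^ n" for G m n by (simp add: twisted_def y_def I_def)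
      have w1: "of_real (height z) * rot (of_int 1 * t) = w" by (simp add: w_def)
      have w2: "of_real (height z) * rot (of_int (- 1) * t) = cnj w" by (simp add: w_def rot_minus)
      \<comment> \<open>Splitting the real derivative into its complex linear and antilinear parts
        separates the terms with \<open>w\<close> from those with \<open>cnj w\<close>.\<close>
      have Lx: "L x = (\<Sum>l\<in>UNIV. x $ l * ((L (axis l 1) - \<i> * L (axis l \<i>)) / 2) + cnj (x $ l) * ((L (axis l 1) + \<i> * L (axis l \<i>)) / 2))"
        by (rule real_linear_complex2[OF bl])
      have xl: "x $ l = c * w * I ^ 2 * \<kappa> z $ l" "cnj (x $ l) = - (c * cnj w * cnj I ^ 2 * cnj (\<kappa> z $ l))" for l
        by (simp_all add: x_def cc)
      show ?thesis
        unfolding u'_def w1 w2 A_def B_def tw Lx xl sum_2 L_def[symmetric]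
        by (simp add: cc power_add power2_eq_square field_simps)
    qed
    ultimately show "(twisted F i j z has_vector_derivative u' z t) (at t within {0..1})"
      by (simp add: S_def)
  qed
qed

lemma smooth_fiber_regular:
  assumes f: "smooth_on f (sphere 0 1)" and sph: "\<And>x. x \<in> sphere 0 1 \<Longrightarrow> \<phi> x \<in> sphere 0 1"
  shows "\<exists>G. continuous_on (cball 0 1) G \<and>
    (\<forall>z\<in>cball 0 1. fiber_coeff (f \<circ> \<phi>) (- int n) z (of_real (height z)) = of_real (height z) ^ n * G z)"
proof -
  obtain U F where UF: "sphere 0 1 \<subseteq> U" "\<And>k. Ck_on k F U" "\<And>x. x \<in> sphere 0 1 \<Longrightarrow> F x = f x"
    using f unfolding smooth_on_def by blast
  have "fiber_class n (twisted F 0 0)"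
    by (rule fiber_class_twisted[of U]) (use UF sph in auto)
  then obtain G where G: "continuous_on (cball 0 1) G"
    "\<And>z. z \<in> cball 0 1 \<Longrightarrow> integral {0..1} (\<lambda>t. twisted F 0 0 z t * rot (of_int (- int n) * t)) = of_real (height z) ^ n * G z"
    unfolding fiber_class_def by blast
  have "fiber_coeff (f \<circ> \<phi>) (- int n) z (of_real (height z)) = of_real (height z) ^ n * G z" if z: "z \<in> cball 0 1" for z
  proof -
    have "F (\<phi> (pt z t)) = f (\<phi> (pt z t))" for t using z by (intro UF(3) sph pt_sphere) simp
    then have "fiber_coeff (f \<circ> \<phi>) (- int n) z (of_real (height z)) = integral {0..1} (\<lambda>t. twisted F 0 0 z t * rot (of_int (- int n) * t))"
      unfolding fiber_coeff_def twisted_def by (simp add: pt_def)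
    then show ?thesis using G(2)[OF z] by simp
  qed
  then show ?thesis using G(1) by blast
qed

end

section \<open>Automorphisms of the ball\<close>

definition herm :: "complex^2 \<Rightarrow> complex^2 \<Rightarrow> complex" where
  "herm x y = x $ 1 * cnj (y $ 1) + x $ 2 * cnj (y $ 2)"

lemma norm_vec2: "(norm x)\<^sup>2 = (norm (x $ 1))\<^sup>2 + (norm (x $ 2))\<^sup>2" for x :: "complex^2"
  by (simp add: norm_vec_def L2_set_def sum_2)

lemma herm_self: "herm x x = of_real ((norm x)\<^sup>2)"
  unfolding herm_def norm_vec2 of_real_add complex_norm_square ..

text \<open>The columns \<open>(d0, N0)\<close>, \<open>(d1, N1)\<close>, \<open>(d2, N2)\<close> form a basis of \<open>\<complex>\<^sup>3\<close> that is orthonormal for the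
  Hermitian form of signature \<open>(1, 2)\<close>, so that the projective map preserves the ball.\<close>

locale ball_automorphism =
  fixes d0 d1 d2 :: complex and N0 N1 N2 :: "complex^2"
  assumes n00: "d0 * cnj d0 - herm N0 N0 = 1"
    and n11: "d1 * cnj d1 - herm N1 N1 = - 1"
    and n22: "d2 * cnj d2 - herm N2 N2 = - 1"
    and n10: "d1 * cnj d0 - herm N1 N0 = 0"
    and n20: "d2 * cnj d0 - herm N2 N0 = 0"
    and n21: "d2 * cnj d1 - herm N2 N1 = 0"
begin

lemma n01: "d0 * cnj d1 - herm N0 N1 = 0" and n02: "d0 * cnj d2 - herm N0 N2 = 0" and n12: "d1 * cnj d2 - herm N1 N2 = 0"
  using arg_cong[OF n10, of cnj] arg_cong[OF n20, of cnj] arg_cong[OF n21, of cnj]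
  by (simp_all add: herm_def mult.commute)

lemma form_identity:
  "(d0 + z * d1 + w * d2) * cnj (d0 + z * d1 + w * d2) - herm (N0 + z *s N1 + w *s N2) (N0 + z *s N1 + w *s N2)
     = 1 - z * cnj z - w * cnj w"
proof -
  have "(d0 + z * d1 + w * d2) * cnj (d0 + z * d1 + w * d2) - herm (N0 + z *s N1 + w *s N2) (N0 + z *s N1 + w *s N2)
    = (d0 * cnj d0 - herm N0 N0) + cnj z * (d0 * cnj d1 - herm N0 N1) + cnj w * (d0 * cnj d2 - herm N0 N2)
    + z * (d1 * cnj d0 - herm N1 N0) + z * cnj z * (d1 * cnj d1 - herm N1 N1) + z * cnj w * (d1 * cnj d2 - herm N1 N2)
    + w * (d2 * cnj d0 - herm N2 N0) + w * cnj z * (d2 * cnj d1 - herm N2 N1) + w * cnj w * (d2 * cnj d2 - herm N2 N2)"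
    by (simp add: herm_def algebra_simps)
  then show ?thesis by (simp add: n00 n11 n22 n10 n20 n21 n01 n02 n12)
qed

lemma form_identity_real:
  "(norm (d0 + z * d1 + w * d2))\<^sup>2 - (norm (N0 + z *s N1 + w *s N2))\<^sup>2 = 1 - (norm z)\<^sup>2 - (norm w)\<^sup>2"
proof -
  have "complex_of_real ((norm (d0 + z * d1 + w * d2))\<^sup>2 - (norm (N0 + z *s N1 + w *s N2))\<^sup>2) = of_real (1 - (norm z)\<^sup>2 - (norm w)\<^sup>2)"
    using form_identity[of z w] unfolding herm_self complex_norm_square of_real_diff of_real_1 by simp
  then show ?thesis by (simp only: of_real_eq_iff)
qed

text \<open>If the denominator vanished, the form identity would force the numerator to vanish too.
  The combination of the columns would then be the zero vector, but its product with the first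
  column is 1.\<close>

lemma den_nonzero_cball:
  assumes "(z, w) \<in> cball 0 1"
  shows "d0 + z * d1 + w * d2 \<noteq> 0"
proof
  assume d: "d0 + z * d1 + w * d2 = 0"
  have "(norm z)\<^sup>2 + (norm w)\<^sup>2 \<le> 1" using assms by (simp only: mem_cball_pair)
  then have "(norm (N0 + z *s N1 + w *s N2))\<^sup>2 \<le> 0"
    using form_identity_real[of z w] unfolding d norm_zero zero_power2 by linarith
  then have N: "N0 + z *s N1 + w *s N2 = 0" by simp
  have "(d0 + z * d1 + w * d2) * cnj d0 - herm (N0 + z *s N1 + w *s N2) N0
      = (d0 * cnj d0 - herm N0 N0) + z * (d1 * cnj d0 - herm N1 N0) + w * (d2 * cnj d0 - herm N2 N0)"
    by (simp add: herm_def algebra_simps)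
  then show False unfolding d N n00 n10 n20 by (simp add: herm_def)
qed

sublocale projective_map d0 d1 d2 N0 N1 N2
  by unfold_locales (rule den_nonzero_cball)

lemma norm_\<phi>:
  assumes "(z, w) \<in> cball 0 1"
  shows "(norm (den (z, w)))\<^sup>2 * (1 - (norm (\<phi> (z, w)))\<^sup>2) = 1 - (norm z)\<^sup>2 - (norm w)\<^sup>2"
proof -
  have "den (z, w) \<noteq> 0" by (rule den_nz[OF assms])
  then have "(norm (den (z, w)))\<^sup>2 * (norm (\<phi> (z, w)))\<^sup>2 = (norm (num (z, w)))\<^sup>2"
    by (simp add: \<phi>_def norm_vector_scalar_mult norm_inverse power_mult_distrib power_inverse)
  then show ?thesis using form_identity_real[of z w] by (simp add: den_def num_def algebra_simps)
qed

lemma \<phi>_sphere: "x \<in> sphere 0 1 \<Longrightarrow> \<phi> x \<in> sphere 0 1"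
proof -
  assume x: "x \<in> sphere 0 1"
  obtain z w where zw: "x = (z, w)" by (cases x)
  have c: "(z, w) \<in> cball 0 1" using x zw by simp
  have "(norm z)\<^sup>2 + (norm w)\<^sup>2 = 1" using x by (simp only: zw mem_sphere_pair)
  then have "(norm (den (z, w)))\<^sup>2 * (1 - (norm (\<phi> (z, w)))\<^sup>2) = 0" unfolding norm_\<phi>[OF c] by simp
  then have "(norm (\<phi> (z, w)))\<^sup>2 = 1" using den_nz[OF c] by simp
  then show ?thesis using zw by (simp add: power2_eq_1_iff) (smt (verit) norm_ge_zero)
qed

lemma \<phi>_ball: "x \<in> ball 0 1 \<Longrightarrow> \<phi> x \<in> ball 0 1"
proof -
  assume x: "x \<in> ball 0 1"
  obtain z w where zw: "x = (z, w)" by (cases x)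
  have c: "(z, w) \<in> cball 0 1" using x zw by simp
  have "(norm z)\<^sup>2 + (norm w)\<^sup>2 < 1" using x by (simp only: zw mem_ball_pair)
  then have "(norm (den (z, w)))\<^sup>2 * (1 - (norm (\<phi> (z, w)))\<^sup>2) > 0" unfolding norm_\<phi>[OF c] by simp
  then have "(norm (\<phi> (z, w)))\<^sup>2 < 1\<^sup>2" by (simp add: zero_less_mult_iff)
  then have "norm (\<phi> (z, w)) < 1" by (rule power2_less_imp_less) simp
  then show ?thesis using zw by simp
qed

lemma \<phi>_cball: "x \<in> cball 0 1 \<Longrightarrow> \<phi> x \<in> cball 0 1"
  using \<phi>_sphere[of x] \<phi>_ball[of x] by (cases "norm x = 1") auto

text \<open>The coordinates \<open>z0 y\<close>, \<open>z1 y\<close>, \<open>z2 y\<close> of the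
  vector \<open>(1, y)\<close> in the basis of the columns, found by pairing with each column; the
  last two change sign because these columns have square norm \<open>- 1\<close>. Their ratios give
  the inverse map.\<close>

definition z0 :: "complex^2 \<Rightarrow> complex" where "z0 y = cnj d0 - herm y N0"
definition z1 :: "complex^2 \<Rightarrow> complex" where "z1 y = herm y N1 - cnj d1"
definition z2 :: "complex^2 \<Rightarrow> complex" where "z2 y = herm y N2 - cnj d2"

definition \<psi> :: "complex^2 \<Rightarrow> complex \<times> complex" where
  "\<psi> y = (z1 y / z0 y, z2 y / z0 y)"

text \<open>Orthonormality says that the matrix \<open>L\<close> of conjugated columns, with signs,
  is a left inverse of \<open>M\<close>. For square matrices it is then a right inverse, and this is
  the expansion of \<open>(1, y)\<close>.\<close>

lemma expansion:
  "z0 y * d0 + z1 y * d1 + z2 y * d2 = 1" "z0 y *s N0 + z1 y *s N1 + z2 y *s N2 = y"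
proof -
  define M :: "complex^3^3" where "M = vector [vector [d0, d1, d2], vector [N0 $ 1, N1 $ 1, N2 $ 1], vector [N0 $ 2, N1 $ 2, N2 $ 2]]"
  define L :: "complex^3^3" where "L = vector [vector [cnj d0, - cnj (N0 $ 1), - cnj (N0 $ 2)],
     vector [- cnj d1, cnj (N1 $ 1), cnj (N1 $ 2)], vector [- cnj d2, cnj (N2 $ 1), cnj (N2 $ 2)]]"
  have "L ** M = mat 1"
    using n00 n11 n22 n10 n20 n21 n01 n02 n12
    by (simp add: vec_eq_iff forall_3 matrix_matrix_mult_def sum_3 L_def M_def mat_def herm_def algebra_simps)
  then have "M ** L = mat 1" by (simp add: matrix_left_right_inverse)
  define Y :: "complex^3" where "Y = vector [1, y $ 1, y $ 2]"
  have "M *v (L *v Y) = Y" by (simp add: matrix_vector_mul_assoc \<open>M ** L = mat 1\<close>)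
  moreover have "L *v Y = vector [z0 y, z1 y, z2 y]"
    by (simp add: vec_eq_iff forall_3 matrix_vector_mult_def sum_3 L_def Y_def z0_def z1_def z2_def herm_def algebra_simps)
  ultimately have "M *v vector [z0 y, z1 y, z2 y] = Y" by simp
  then show "z0 y * d0 + z1 y * d1 + z2 y * d2 = 1" "z0 y *s N0 + z1 y *s N1 + z2 y *s N2 = y"
    by (auto simp: vec_eq_iff forall_3 forall_2 matrix_vector_mult_def sum_3 M_def Y_def mult_ac)
qed

text \<open>Parseval's identity for the indefinite form: pairing the expansion of
  \<open>(1, y)\<close> with \<open>(1, y)\<close> itself.\<close>

lemma inverse_form_identity: "(norm (z0 y))\<^sup>2 - (norm (z1 y))\<^sup>2 - (norm (z2 y))\<^sup>2 = 1 - (norm y)\<^sup>2"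
proof -
  have "z0 y * cnj (z0 y) - z1 y * cnj (z1 y) - z2 y * cnj (z2 y)
     = z0 y * d0 + z1 y * d1 + z2 y * d2 - herm (z0 y *s N0 + z1 y *s N1 + z2 y *s N2) y"
    by (simp add: z0_def z1_def z2_def herm_def algebra_simps)
  then have "z0 y * cnj (z0 y) - z1 y * cnj (z1 y) - z2 y * cnj (z2 y) = 1 - of_real ((norm y)\<^sup>2)"
    unfolding expansion herm_self .
  then have "complex_of_real ((norm (z0 y))\<^sup>2 - (norm (z1 y))\<^sup>2 - (norm (z2 y))\<^sup>2) = of_real (1 - (norm y)\<^sup>2)"
    unfolding complex_norm_square[symmetric] by simp
  then show ?thesis by (simp only: of_real_eq_iff)
qed

lemma z0_nonzero:
  assumes "y \<in> cball 0 1"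
  shows "z0 y \<noteq> 0"
proof
  assume z: "z0 y = 0"
  have "(norm y)\<^sup>2 \<le> 1" using assms by (simp add: power_le_one)
  then have "(norm (z1 y))\<^sup>2 + (norm (z2 y))\<^sup>2 \<le> 0" using inverse_form_identity[of y] by (simp add: z)
  then have "z1 y = 0" "z2 y = 0" by (simp_all add: sum_power2_le_zero_iff)
  then show False using expansion(1)[of y] z by simp
qed

lemma \<psi>_props:
  assumes "y \<in> cball 0 1"
  shows "\<phi> (\<psi> y) = y" "(norm (fst (\<psi> y)))\<^sup>2 + (norm (snd (\<psi> y)))\<^sup>2 = 1 - (1 - (norm y)\<^sup>2) / (norm (z0 y))\<^sup>2"
proof -
  have nz: "z0 y \<noteq> 0" by (rule z0_nonzero[OF assms])
  have "den (\<psi> y) = (z0 y * d0 + z1 y * d1 + z2 y * d2) / z0 y"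
    using nz by (simp add: den_def \<psi>_def add_divide_distrib)
  then have den: "den (\<psi> y) = 1 / z0 y" by (simp only: expansion)
  have "num (\<psi> y) = (1 / z0 y) *s (z0 y *s N0 + z1 y *s N1 + z2 y *s N2)"
    using nz by (simp add: num_def \<psi>_def vec_eq_iff field_simps)
  then have num: "num (\<psi> y) = (1 / z0 y) *s y" by (simp only: expansion)
  show "\<phi> (\<psi> y) = y" using nz by (simp add: \<phi>_def den num)
  show "(norm (fst (\<psi> y)))\<^sup>2 + (norm (snd (\<psi> y)))\<^sup>2 = 1 - (1 - (norm y)\<^sup>2) / (norm (z0 y))\<^sup>2"
    using inverse_form_identity[of y] nz by (simp add: \<psi>_def norm_divide power_divide field_simps)
qed

lemma \<psi>_mem:
  "y \<in> sphere 0 1 \<Longrightarrow> \<psi> y \<in> sphere 0 1" "y \<in> ball 0 1 \<Longrightarrow> \<psi> y \<in> ball 0 1" "y \<in> cball 0 1 \<Longrightarrow> \<psi> y \<in> cball 0 1"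
proof -
  have p: "\<psi> y = (fst (\<psi> y), snd (\<psi> y))" by simp
  show "y \<in> sphere 0 1 \<Longrightarrow> \<psi> y \<in> sphere 0 1"
    by (subst p, unfold mem_sphere_pair, subst \<psi>_props(2)) auto
  show "y \<in> ball 0 1 \<Longrightarrow> \<psi> y \<in> ball 0 1"
    using z0_nonzero[of y] by (subst p, unfold mem_ball_pair, subst \<psi>_props(2)) (auto simp: abs_square_less_1)
  show "y \<in> cball 0 1 \<Longrightarrow> \<psi> y \<in> cball 0 1"
    by (subst p, unfold mem_cball_pair, subst \<psi>_props(2)) (auto simp: power_le_one)
qed

lemma herm_has_derivative: "((\<lambda>y. herm y N) has_derivative (\<lambda>h. herm h N)) (at y within S)"
  unfolding herm_def
  by (intro has_derivative_add has_derivative_mult_left bounded_linear_imp_has_derivative bounded_linear_vec_nth)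

lemma \<psi>_has_derivative:
  assumes "y \<in> cball 0 1"
  shows "\<exists>D1 D2. (\<psi> has_derivative (\<lambda>h. (D1 h, D2 h))) (at y within S) \<and>
     (\<forall>c h. D1 (c *s h) = c * D1 h) \<and> (\<forall>c h. D2 (c *s h) = c * D2 h)"
proof -
  have nz: "z0 y \<noteq> 0" by (rule z0_nonzero[OF assms])
  have d0: "(z0 has_derivative (\<lambda>h. - herm h N0)) (at y within S)"
    unfolding z0_def [abs_def] by (auto intro!: derivative_eq_intros herm_has_derivative)
  have d1: "(z1 has_derivative (\<lambda>h. herm h N1)) (at y within S)"
    unfolding z1_def [abs_def] by (auto intro!: derivative_eq_intros herm_has_derivative)
  have d2: "(z2 has_derivative (\<lambda>h. herm h N2)) (at y within S)"
    unfolding z2_def [abs_def] by (auto intro!: derivative_eq_intros herm_has_derivative)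
  define D where "D N u h = (herm h N * z0 y - u * (- herm h N0)) / (z0 y * z0 y)" for N u h
  have "(\<psi> has_derivative (\<lambda>h. (D N1 (z1 y) h, D N2 (z2 y) h))) (at y within S)"
    unfolding \<psi>_def [abs_def] D_def
    by (intro has_derivative_Pair has_derivative_divide'[OF d1 d0 nz] has_derivative_divide'[OF d2 d0 nz])
  moreover have "herm (c *s h) N = c * herm h N" for c h N by (simp add: herm_def algebra_simps)
  then have "D N u (c *s h) = c * D N u h" for N u c h
    using nz by (simp add: D_def field_simps)
  ultimately show ?thesis by (intro exI[of _ "D N1 (z1 y)"] exI[of _ "D N2 (z2 y)"]) simp
qed

lemma continuous_on_\<psi>: "continuous_on (cball 0 1) \<psi>"
  unfolding continuous_on_eq_continuous_within
  using \<psi>_has_derivative has_derivative_continuous by blast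

lemma transfer_extension:
  assumes F: "continuous_on (cball 0 1) F" "\<And>x. x \<in> sphere 0 1 \<Longrightarrow> F x = f (\<phi> x)"
    and dF: "\<And>x. x \<in> ball 0 1 \<Longrightarrow> \<exists>A B. (F has_derivative (\<lambda>(s, t). A * s + B * t)) (at x)"
  shows "extends_holomorphically_through_ball f"
  unfolding extends_holomorphically_through_ball_def
proof (intro exI[of _ "F \<circ> \<psi>"] conjI ballI)
  show "continuous_on (cball 0 1) (F \<circ> \<psi>)"
    by (rule continuous_on_compose[OF continuous_on_\<psi>]) (use \<psi>_mem(3) in \<open>auto intro: continuous_on_subset[OF F(1)]\<close>)
  fix y :: "complex^2" assume y: "y \<in> sphere 0 1"
  have "y \<in> cball 0 1" using y by simp
  then show "(F \<circ> \<psi>) y = f y" using F(2)[OF \<psi>_mem(1)[OF y]] \<psi>_props(1)[of y] by simp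
next
  show "holomorphic_in_on (F \<circ> \<psi>) (ball 0 1)"
    unfolding holomorphic_in_on_def
  proof
    fix y :: "complex^2" assume y: "y \<in> ball 0 1"
    then have "y \<in> cball 0 1" by simp
    then obtain D1 D2 where D: "(\<psi> has_derivative (\<lambda>h. (D1 h, D2 h))) (at y within ball 0 1)"
      "\<And>c h. D1 (c *s h) = c * D1 h" "\<And>c h. D2 (c *s h) = c * D2 h"
      using \<psi>_has_derivative by meson
    obtain A B where AB: "(F has_derivative (\<lambda>(s, t). A * s + B * t)) (at (\<psi> y))"
      using dF[OF \<psi>_mem(2)[OF y]] by blast
    have "(F \<circ> \<psi> has_derivative (\<lambda>(s, t). A * s + B * t) \<circ> (\<lambda>h. (D1 h, D2 h))) (at y within ball 0 1)"
      by (rule diff_chain_within[OF D(1) has_derivative_at_withinI[OF AB]])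
    then show "\<exists>D. (F \<circ> \<psi> has_derivative D) (at y within ball 0 1) \<and> (\<forall>c w. D (c *s w) = c * D w)"
      by (intro exI conjI, assumption) (simp add: D(2,3) algebra_simps)
  qed
qed

end

section \<open>Lines through the two points under the automorphism\<close>

context ball_automorphism
begin

text \<open>The assumption on \<open>p\<close> says, without division, that \<open>(a, 0)\<close> is
  sent to \<open>p\<close>. The explicit formula shows both that the image lies on a line through
  \<open>p\<close> and that the parameter on it is a fractional linear, hence holomorphic, function
  of \<open>z\<close>.\<close>

lemma line_image:
  assumes P: "N0 + of_real a *s N1 = (d0 + of_real a * d1) *s p"
    and x: "(z, c * (z - of_real a)) \<in> cball 0 1"
  shows "\<phi> (z, c * (z - of_real a)) =
    p + ((z - of_real a) / den (z, c * (z - of_real a))) *s ((N1 + c *s N2) - (d1 + c * d2) *s p)"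
proof -
  define D where "D = den (z, c * (z - of_real a))"
  have D: "D \<noteq> 0" unfolding D_def by (rule den_nz[OF x])
  have D_eq: "D = (d0 + of_real a * d1) + (z - of_real a) * (d1 + c * d2)"
    by (simp add: D_def den_def algebra_simps)
  have "num (z, c * (z - of_real a)) = (N0 + of_real a *s N1) + (z - of_real a) *s (N1 + c *s N2)"
    by (simp add: num_def vec_eq_iff algebra_simps)
  also have "\<dots> = D *s p + (z - of_real a) *s ((N1 + c *s N2) - (d1 + c * d2) *s p)"
    unfolding P D_eq by (simp add: vec_eq_iff algebra_simps)
  finally have "\<phi> (z, c * (z - of_real a)) = inverse D *s (D *s p + (z - of_real a) *s ((N1 + c *s N2) - (d1 + c * d2) *s p))"
    by (simp add: \<phi>_def D_def)
  also have "\<dots> = p + ((z - of_real a) / D) *s ((N1 + c *s N2) - (d1 + c * d2) *s p)"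
    using D by (simp add: vec_eq_iff field_simps)
  finally show ?thesis by (simp add: D_def)
qed

text \<open>Composed with \<open>\<phi>\<close>, the extension along the image line is a function of
  \<open>z\<close> that is continuous on the closed disc bounded by the circle, holomorphic inside,
  and equal to \<open>f \<circ> \<phi>\<close> on the circle. Cauchy's theorem gives the vanishing
  integrals.\<close>

lemma annihilates_lines_of_extension:
  assumes a: "\<bar>a\<bar> \<le> 1"
    and P: "N0 + of_real a *s N1 = (d0 + of_real a * d1) *s p"
    and ext: "\<And>L. L \<in> complex_lines_through p \<Longrightarrow> L \<inter> ball 0 1 \<noteq> {} \<Longrightarrow> extends_holomorphically_along f L"
  shows "annihilates_lines (f \<circ> \<phi>) a"
  unfolding annihilates_lines_def
proof (intro ballI allI impI)
  fix l :: real and c :: complex and h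
  assume l: "l \<in> {0<..<1}" and c: "(norm c)\<^sup>2 * (1 - l) = l"
    and ch: "continuous_on (cball 0 1) h" and hh: "h holomorphic_on ball 0 1"
  define x where "x z = (z, c * (z - of_real a))" for z
  define r where "r = circle_radius a l"
  define m where "m = complex_of_real (l * a)"
  have l01: "0 \<le> l" "l \<le> 1" using l by auto
  have r2: "r\<^sup>2 = (1 - l) * (1 - l * a\<^sup>2)" using circle_radius_facts(3)[OF a l01] by (simp add: r_def)
  have "l < 1" using l by simp
  then have "l * a\<^sup>2 < 1" using circle_radius_facts(1)[OF a l01] by linarith
  then have r: "r > 0" unfolding r_def circle_radius_def using l by auto
  \<comment> \<open>Completing the square: the disc of centre \<open>m\<close> and radius
    \<open>r\<close> is exactly the projection of the part of the line inside the ball.\<close>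
  have cond: "(1 - l) * (1 - (norm z)\<^sup>2 - (norm (c * (z - of_real a)))\<^sup>2) = r\<^sup>2 - (norm (z - m))\<^sup>2" for z
  proof -
    have "(1 - l) * (norm (c * (z - of_real a)))\<^sup>2 = ((norm c)\<^sup>2 * (1 - l)) * (norm (z - of_real a))\<^sup>2"
      by (simp add: norm_mult power_mult_distrib mult_ac)
    then have "(1 - l) * (norm (c * (z - of_real a)))\<^sup>2 = l * (norm (z - of_real a))\<^sup>2" by (simp only: c)
    then have "(1 - l) * (1 - (norm z)\<^sup>2 - (norm (c * (z - of_real a)))\<^sup>2) =
        (1 - l) - (1 - l) * (norm z)\<^sup>2 - l * (norm (z - of_real a))\<^sup>2"
      by (simp only: right_diff_distrib mult_1_right)
    also have "\<dots> = (1 - l) * (1 - l * a\<^sup>2) - (norm (z - m))\<^sup>2"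
      unfolding m_def cmod_power2 by (simp add: power2_eq_square algebra_simps)
    finally show ?thesis by (simp only: r2)
  qed
  have xb: "x z \<in> ball 0 1" if "z \<in> ball m r" for z
  proof -
    have "(norm (z - m))\<^sup>2 < r\<^sup>2" using that by (intro power_strict_mono) (auto simp: dist_norm norm_minus_commute)
    then have "(1 - l) * (1 - (norm z)\<^sup>2 - (norm (c * (z - of_real a)))\<^sup>2) > 0" by (simp only: cond)
    then have "1 - (norm z)\<^sup>2 - (norm (c * (z - of_real a)))\<^sup>2 > 0" using l by (simp only: zero_less_mult_iff) auto
    then show ?thesis unfolding x_def mem_ball_pair by simp
  qed
  have xc: "x z \<in> cball 0 1" if "z \<in> cball m r" for z
  proof -
    have "(norm (z - m))\<^sup>2 \<le> r\<^sup>2" using that by (intro power_mono) (auto simp: dist_norm norm_minus_commute)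
    then have "(1 - l) * (1 - (norm z)\<^sup>2 - (norm (c * (z - of_real a)))\<^sup>2) \<ge> 0" by (simp only: cond)
    then have "1 - (norm z)\<^sup>2 - (norm (c * (z - of_real a)))\<^sup>2 \<ge> 0" using l by (simp only: zero_le_mult_iff) auto
    then show ?thesis unfolding x_def mem_cball_pair by simp
  qed
  have cp: "circle_point a l t = m + of_real r * rot t" for t by (simp add: circle_point_def m_def r_def)
  have xs: "x (circle_point a l t) \<in> sphere 0 1" for t
    using circle_point_on_line[of a l c t] a l c by (simp add: x_def)
  define v where "v = (N1 + c *s N2) - (d1 + c * d2) *s p"
  define \<zeta> where "\<zeta> z = (z - of_real a) / den (x z)" for z
  have img: "\<phi> (x z) = p + \<zeta> z *s v" if "z \<in> cball m r" for z
    using line_image[OF P, of z c] xc[OF that] by (simp add: x_def \<zeta>_def v_def)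
  \<comment> \<open>Otherwise the whole section would be mapped to \<open>p\<close>, although its
    boundary points go to the sphere and its interior points into the open ball.\<close>
  have v: "v \<noteq> 0"
  proof
    assume "v = 0"
    then have eq: "\<phi> (x z) = p" if "z \<in> cball m r" for z using img[OF that] by simp
    have "circle_point a l 0 \<in> cball m r" using r by (simp add: cp dist_norm)
    then have "norm p = 1" using \<phi>_sphere[OF xs[of 0]] eq by simp
    moreover have "m \<in> ball m r" "m \<in> cball m r" using r by auto
    then have "norm p < 1" using \<phi>_ball[OF xb[of m]] eq[of m] by simp
    ultimately show False by simp
  qed
  define L where "L = complex_line p v"
  have pL: "p \<in> L" unfolding L_def complex_line_def by (auto intro!: exI[of _ 0])
  then have L: "L \<in> complex_lines_through p" unfolding complex_lines_through_def L_def using v by blast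
  have inL: "\<phi> (x z) \<in> L" if "z \<in> cball m r" for z
    unfolding img[OF that] L_def complex_line_def by blast
  have "\<phi> (x m) \<in> L \<inter> ball 0 1" using inL[of m] \<phi>_ball[OF xb[of m]] r by auto
  then have "extends_holomorphically_along f L" using ext[OF L] by blast
  then obtain E where E: "continuous_on (L \<inter> cball 0 1) E" "\<And>y. y \<in> L \<inter> sphere 0 1 \<Longrightarrow> E y = f y"
      "holomorphic_in_on E (L \<inter> ball 0 1)"
    unfolding extends_holomorphically_along_def by blast
  have hE: "(\<lambda>\<zeta>. E (p + \<zeta> *s v)) holomorphic_on {\<zeta>. p + \<zeta> *s v \<in> ball 0 1}"
    using E(3) unfolding L_def holomorphic_in_on_line_iff[OF v] .
  define \<epsilon> where "\<epsilon> z = E (\<phi> (x z))" for z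
  have cx: "continuous_on S x" for S unfolding x_def by (intro continuous_intros)
  have c\<epsilon>: "continuous_on (cball m r) \<epsilon>"
    unfolding \<epsilon>_def
  proof (rule continuous_on_compose2[OF E(1)])
    show "continuous_on (cball m r) (\<lambda>z. \<phi> (x z))"
      by (rule continuous_on_compose2[OF continuous_on_\<phi> cx]) (use xc in auto)
    show "(\<lambda>z. \<phi> (x z)) ` cball m r \<subseteq> L \<inter> cball 0 1"
      using inL \<phi>_cball[OF xc] by blast
  qed
  have h\<epsilon>: "\<epsilon> holomorphic_on ball m r"
  proof -
    have "(\<lambda>z. den (x z)) holomorphic_on ball m r"
      unfolding den_def x_def by (simp, intro holomorphic_intros)
    moreover have "den (x z) \<noteq> 0" if "z \<in> ball m r" for z using that by (intro den_nz xc) simp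
    ultimately have h\<zeta>: "\<zeta> holomorphic_on ball m r" unfolding \<zeta>_def by (intro holomorphic_intros)
    have "\<zeta> ` ball m r \<subseteq> {\<zeta>. p + \<zeta> *s v \<in> ball 0 1}"
    proof
      fix w assume "w \<in> \<zeta> ` ball m r"
      then obtain z where z: "z \<in> ball m r" "w = \<zeta> z" by blast
      have "\<phi> (x z) = p + w *s v" using img[of z] z by simp
      then show "w \<in> {\<zeta>. p + \<zeta> *s v \<in> ball 0 1}" using \<phi>_ball[OF xb[OF z(1)]] by simp
    qed
    from holomorphic_on_compose_gen[OF h\<zeta> hE this]
    have "(\<lambda>z. E (p + \<zeta> z *s v)) holomorphic_on ball m r" by (simp add: o_def)
    then show ?thesis by (rule holomorphic_transform) (use img in \<open>auto simp: \<epsilon>_def\<close>)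
  qed
  have sub: "cball m r \<subseteq> cball 0 1" "ball m r \<subseteq> ball 0 1"
  proof -
    have "norm m + r \<le> 1" using circle_radius_facts(4)[OF a l01] l by (simp add: m_def r_def norm_mult abs_mult)
    then show "cball m r \<subseteq> cball 0 1" "ball m r \<subseteq> ball 0 1"
      by (auto simp: cball_subset_cball_iff ball_subset_ball_iff dist_norm)
  qed
  have "integral {0..1} (\<lambda>t. \<epsilon> (m + of_real r * rot t) * h (m + of_real r * rot t) * rot t) = 0"
    by (rule Cauchy_circle_rot[OF _ _ r])
       (auto intro!: continuous_intros holomorphic_intros c\<epsilon> h\<epsilon> continuous_on_subset[OF ch sub(1)] holomorphic_on_subset[OF hh sub(2)])
  moreover have "\<epsilon> (m + of_real r * rot t) = (f \<circ> \<phi>) (circle_point a l t, c * (circle_point a l t - of_real a))" for t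
  proof -
    have "circle_point a l t \<in> cball m r" using r by (simp add: cp dist_norm norm_mult)
    then have "\<phi> (x (circle_point a l t)) \<in> L \<inter> sphere 0 1" using inL \<phi>_sphere[OF xs] by blast
    then have "E (\<phi> (x (circle_point a l t))) = f (\<phi> (x (circle_point a l t)))" by (rule E(2))
    then show ?thesis by (simp add: \<epsilon>_def x_def cp)
  qed
  ultimately show "integral {0..1} (\<lambda>t. (f \<circ> \<phi>) (circle_point a l t, c * (circle_point a l t - of_real a)) * h (circle_point a l t) * rot t) = 0"
    by (simp only: cp)
qed

theorem extension_of_normalized:
  assumes f: "smooth_on f (sphere 0 1)"
    and ab: "-1 \<le> \<alpha>" "\<alpha> < 0" "0 < \<beta>" "\<beta> \<le> 1"
    and A: "N0 + of_real \<alpha> *s N1 = (d0 + of_real \<alpha> * d1) *s a"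
    and B: "N0 + of_real \<beta> *s N1 = (d0 + of_real \<beta> * d1) *s b"
    and ext: "\<And>L. L \<in> complex_lines_through a \<union> complex_lines_through b \<Longrightarrow> L \<inter> ball 0 1 \<noteq> {} \<Longrightarrow>
           extends_holomorphically_along f L"
  shows "extends_holomorphically_through_ball f"
proof -
  obtain U F where UF: "sphere 0 1 \<subseteq> U" "\<And>k. Ck_on k F U" "\<And>x. x \<in> sphere 0 1 \<Longrightarrow> F x = f x"
    using f unfolding smooth_on_def by blast
  have "continuous_on U F" by (rule Ck_on_imp_continuous[OF UF(2)])
  then have "continuous_on (sphere 0 1) F" using UF(1) continuous_on_subset by blast
  then have cf: "continuous_on (sphere 0 1) f" by (rule continuous_on_eq) (use UF(3) in blast)
  have "sphere (0 :: complex \<times> complex) 1 \<subseteq> cball 0 1" by auto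
  then have "continuous_on (sphere 0 1) \<phi>" using continuous_on_\<phi> continuous_on_subset by blast
  then have cf\<phi>: "continuous_on (sphere 0 1) (f \<circ> \<phi>)"
    by (rule continuous_on_compose) (use \<phi>_sphere in \<open>auto intro!: continuous_on_subset[OF cf] simp del: mem_sphere_0\<close>)
  have "annihilates_lines (f \<circ> \<phi>) \<alpha>" "annihilates_lines (f \<circ> \<phi>) \<beta>"
    using annihilates_lines_of_extension[OF _ A] annihilates_lines_of_extension[OF _ B] ext ab by auto
  from ball_extension_of_two_families[OF cf\<phi> ab this smooth_fiber_regular[OF f \<phi>_sphere]]
  obtain F where "continuous_on (cball 0 1) F" "\<And>x. x \<in> sphere 0 1 \<Longrightarrow> F x = f (\<phi> x)"
    "\<And>x. x \<in> ball 0 1 \<Longrightarrow> \<exists>A B. (F has_derivative (\<lambda>(s, t). A * s + B * t)) (at x)"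
    by auto
  then show ?thesis by (rule transfer_extension)
qed

end

section \<open>Normalisation of two points of the closed ball\<close>

lemma norm_diff_square_herm: "(norm (x - y))\<^sup>2 = (norm x)\<^sup>2 + (norm y)\<^sup>2 - 2 * Re (herm x y)"
  unfolding norm_vec2 herm_def cmod_power2 by (simp add: power2_eq_square algebra_simps)

lemma Lagrange_herm: "(norm x)\<^sup>2 * (norm y)\<^sup>2 - (norm (herm x y))\<^sup>2 = (norm (x $ 1 * y $ 2 - x $ 2 * y $ 1))\<^sup>2"
  unfolding norm_vec2 herm_def cmod_power2 by (simp add: power2_eq_square algebra_simps)

text \<open>The difference of the two sides is \<open>(norm (a - b)) ^ 2 * (1 - (norm a) ^ 2) +
  (norm (herm a (a - b))) ^ 2\<close>. If it vanished, \<open>a\<close> would lie on the sphere and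
  \<open>herm a b\<close> would be 1, so that
  \<open>(norm (a - b)) ^ 2 = (norm b) ^ 2 - 1 \<le> 0\<close>. Strictness covers boundary points
  and keeps the two normalised points apart.\<close>

lemma reversed_Cauchy_Schwarz:
  assumes a: "norm a \<le> 1" and b: "norm b \<le> 1" and ab: "a \<noteq> b"
  shows "(1 - (norm a)\<^sup>2) * (1 - (norm b)\<^sup>2) < (norm (1 - herm a b))\<^sup>2"
proof -
  have a2: "(norm a)\<^sup>2 \<le> 1" and b2: "(norm b)\<^sup>2 \<le> 1" using a b by (auto simp: power_le_one)
  have pos: "(norm (a - b))\<^sup>2 > 0" using ab by simp
  have "(norm (a $ 1 * (a - b) $ 2 - a $ 2 * (a - b) $ 1))\<^sup>2 = (norm a)\<^sup>2 * (norm (a - b))\<^sup>2 - (norm (herm a (a - b)))\<^sup>2"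
    by (rule Lagrange_herm[symmetric])
  moreover have "a $ 1 * (a - b) $ 2 - a $ 2 * (a - b) $ 1 = - (a $ 1 * b $ 2 - a $ 2 * b $ 1)"
    by (simp add: algebra_simps)
  ultimately have det: "(norm (a $ 1 * b $ 2 - a $ 2 * b $ 1))\<^sup>2 = (norm a)\<^sup>2 * (norm (a - b))\<^sup>2 - (norm (herm a (a - b)))\<^sup>2"
    by (simp only: norm_minus_cancel)
  have "(norm (1 - herm a b))\<^sup>2 = 1 - 2 * Re (herm a b) + (norm (herm a b))\<^sup>2"
    unfolding cmod_power2 by (simp add: power2_eq_square algebra_simps)
  then have "(norm (1 - herm a b))\<^sup>2 - (1 - (norm a)\<^sup>2) * (1 - (norm b)\<^sup>2) =
      (norm (a - b))\<^sup>2 - ((norm a)\<^sup>2 * (norm b)\<^sup>2 - (norm (herm a b))\<^sup>2)"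
    unfolding norm_diff_square_herm by (simp add: algebra_simps)
  also have "\<dots> = (norm (a - b))\<^sup>2 * (1 - (norm a)\<^sup>2) + (norm (herm a (a - b)))\<^sup>2"
    unfolding Lagrange_herm[of a b] det by (simp add: algebra_simps)
  finally have eq: "(norm (1 - herm a b))\<^sup>2 - (1 - (norm a)\<^sup>2) * (1 - (norm b)\<^sup>2) =
      (norm (a - b))\<^sup>2 * (1 - (norm a)\<^sup>2) + (norm (herm a (a - b)))\<^sup>2" .
  have "(norm (a - b))\<^sup>2 * (1 - (norm a)\<^sup>2) + (norm (herm a (a - b)))\<^sup>2 > 0"
  proof (cases "(norm a)\<^sup>2 = 1")
    case False
    then have "1 - (norm a)\<^sup>2 > 0" using a2 by simp
    then show ?thesis using pos by (intro add_pos_nonneg mult_pos_pos) auto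
  next
    case True
    have "herm a (a - b) \<noteq> 0"
    proof
      assume "herm a (a - b) = 0"
      moreover have "herm a (a - b) = herm a a - herm a b" by (simp add: herm_def algebra_simps)
      ultimately have "herm a b = 1" using True by (simp add: herm_self)
      then have "(norm (a - b))\<^sup>2 = (norm b)\<^sup>2 - 1" unfolding norm_diff_square_herm using True by simp
      then show False using pos b2 by linarith
    qed
    then show ?thesis using True by simp
  qed
  then show ?thesis using eq by linarith
qed

text \<open>The third column is the conjugate cross product of the first two.\<close>

lemma ball_automorphism_cross:
  assumes n00: "d0 * cnj d0 - herm N0 N0 = 1"
    and n11: "d1 * cnj d1 - herm N1 N1 = - 1"
    and n10: "d1 * cnj d0 - herm N1 N0 = 0"
  shows "ball_automorphism d0 d1 (cnj (N0 $ 1 * N1 $ 2 - N0 $ 2 * N1 $ 1)) N0 N1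
     (vector [cnj (d0 * N1 $ 2 - N0 $ 2 * d1), cnj (N0 $ 1 * d1 - d0 * N1 $ 1)])"
proof (unfold_locales, fact n00, fact n11)
  define d2 where "d2 = cnj (N0 $ 1 * N1 $ 2 - N0 $ 2 * N1 $ 1)"
  define N2 :: "complex^2" where "N2 = vector [cnj (d0 * N1 $ 2 - N0 $ 2 * d1), cnj (N0 $ 1 * d1 - d0 * N1 $ 1)]"
  have "d2 * cnj d2 - herm N2 N2 = (d0 * cnj d0 - herm N0 N0) * (d1 * cnj d1 - herm N1 N1)
     - (d1 * cnj d0 - herm N1 N0) * cnj (d1 * cnj d0 - herm N1 N0)"
    by (simp add: d2_def N2_def herm_def algebra_simps)
  then show "d2 * cnj d2 - herm N2 N2 = - 1" unfolding n00 n11 n10 by simp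
  show "d1 * cnj d0 - herm N1 N0 = 0" by fact
  show "d2 * cnj d0 - herm N2 N0 = 0" by (simp add: d2_def N2_def herm_def algebra_simps)
  show "d2 * cnj d1 - herm N2 N1 = 0" by (simp add: d2_def N2_def herm_def algebra_simps)
qed

text \<open>Gram-Schmidt in the real span of \<open>A = (1, a)\<close> and \<open>B = \<omega> (1, b)\<close>, where the phase \<open>\<omega>\<close> makes the
  product \<open>s\<close> of \<open>A\<close> and \<open>B\<close> positive: the first vector is proportional to \<open>A + B\<close>.\<close>

lemma ball_automorphism_normalizing:
  assumes a: "norm a \<le> 1" and b: "norm b \<le> 1" and ab: "a \<noteq> b"
  obtains d0 d1 d2 N0 N1 N2 \<alpha> \<beta> where "ball_automorphism d0 d1 d2 N0 N1 N2"
    "-1 \<le> \<alpha>" "\<alpha> < 0" "0 < \<beta>" "\<beta> \<le> 1"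
    "N0 + of_real \<alpha> *s N1 = (d0 + of_real \<alpha> * d1) *s a"
    "N0 + of_real \<beta> *s N1 = (d0 + of_real \<beta> * d1) *s b"
proof -
  define p where "p = 1 - (norm a)\<^sup>2"
  define q where "q = 1 - (norm b)\<^sup>2"
  define \<tau> where "\<tau> = 1 - herm a b"
  define s where "s = norm \<tau>"
  have pq: "p \<ge> 0" "q \<ge> 0" using a b by (auto simp: p_def q_def power_le_one)
  have lt: "p * q < s\<^sup>2" unfolding p_def q_def s_def \<tau>_def by (rule reversed_Cauchy_Schwarz[OF a b ab])
  then have "s\<^sup>2 > 0" using mult_nonneg_nonneg[OF pq] by linarith
  then have s: "s > 0" by (simp add: s_def)
  define \<omega> where "\<omega> = \<tau> / of_real s"
  define \<nu> where "\<nu> = sqrt (p + q + 2 * s)"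
  define \<delta> where "\<delta> = sqrt (s\<^sup>2 - p * q)"
  have \<nu>: "\<nu> > 0" "\<nu>\<^sup>2 = p + q + 2 * s" using pq s by (auto simp: \<nu>_def)
  have \<delta>: "\<delta> > 0" "\<delta>\<^sup>2 = s\<^sup>2 - p * q" using lt by (auto simp: \<delta>_def)
  have \<delta>s: "\<delta> \<le> s" by (rule power2_le_imp_le) (use \<delta> s mult_nonneg_nonneg[OF pq] in auto)
  have hA: "1 - herm a a = of_real p" and hB: "1 - herm b b = of_real q"
    by (simp_all add: herm_self p_def q_def)
  have \<tau>\<tau>: "\<tau> * cnj \<tau> = (of_real s)\<^sup>2" by (simp add: s_def complex_norm_square[symmetric])
  have \<omega>\<omega>: "\<omega> * cnj \<omega> = 1" using s \<tau>\<tau> by (simp add: \<omega>_def power2_eq_square)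
  have hAB: "cnj \<omega> * (1 - herm a b) = of_real s"
    using s \<tau>\<tau> unfolding \<tau>_def[symmetric] by (simp add: \<omega>_def power2_eq_square mult.commute)
  have hBA: "\<omega> * (1 - herm b a) = of_real s"
    using arg_cong[OF hAB, of cnj] by (simp add: herm_def mult.commute)
  define d where "d x y = of_real x + of_real y * \<omega>" for x y :: real
  define N where "N x y = of_real x *s a + (of_real y * \<omega>) *s b" for x y :: real
  have form: "d x y * cnj (d x' y') - herm (N x y) (N x' y') = of_real (x * x' * p + (x * y' + y * x') * s + y * y' * q)" for x y x' y'
  proof -
    have "d x y * cnj (d x' y') - herm (N x y) (N x' y') =
      of_real (x * x') * (1 - herm a a) + of_real (x * y') * (cnj \<omega> * (1 - herm a b))
      + of_real (y * x') * (\<omega> * (1 - herm b a)) + of_real (y * y') * (\<omega> * cnj \<omega>) * (1 - herm b b)"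
      by (simp add: d_def N_def herm_def algebra_simps)
    then show ?thesis unfolding hA hB hAB hBA \<omega>\<omega> by (simp add: algebra_simps)
  qed
  \<comment> \<open>\<open>\<nu>\<close> is the norm of \<open>A + B\<close>, whose products with
    \<open>A\<close> and \<open>B\<close> are \<open>p + s\<close> and \<open>q + s\<close>. Hence
    \<open>(p + s) * B - (q + s) * A\<close> is orthogonal to it. Its square norm is
    \<open>- \<delta> ^ 2 * \<nu> ^ 2\<close>, where \<open>\<delta> ^ 2\<close> is minus the Gram
    determinant of \<open>A\<close> and \<open>B\<close>.\<close>
  define c where "c = 1 / \<nu>"
  define e1 where "e1 = (p + s) / (\<delta> * \<nu>)"
  define e2 where "e2 = (q + s) / (\<delta> * \<nu>)"
  have "c * c * p + (c * c + c * c) * s + c * c * q = (p + q + 2 * s) / \<nu>\<^sup>2"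
    using \<nu>(1) by (simp add: c_def power2_eq_square field_simps)
  also have "\<dots> = 1" unfolding \<nu>(2)[symmetric] using \<nu>(1) by simp
  finally have n00: "d c c * cnj (d c c) - herm (N c c) (N c c) = 1" unfolding form by simp
  have "(- e2) * (- e2) * p + ((- e2) * e1 + e1 * (- e2)) * s + e1 * e1 * q
      = ((q + s)\<^sup>2 * p - 2 * (p + s) * (q + s) * s + (p + s)\<^sup>2 * q) / (\<delta>\<^sup>2 * \<nu>\<^sup>2)"
    using \<nu>(1) \<delta>(1) by (simp add: e1_def e2_def power2_eq_square field_simps)
  also have "\<dots> = - ((s\<^sup>2 - p * q) * (p + q + 2 * s)) / (\<delta>\<^sup>2 * \<nu>\<^sup>2)"
    by (simp add: power2_eq_square algebra_simps)
  also have "\<dots> = - 1" using \<nu>(1) \<delta>(1) unfolding \<nu>(2)[symmetric] \<delta>(2)[symmetric] by simp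
  finally have n11: "d (- e2) e1 * cnj (d (- e2) e1) - herm (N (- e2) e1) (N (- e2) e1) = - 1" unfolding form by simp
  have "(- e2) * c * p + ((- e2) * c + e1 * c) * s + e1 * c * q = 0"
    using \<nu>(1) \<delta>(1) by (simp add: e1_def e2_def c_def field_simps)
  then have n10: "d (- e2) e1 * cnj (d c c) - herm (N (- e2) e1) (N c c) = 0" unfolding form by simp
  \<comment> \<open>\<alpha> cancels the coefficient of \<open>B\<close> and \<beta> that of
    \<open>A\<close>, which leaves multiples of \<open>(1, a)\<close> and \<open>(1, b)\<close>. The
    bound \<open>\<delta> \<le> s\<close> keeps both in the closed unit interval; an end value can
    occur only if a point lies on the sphere.\<close>
  define \<alpha> where "\<alpha> = - \<delta> / (p + s)"
  define \<beta> where "\<beta> = \<delta> / (q + s)"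
  have cancel: "\<delta> / P * (P / (\<delta> * \<nu>)) = 1 / \<nu>" if "P \<noteq> 0" for P
    using that \<nu>(1) \<delta>(1) by (simp add: field_simps)
  have "c + \<alpha> * e1 = 0" "c + \<beta> * (- e2) = 0"
    using cancel[of "p + s"] cancel[of "q + s"] s pq by (simp_all add: c_def \<alpha>_def \<beta>_def e1_def e2_def)
  moreover have "d c c + of_real k * d (- e2) e1 = d (c + k * (- e2)) (c + k * e1)"
      "N c c + of_real k *s N (- e2) e1 = N (c + k * (- e2)) (c + k * e1)" for k
    by (simp_all add: d_def N_def vec_eq_iff algebra_simps)
  moreover have "N x 0 = d x 0 *s a" "N 0 x = d 0 x *s b" for x by (simp_all add: N_def d_def)
  ultimately have "N c c + of_real \<alpha> *s N (- e2) e1 = (d c c + of_real \<alpha> * d (- e2) e1) *s a"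
    "N c c + of_real \<beta> *s N (- e2) e1 = (d c c + of_real \<beta> * d (- e2) e1) *s b" by simp_all
  moreover have "-1 \<le> \<alpha>" "\<alpha> < 0" "0 < \<beta>" "\<beta> \<le> 1"
    using \<delta>(1) \<delta>s s pq by (auto simp: \<alpha>_def \<beta>_def divide_simps)
  ultimately show ?thesis
    using that[OF ball_automorphism_cross[OF n00 n11 n10]] by blast
qed

theorem theorem1p1:
  fixes a b :: "complex^2" and f :: "complex^2 \<Rightarrow> complex"
  assumes "a \<in> cball 0 1" and "b \<in> cball 0 1" and "a \<noteq> b"
    and "smooth_on f (sphere 0 1)"
    and "\<And>L. L \<in> complex_lines_through a \<union> complex_lines_through b \<Longrightarrow> L \<inter> ball 0 1 \<noteq> {} \<Longrightarrow>
           extends_holomorphically_along f L"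
  shows "extends_holomorphically_through_ball f"
proof -
  have "norm a \<le> 1" "norm b \<le> 1" using assms(1,2) by auto
  then obtain d0 d1 d2 N0 N1 N2 \<alpha> \<beta> where aut: "ball_automorphism d0 d1 d2 N0 N1 N2"
    and ab: "-1 \<le> \<alpha>" "\<alpha> < 0" "0 < \<beta>" "\<beta> \<le> 1"
    and A: "N0 + of_real \<alpha> *s N1 = (d0 + of_real \<alpha> * d1) *s a"
    and B: "N0 + of_real \<beta> *s N1 = (d0 + of_real \<beta> * d1) *s b"
    using ball_automorphism_normalizing[OF _ _ assms(3)] by metis
  show ?thesis
    by (rule ball_automorphism.extension_of_normalized[OF aut assms(4) ab A B assms(5)])
qed

end
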